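(* Let $N\ge2$, $\alpha\in(0,1)$ and $p\in(0,\frac{N}{N-2\alpha})$. For $k>0$ let $u_k$ be the unique weak solution of $$(-\Delta)^\alpha u+u^p=k\delta_0\ \text{ in }\mathbb{R}^N,\qquad\lim_{|x|\to+\infty}u(x)=0 ,$$ and set $u_\infty(x)=\lim_{k\to\infty}u_k(x)\in\mathbb{R}_+\cup\{+\infty\}$ for $x\in\mathbb{R}^N$. Then: (i) if $p\in(0,1+\frac{2\alpha}{N}]$, then $u_\infty(x)=\infty$ for all $x\in\mathbb{R}^N$; (ii) if $p\in(1+\frac{2\alpha}{N},\frac{N}{N-2\alpha})$, then $u_\infty$ is a classical solution of $(-\Delta)^\alpha u+u^p=0$ in $\mathbb{R}^N\setminus\{0\}$, and there exists $c_3>0$ such that $$u_\infty(x)=c_3|x|^{-\frac{2\alpha}{p-1}}\qquad\text{for all }x\in\mathbb{R}^N\setminus\{0\}.$$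
   Context: $\delta_0$ is the Dirac mass at the origin, $d\omega(x)=\frac{dx}{1+|x|^{N+2\alpha}}$. Fractional Laplacian: for $\epsilon>0$, $(-\Delta)^\alpha_\epsilon u(x)=-\int_{\{|z-x|>\epsilon\}}\frac{u(z)-u(x)}{|z-x|^{N+2\alpha}}\,dz$, and $(-\Delta)^\alpha u(x)=\lim_{\epsilon\to0^+}(-\Delta)^\alpha_\epsilon u(x)$ (no normalizing constant). Test functions: $\mathbb{X}_{\mathbb{R}^N}\subset C(\mathbb{R}^N)$ is the space of functions $\xi$ such that (i) $\xi$ has compact support; (ii) $(-\Delta)^\alpha\xi(x)$ exists for every $x\in\mathbb{R}^N$ and there is $C>0$ with $|(-\Delta)^\alpha\xi(x)|\le\frac{C}{1+|x|^{N+2\alpha}}$ for all $x$; (iii) there exist $\varphi\in L^1(\mathbb{R}^N)$ and $\epsilon_0>0$ such that $|(-\Delta)^\alpha_\epsilon\xi|\le\varphi$ a.e. in $\mathbb{R}^N$ for all $\epsilon\in(0,\epsilon_0]$. Weak solution of the problem: a nonnegative function $u\in L^1(\mathbb{R}^N,d\omega)$ with $u^p\in L^1(\mathbb{R}^N,d\omega)$, $\lim_{|x|\to\infty}u(x)=0$, and $\int_{\mathbb{R}^N}[u(-\Delta)^\alpha\xi+u^p\xi]\,dx=k\xi(0)$ for all $\xi\in\mathbb{X}_{\mathbb{R}^N}$. For $p\in(0,\frac{N}{N-2\alpha})$ this weak solution $u_k$ exists, is unique, is a classical solution of $(-\Delta)^\alpha u+u^p=0$ in $\mathbb{R}^N\setminus\{0\}$,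 satisfies $\lim_{x\to0}u_k(x)=+\infty$, and is nondecreasing in $k$. Pointwise values refer to the continuous representative in $\mathbb{R}^N\setminus\{0\}$, with the convention $u_k(0)=+\infty$. Classical solution in $\mathbb{R}^N\setminus\{0\}$: $u$ is continuous in $\mathbb{R}^N\setminus\{0\}$, $(-\Delta)^\alpha u(x)$ is well defined at every $x\ne0$, and the equation holds pointwise there. *)

theory Defs
  imports "HOL-Analysis.Analysis"
begin

definition omega_measure :: "real \<Rightarrow> (real^'n) measure" where
  "omega_measure \<alpha> =
     density lebesgue (\<lambda>x::real^'n. ennreal (1 / (1 + norm x powr (real CARD('n) + 2 * \<alpha>))))"

definition frac_kernel :: "real \<Rightarrow> (real^'n \<Rightarrow> real) \<Rightarrow> real^'n \<Rightarrow> real^'n \<Rightarrow> real" where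
  "frac_kernel \<alpha> u x z = (u z - u x) / norm (z - x) powr (real CARD('n) + 2 * \<alpha>)"

definition frac_lap_eps :: "real \<Rightarrow> real \<Rightarrow> (real^'n \<Rightarrow> real) \<Rightarrow> real^'n \<Rightarrow> real" where
  "frac_lap_eps \<alpha> \<epsilon> u x = - (LINT z:{z. norm (z - x) > \<epsilon>}|lebesgue. frac_kernel \<alpha> u x z)"

(* The Bochner integral is 0 on non-integrable functions, so integrability of the truncated
   integrands is required explicitly; otherwise divergent integrals would count as existing. *)
definition frac_lap_exists :: "real \<Rightarrow> (real^'n \<Rightarrow> real) \<Rightarrow> real^'n \<Rightarrow> bool" where
  "frac_lap_exists \<alpha> u x \<longleftrightarrow>
     (\<forall>\<epsilon>>0. set_integrable lebesgue {z. norm (z - x) > \<epsilon>} (frac_kernel \<alpha> u x)) \<and>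
     (\<exists>l. ((\<lambda>\<epsilon>. frac_lap_eps \<alpha> \<epsilon> u x) \<longlongrightarrow> l) (at_right 0))"

(* Meaningful only where frac_lap_exists holds. *)
definition frac_lap :: "real \<Rightarrow> (real^'n \<Rightarrow> real) \<Rightarrow> real^'n \<Rightarrow> real" where
  "frac_lap \<alpha> u x = Lim (at_right 0) (\<lambda>\<epsilon>. frac_lap_eps \<alpha> \<epsilon> u x)"

definition test_functions :: "real \<Rightarrow> (real^'n \<Rightarrow> real) set" where
  "test_functions \<alpha> = {\<xi>.
     continuous_on UNIV \<xi> \<and>
     compact (closure {x. \<xi> x \<noteq> 0}) \<and>
     (\<forall>x. frac_lap_exists \<alpha> \<xi> x) \<and>
     (\<exists>C>0. \<forall>x. \<bar>frac_lap \<alpha> \<xi> x\<bar> \<le> C / (1 + norm x powr (real CARD('n) + 2 * \<alpha>))) \<and>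
     (\<exists>\<phi> \<epsilon>\<^sub>0. integrable lebesgue \<phi> \<and> \<epsilon>\<^sub>0 > 0 \<and>
        (\<forall>\<epsilon>\<in>{0<..\<epsilon>\<^sub>0}. AE x in lebesgue. \<bar>frac_lap_eps \<alpha> \<epsilon> \<xi> x\<bar> \<le> \<phi> x))}"

(* The real value at the origin plays no role: a point is a null set. *)
definition weak_solution :: "real \<Rightarrow> real \<Rightarrow> real \<Rightarrow> (real^'n \<Rightarrow> real) \<Rightarrow> bool" where
  "weak_solution \<alpha> p k u \<longleftrightarrow>
     (\<forall>x. 0 \<le> u x) \<and>
     integrable (omega_measure \<alpha>) u \<and>
     integrable (omega_measure \<alpha>) (\<lambda>x. u x powr p) \<and>
     (u \<longlongrightarrow> 0) at_infinity \<and>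
     (\<forall>\<xi>\<in>test_functions \<alpha>.
        (LINT x|lebesgue. u x * frac_lap \<alpha> \<xi> x + u x powr p * \<xi> x) = k * \<xi> 0)"

definition classical_solution :: "real \<Rightarrow> real \<Rightarrow> (real^'n \<Rightarrow> real) \<Rightarrow> bool" where
  "classical_solution \<alpha> p u \<longleftrightarrow>
     continuous_on (- {0}) u \<and>
     (\<forall>x. x \<noteq> 0 \<longrightarrow> frac_lap_exists \<alpha> u x \<and> frac_lap \<alpha> u x + u x powr p = 0)"

(* Convention u(0) = +infinity for the pointwise values of a nonnegative u. *)
definition pointwise_value :: "(real^'n \<Rightarrow> real) \<Rightarrow> real^'n \<Rightarrow> ennreal" where
  "pointwise_value u x = (if x = 0 then \<infinity> else ennreal (u x))"

definition u_infty :: "(real \<Rightarrow> real^'n \<Rightarrow> real) \<Rightarrow> real^'n \<Rightarrow> ennreal" where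
  "u_infty u x = Lim at_top (\<lambda>k. pointwise_value (u k) x)"

end

theory Submission
  imports Defs
begin

text \<open>
  With \<open>a = 2\<alpha> / (p - 1)\<close> and \<open>\<sigma> = ap - N\<close>, uniqueness turns the scaling and rotation invariance of the
  equation into \<open>u k x = |x|\<^sup>-\<^sup>a u (k |x|\<^sup>\<sigma>) e\<close> for every unit vector \<open>e\<close> (\<open>p \<noteq> 1\<close>), so that
  \<open>u_infty u x = c |x|\<^sup>-\<^sup>a\<close> with \<open>c \<in> (0, \<infinity>]\<close>. Everything else comes from testing with one bump \<open>\<xi>\<close>
  supported in \<open>2 \<le> |x| \<le> 4\<close>: the identity \<open>\<integral> (u k)\<^sup>p \<xi> = - \<integral> u k (-\<Delta>)\<^sup>\<alpha> \<xi>\<close> no longer sees the mass \<open>k\<close>, and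
  \<open>(-\<Delta>)\<^sup>\<alpha> \<xi>\<close> is bounded by the density of \<open>\<omega>\<close>, and away from the support it is negative and comparable to it.

  If \<open>c < \<infinity>\<close>, this bounds \<open>\<integral> u k d\<omega>\<close> uniformly in \<open>k\<close>, hence \<open>|x|\<^sup>-\<^sup>a\<close> is \<open>\<omega>\<close>-integrable, which fails for
  \<open>p \<le> 1 + 2\<alpha>/N\<close>, \<open>p \<noteq> 1\<close>. For \<open>p = 1\<close> simply \<open>u k = k u 1\<close> with \<open>u 1 > 0\<close>.
  If \<open>p > 1 + 2\<alpha>/N\<close>, it bounds \<open>(u k e)\<^sup>p\<close> by the mass of \<open>u k\<close>, and iterating improves a power bound in \<open>k\<close>
  to \<open>c < \<infinity>\<close>. Passing to the limit in the test identity and integrating by parts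
  identifies the constant in \<open>(-\<Delta>)\<^sup>\<alpha> |x|\<^sup>-\<^sup>a = l |x|\<^sup>-\<^sup>a\<^sup>p\<close> as the one for which \<open>c |x|\<^sup>-\<^sup>a\<close> solves the equation.
\<close>

section \<open>Similarities and Lebesgue measure\<close>

text \<open>The exponent \<open>a\<close> satisfies \<open>a * p = a + 2 * \<alpha>\<close>, so
  replacing \<open>u\<close> by \<open>r powr a * u (r x)\<close> multiplies both terms of the
  equation by \<open>r powr (a * p)\<close> and the mass by \<open>r powr \<sigma>\<close>. For p =
  1 there is no such exponent. The function |x|^-a is \<omega>-integrable only for -2\<alpha> < a <
  N: for p < 1 this fails at infinity, since a < -2\<alpha>, and for 1 < p \<le> 1 + 2\<alpha>/N at
  the origin, since a \<ge> N. Above that range the upper bound on p gives \<sigma> > 0: raising the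
  mass then amounts to moving the point outwards, so the decay of \<open>u 1\<close> yields the
  bound \<open>M * k powr (a / \<sigma>)\<close> that starts the iteration, and each step divides
  the exponent by p > 1. The constant l is never computed: homogeneity and rotations leave it as the
  only unknown, and the limit of the test identity says c l + c^p = 0. Integration by parts is done
  with truncated kernels, where the double integral converges absolutely; bounds uniform in the
  truncation radius then permit the limit. Bounded second differences are all the regularity that
  this takes.\<close>

lemma nn_integral_lborel_translate:
  fixes f :: "'a::euclidean_space \<Rightarrow> ennreal"
  assumes [measurable]: "f \<in> borel_measurable borel"
  shows "(\<integral>\<^sup>+x. f (x + y) \<partial>lborel) = (\<integral>\<^sup>+x. f x \<partial>lborel)"
proof -
  have "(\<integral>\<^sup>+x. f x \<partial>lborel) = (\<integral>\<^sup>+x. f x \<partial>distr lborel borel ((+) y))"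
    by (subst lborel_distr_plus) simp
  also have "\<dots> = (\<integral>\<^sup>+x. f (x + y) \<partial>lborel)"
    by (subst nn_integral_distr) (auto simp: add.commute)
  finally show ?thesis by simp
qed

text \<open>
  Both \<open>\<lambda>\<close> and its image \<open>\<mu>\<close> under \<open>Q\<close> are translation invariant, so for the unit ball \<open>B\<close> integrating
  \<open>1\<^sub>A(x + y) 1\<^sub>B(y)\<close> in both orders gives \<open>\<lambda>(A) \<mu>(B) = \<mu>(A) \<lambda>(B)\<close>.
  The change of variables theorems of the library require a well-ordered index type.
\<close>

lemma lborel_distr_orthogonal:
  fixes Q :: "'a::euclidean_space \<Rightarrow> 'a"
  assumes Q: "orthogonal_transformation Q"
  shows "distr lborel borel Q = lborel"
proof -
  define \<mu> where "\<mu> = distr lborel borel Q"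
  have lin: "linear Q" using Q by (rule orthogonal_transformation_linear)
  have Qm [measurable]: "Q \<in> borel_measurable borel"
    using linear_continuous_on[of Q UNIV] lin linear_conv_bounded_linear
    by (intro borel_measurable_continuous_onI) auto
  have [simp, measurable_cong]: "sets \<mu> = sets borel" and [simp]: "space \<mu> = UNIV"
    by (auto simp: \<mu>_def)
  define B :: "'a set" where "B = ball 0 1"
  have Bm [measurable]: "B \<in> sets borel" by (simp add: B_def)
  \<comment> \<open>Orthogonal maps preserve balls centred at the origin; this normalizes the
    proportionality factor between the two measures to 1.\<close>
  have B\<mu>: "emeasure \<mu> B = emeasure lborel B"
  proof -
    have "Q -` B = B" using Q by (auto simp: B_def orthogonal_transformation_norm)
    then show ?thesis by (simp add: \<mu>_def emeasure_distr)
  qed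
  have Bpos: "emeasure lborel B \<noteq> 0" and Bfin: "emeasure lborel B \<noteq> \<infinity>"
    by (simp_all add: B_def emeasure_ball ennreal_eq_0_iff not_le)
  have trans: "(\<integral>\<^sup>+y. f (y + x) \<partial>\<mu>) = (\<integral>\<^sup>+y. f y \<partial>\<mu>)"
    if [measurable]: "f \<in> borel_measurable borel" for f and x
  proof -
    obtain x' where x': "Q x' = x"
      using orthogonal_transformation_surj[OF Q] by (metis surjD)
    have "(\<integral>\<^sup>+y. f (y + x) \<partial>\<mu>) = (\<integral>\<^sup>+y. f (Q y + x) \<partial>lborel)"
      by (simp add: \<mu>_def nn_integral_distr)
    also have "\<dots> = (\<integral>\<^sup>+y. f (Q (y + x')) \<partial>lborel)"
      by (simp add: linear_add[OF lin] x')
    also have "\<dots> = (\<integral>\<^sup>+y. f (Q y) \<partial>lborel)"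
      by (rule nn_integral_lborel_translate) simp
    also have "\<dots> = (\<integral>\<^sup>+y. f y \<partial>\<mu>)"
      by (simp add: \<mu>_def nn_integral_distr)
    finally show ?thesis .
  qed
  \<comment> \<open>Exchanging the integrals over \<open>lborel\<close> and \<open>\<mu>\<close>
    needs sigma-finiteness; again balls centred at the origin keep their measure.\<close>
  have sf: "sigma_finite_measure \<mu>"
  proof
    define F :: "nat \<Rightarrow> 'a set" where "F n = ball 0 (real n)" for n
    have fin: "emeasure \<mu> (F n) \<noteq> \<infinity>" for n
    proof -
      have "Q -` F n = F n" using Q by (auto simp: F_def orthogonal_transformation_norm)
      then have "emeasure \<mu> (F n) = emeasure lborel (F n)"
        by (simp add: \<mu>_def emeasure_distr F_def)
      then show ?thesis using emeasure_lborel_ball_finite[of 0 "real n"] by (simp add: F_def less_top[symmetric])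
    qed
    have "(\<Union>n. F n) = UNIV"
      unfolding F_def using reals_Archimedean2 by (force simp: dist_norm)
    then show "\<exists>A. countable A \<and> A \<subseteq> sets \<mu> \<and> \<Union> A = space \<mu> \<and> (\<forall>a\<in>A. emeasure \<mu> a \<noteq> \<infinity>)"
      using fin by (intro exI[of _ "range F"]) (auto simp: F_def)
  qed
  interpret \<mu>: sigma_finite_measure \<mu> by (rule sf)
  interpret pair_sigma_finite lborel \<mu> ..
  have eq: "emeasure lborel A = emeasure \<mu> A" if A [measurable]: "A \<in> sets borel" for A
  proof -
    let ?I = "\<lambda>S x. indicator S x :: ennreal"
    have "emeasure lborel A * emeasure \<mu> B = (\<integral>\<^sup>+y. (\<integral>\<^sup>+x. ?I A (x + y) * ?I B y \<partial>lborel) \<partial>\<mu>)"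
    proof -
      have "(\<integral>\<^sup>+x. ?I A (x + y) * ?I B y \<partial>lborel) = emeasure lborel A * ?I B y" for y
        using nn_integral_lborel_translate[of "?I A" y]
        by (subst nn_integral_multc) (auto simp: nn_integral_indicator)
      then show ?thesis by (simp add: nn_integral_cmult)
    qed
    also have "\<dots> = (\<integral>\<^sup>+x. (\<integral>\<^sup>+y. ?I A (x + y) * ?I B y \<partial>\<mu>) \<partial>lborel)"
      by (rule Fubini') measurable
    also have "\<dots> = (\<integral>\<^sup>+x. (\<integral>\<^sup>+y. ?I A y * ?I B (y - x) \<partial>\<mu>) \<partial>lborel)"
    proof (rule nn_integral_cong)
      fix x
      show "(\<integral>\<^sup>+y. ?I A (x + y) * ?I B y \<partial>\<mu>) = (\<integral>\<^sup>+y. ?I A y * ?I B (y - x) \<partial>\<mu>)"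
        using trans[of "\<lambda>y. ?I A y * ?I B (y - x)" x] by (simp add: add.commute)
    qed
    also have "\<dots> = (\<integral>\<^sup>+y. (\<integral>\<^sup>+x. ?I A y * ?I B (y - x) \<partial>lborel) \<partial>\<mu>)"
      by (rule Fubini'[symmetric]) measurable
    also have "\<dots> = emeasure \<mu> A * emeasure lborel B"
    proof -
      have "?I B (y - x) = ?I B (x + (- y))" for x y
        by (auto simp: B_def indicator_def dist_norm norm_minus_commute)
      then have "(\<integral>\<^sup>+x. ?I A y * ?I B (y - x) \<partial>lborel) = ?I A y * emeasure lborel B" for y
        using nn_integral_lborel_translate[of "?I B" "- y"]
        by (subst nn_integral_cmult) (auto simp: nn_integral_indicator)
      then show ?thesis by (simp add: nn_integral_multc)
    qed
    finally have "emeasure lborel B * emeasure lborel A = emeasure lborel B * emeasure \<mu> A"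
      unfolding B\<mu> by (simp add: mult.commute)
    then show ?thesis
      using Bpos Bfin by (subst (asm) ennreal_mult_cancel_left) (simp add: infinity_ennreal_def)
  qed
  show ?thesis unfolding \<mu>_def[symmetric] by (rule measure_eqI) (auto simp: eq)
qed

text \<open>One notion for translations, dilations and orthogonal maps, so that the behaviour of
  integrals, of the fractional Laplacian and of test functions is treated once. Rescaling solutions
  uses \<open>b = 0\<close>; moving the bump and forming second differences use
  \<open>l = 1\<close>.\<close>

definition similarity :: "real \<Rightarrow> ('a::euclidean_space \<Rightarrow> 'a) \<Rightarrow> bool" where
  "similarity l T \<longleftrightarrow> l > 0 \<and> (\<exists>Q b. orthogonal_transformation Q \<and> T = (\<lambda>x. l *\<^sub>R Q x + b))"

lemma similarityI:
  assumes "l > 0" "orthogonal_transformation Q"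
  shows "similarity l (\<lambda>x. l *\<^sub>R Q x + b)"
  using assms unfolding similarity_def by blast

lemma similarity_pos: "similarity l T \<Longrightarrow> l > 0"
  by (simp add: similarity_def)

lemma similarity_dist:
  assumes "similarity l T"
  shows "norm (T x - T y) = l * norm (x - y)"
proof -
  obtain Q b where "l > 0" and Q: "orthogonal_transformation Q" and T: "T = (\<lambda>x. l *\<^sub>R Q x + b)"
    using assms by (auto simp: similarity_def)
  have "T x - T y = l *\<^sub>R Q (x - y)"
    by (simp add: T linear_diff[OF orthogonal_transformation_linear[OF Q]] scaleR_diff_right)
  then show ?thesis using Q \<open>l > 0\<close> by (simp add: orthogonal_transformation_norm)
qed

lemma similarity_inverse:
  assumes "similarity l T"
  obtains S where "similarity (1 / l) S" "\<And>x. S (T x) = x" "\<And>x. T (S x) = x"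
proof -
  obtain Q b where l: "l > 0" and Q: "orthogonal_transformation Q" and T: "T = (\<lambda>x. l *\<^sub>R Q x + b)"
    using assms by (auto simp: similarity_def)
  let ?R = "inv Q"
  have R: "orthogonal_transformation ?R" using orthogonal_transformation_inv[OF Q] .
  have linR: "linear ?R" using R by (rule orthogonal_transformation_linear)
  define S where "S = (\<lambda>x. (1 / l) *\<^sub>R ?R x + (- (1 / l) *\<^sub>R ?R b))"
  have bij: "bij Q" using orthogonal_transformation_bij[OF Q] .
  have linQ: "linear Q" using Q by (rule orthogonal_transformation_linear)
  show thesis
  proof
    show "similarity (1 / l) S" unfolding S_def using l R by (intro similarityI) auto
    show "S (T x) = x" for x
      using l bij by (simp add: S_def T linear_add[OF linR] linear_scale[OF linR] bij_is_inj scaleR_add_right)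
    have "Q (?R y) = y" for y using bij by (simp add: bij_is_surj surj_f_inv_f)
    then show "T (S x) = x" for x
      using l by (simp add: S_def T linear_diff[OF linQ] linear_scale[OF linQ] scaleR_diff_right)
  qed
qed

lemma similarity_continuous: "similarity l T \<Longrightarrow> continuous_on S T"
  by (rule lipschitz_on_continuous_on[of l])
     (auto intro!: lipschitz_onI simp: dist_norm similarity_dist dest: similarity_pos)

text \<open>By \<open>lborel_distr_orthogonal\<close> the orthogonal part leaves the measure alone,
  so only the dilation contributes a factor.\<close>

lemma similarity_lborel:
  fixes T :: "'a::euclidean_space \<Rightarrow> 'a"
  assumes "similarity l T"
  shows "lborel = density (distr lborel borel T) (\<lambda>_. ennreal (l ^ DIM('a)))"
proof -
  obtain Q b where l: "l > 0" and Q: "orthogonal_transformation Q" and T: "T = (\<lambda>x. l *\<^sub>R Q x + b)"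
    using assms by (auto simp: similarity_def)
  have [measurable]: "Q \<in> borel_measurable borel"
    using linear_continuous_on[of Q UNIV] orthogonal_transformation_linear[OF Q] linear_conv_bounded_linear
    by (intro borel_measurable_continuous_onI) auto
  have "distr lborel borel T = distr (distr lborel borel Q) borel (\<lambda>x. b + l *\<^sub>R x)"
    by (subst distr_distr) (auto simp: T comp_def add.commute)
  also have "\<dots> = distr lborel borel (\<lambda>x. b + l *\<^sub>R x)"
    by (simp add: lborel_distr_orthogonal[OF Q])
  finally show ?thesis using lborel_affine[of l b] l by simp
qed

text \<open>Continuity gives Borel measurability only; for the completed measure, preimages of null
  sets must be null as well. They are, because the density on Borel sets is a positive constant and
  so does not change the null sets. The formula then passes to completions.\<close>

lemma
  fixes T :: "'a::euclidean_space \<Rightarrow> 'a"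
  assumes T: "similarity l T"
  shows similarity_measurable: "T \<in> lebesgue \<rightarrow>\<^sub>M lebesgue"
    and similarity_lebesgue: "lebesgue = density (distr lebesgue lebesgue T) (\<lambda>_. ennreal (l ^ DIM('a)))"
proof -
  have l: "l > 0" using similarity_pos[OF T] .
  have T_borel[measurable]: "T \<in> borel_measurable borel"
    by (intro borel_measurable_continuous_onI similarity_continuous[OF T])
  { fix A :: "'a set" assume A: "A \<in> sets borel"
    then have "emeasure lborel A = 0 \<longleftrightarrow> emeasure (density (distr lborel borel T) (\<lambda>_. ennreal (l ^ DIM('a)))) A = 0"
      by (subst similarity_lborel[OF T, symmetric]) auto
    also have "\<dots> \<longleftrightarrow> emeasure (distr lebesgue lborel T) A = 0"
      using A zero_less_power[OF l, of "DIM('a)"]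
      by (simp add: distr_completion emeasure_density nn_integral_cmult ennreal_eq_0_iff not_le[symmetric] del: zero_less_power cong: distr_cong)
    finally have "emeasure lborel A = 0 \<longleftrightarrow> emeasure (distr lebesgue lborel T) A = 0" . }
  then have eq: "null_sets lborel = null_sets (distr lebesgue lborel T)"
    by (auto simp: null_sets_def)
  show "T \<in> lebesgue \<rightarrow>\<^sub>M lebesgue"
    by (simp add: completion.measurable_completion2 eq measurable_completion)
  have "lebesgue = completion (density (distr lborel borel T) (\<lambda>_. ennreal (l ^ DIM('a))))"
    by (subst similarity_lborel[OF T]) simp
  also have "\<dots> = density (completion (distr lebesgue lborel T)) (\<lambda>_. ennreal (l ^ DIM('a)))"
    using l by (auto intro!: always_eventually completion_density_eq simp: distr_completion cong: distr_cong)
  also have "\<dots> = density (distr lebesgue lebesgue T) (\<lambda>_. ennreal (l ^ DIM('a)))"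
    by (subst completion.completion_distr_eq) (auto simp: eq measurable_completion)
  finally show "lebesgue = density (distr lebesgue lebesgue T) (\<lambda>_. ennreal (l ^ DIM('a)))" .
qed

lemma similarity_AE:
  fixes T :: "'a::euclidean_space \<Rightarrow> 'a"
  assumes T: "similarity l T" and P: "AE x in lebesgue. P x"
  shows "AE x in lebesgue. P (T x)"
proof -
  have "AE x in density (distr lebesgue lebesgue T) (\<lambda>_. ennreal (l ^ DIM('a))). P x"
    using P by (subst similarity_lebesgue[OF T, symmetric])
  then have "AE x in distr lebesgue lebesgue T. P x"
    using similarity_pos[OF T] by (subst (asm) AE_density) auto
  then show ?thesis
    by (rule AE_distrD[OF similarity_measurable[OF T]])
qed

lemma similarity_integrable:
  fixes f :: "'a::euclidean_space \<Rightarrow> real"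
  assumes T: "similarity l T" and f: "integrable lebesgue f"
  shows "integrable lebesgue (\<lambda>x. f (T x))"
proof -
  note [measurable] = similarity_measurable[OF T] borel_measurable_integrable[OF f]
  have "integrable (density (distr lebesgue lebesgue T) (\<lambda>_. ennreal (l ^ DIM('a)))) f"
    using f by (subst similarity_lebesgue[OF T, symmetric])
  then have "integrable (distr lebesgue lebesgue T) (\<lambda>x. l ^ DIM('a) * f x)"
    using similarity_pos[OF T] by (subst (asm) integrable_density) auto
  then have "integrable (distr lebesgue lebesgue T) f"
    using similarity_pos[OF T] by simp
  then show ?thesis by (subst (asm) integrable_distr_eq) auto
qed

lemma similarity_integrable_iff:
  fixes f :: "'a::euclidean_space \<Rightarrow> real"
  assumes T: "similarity l T"
  shows "integrable lebesgue (\<lambda>x. f (T x)) \<longleftrightarrow> integrable lebesgue f"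
proof
  obtain S where S: "similarity (1 / l) S" "\<And>x. S (T x) = x" "\<And>x. T (S x) = x"
    by (rule similarity_inverse[OF T]) (rule that)
  show "integrable lebesgue f" if "integrable lebesgue (\<lambda>x. f (T x))"
    using similarity_integrable[OF S(1), of "\<lambda>x. f (T x)"] that by (simp only: S(3))
  show "integrable lebesgue (\<lambda>x. f (T x))" if "integrable lebesgue f"
    using T that by (rule similarity_integrable)
qed

text \<open>Both sides are 0 if \<^term>\<open>f\<close> is not integrable.\<close>

lemma similarity_integral:
  fixes f :: "'a::euclidean_space \<Rightarrow> real"
  assumes T: "similarity l T"
  shows "(LINT x|lebesgue. f x) = l ^ DIM('a) * (LINT x|lebesgue. f (T x))"
proof (cases "integrable lebesgue f")
  case True
  note [measurable] = similarity_measurable[OF T] borel_measurable_integrable[OF True]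
  have "(LINT x|lebesgue. f x) = (LINT x|density (distr lebesgue lebesgue T) (\<lambda>_. ennreal (l ^ DIM('a))). f x)"
    by (subst similarity_lebesgue[OF T, symmetric]) simp
  also have "\<dots> = l ^ DIM('a) * (LINT x|distr lebesgue lebesgue T. f x)"
    using similarity_pos[OF T] by (subst integral_density) auto
  also have "(LINT x|distr lebesgue lebesgue T. f x) = (LINT x|lebesgue. f (T x))"
    by (rule integral_distr) measurable
  finally show ?thesis .
next
  case False
  then show ?thesis
    using similarity_integrable_iff[OF T, of f] by (simp add: not_integrable_integral_eq)
qed

lemma nn_integral_lborel_scale:
  fixes f :: "'a::euclidean_space \<Rightarrow> ennreal"
  assumes [measurable]: "f \<in> borel_measurable borel" and "l > 0"
  shows "(\<integral>\<^sup>+x. f x \<partial>lborel) = ennreal (l ^ DIM('a)) * (\<integral>\<^sup>+x. f (l *\<^sub>R x) \<partial>lborel)"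
proof -
  have "(\<integral>\<^sup>+x. f x \<partial>lborel) = (\<integral>\<^sup>+x. f x \<partial>density (distr lborel borel (\<lambda>x. 0 + l *\<^sub>R x)) (\<lambda>_. ennreal (\<bar>l\<bar> ^ DIM('a))))"
    using \<open>l > 0\<close> by (subst lborel_affine[of l "0::'a"]) simp_all
  also have "\<dots> = ennreal (l ^ DIM('a)) * (\<integral>\<^sup>+x. f (l *\<^sub>R x) \<partial>lborel)"
    using \<open>l > 0\<close> by (simp add: nn_integral_density nn_integral_distr nn_integral_cmult)
  finally show ?thesis .
qed

section \<open>Power weights\<close>

text \<open>Nonempty open sets are not negligible. Through this lemma almost everywhere statements
  about continuous functions become pointwise ones, and integrals of bumps become strictly
  positive.\<close>

lemma open_AE_empty:
  fixes U :: "'a::euclidean_space set"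
  assumes "open U" "AE x in lebesgue. x \<notin> U"
  shows "U = {}"
proof -
  have "U \<in> sets lebesgue" using assms(1) by (auto intro: sets_completionI_sets)
  then have "negligible U" using assms(2) by (simp add: AE_iff_null_sets negligible_iff_null_sets)
  then show ?thesis using open_not_negligible[OF assms(1)] by blast
qed

lemma integrable_indicator_cball:
  "integrable lborel (indicator (cball (x::'a::euclidean_space) r) :: 'a \<Rightarrow> real)"
  "integrable lebesgue (indicator (cball (x::'a::euclidean_space) r) :: 'a \<Rightarrow> real)"
proof -
  show *: "integrable lborel (indicator (cball (x::'a::euclidean_space) r) :: 'a \<Rightarrow> real)"
    using emeasure_lborel_cball_finite[of x r] by (intro integrable_real_indicator) auto
  then show "integrable lebesgue (indicator (cball (x::'a::euclidean_space) r) :: 'a \<Rightarrow> real)"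
    by (subst integrable_completion) auto
qed

lemma integrable_lborel_bounded_support:
  fixes f :: "'a::euclidean_space \<Rightarrow> real"
  assumes [measurable]: "f \<in> borel_measurable borel" and "\<And>x. \<bar>f x\<bar> \<le> 1" "\<And>x. norm x > R \<Longrightarrow> f x = 0"
  shows "integrable lborel f"
  using integrable_indicator_cball(1)[of 0 R]
proof (rule Bochner_Integration.integrable_bound)
  show "AE x in lborel. norm (f x) \<le> norm (indicator (cball 0 R) x :: real)"
    using assms by (intro AE_I2) (auto simp: indicator_def)
qed simp

text \<open>The set with index \<open>j\<close> is the dilate of \<open>A\<close> by
  \<open>b ^ j\<close>. Substitution gives the factor \<open>(b ^ j) ^ DIM('a)\<close> from the
  measure and \<open>(b ^ j) powr (- s)\<close> from the weight, so a geometric series takes the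
  place of polar coordinates. The base is 2 for shells going to infinity and 1/2 for shells
  shrinking to the origin.\<close>

lemma nn_integral_dyadic_shells:
  fixes A :: "'a::euclidean_space set" and b s :: real
  assumes [measurable]: "A \<in> sets borel" and b: "b > 0"
    and disj: "disjoint_family (\<lambda>j::nat. {x. (1 / b ^ j) *\<^sub>R x \<in> A})"
  shows "(\<integral>\<^sup>+x. indicator (\<Union>j::nat. {x. (1 / b ^ j) *\<^sub>R x \<in> A}) x * ennreal (norm x powr (- s)) \<partial>lborel)
     = (\<Sum>j. ennreal ((b powr (real DIM('a) - s)) ^ j)) * (\<integral>\<^sup>+x. indicator A x * ennreal (norm x powr (- s)) \<partial>lborel)"
proof -
  let ?A = "\<lambda>j::nat. {x. (1 / b ^ j) *\<^sub>R x \<in> A}"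
  let ?F = "\<integral>\<^sup>+x. indicator A x * ennreal (norm x powr (- s)) \<partial>lborel"
  have "(\<integral>\<^sup>+x. indicator (\<Union>j::nat. ?A j) x * ennreal (norm x powr (- s)) \<partial>lborel)
      = (\<integral>\<^sup>+x. (\<Sum>j. indicator (?A j) x * ennreal (norm x powr (- s))) \<partial>lborel)"
    by (intro nn_integral_cong) (simp only: suminf_indicator[OF disj, symmetric] ennreal_suminf_multc)
  also have "\<dots> = (\<Sum>j. \<integral>\<^sup>+x. indicator (?A j) x * ennreal (norm x powr (- s)) \<partial>lborel)"
    by (rule nn_integral_suminf) measurable
  also have "\<dots> = (\<Sum>j. ennreal ((b powr (real DIM('a) - s)) ^ j) * ?F)"
  proof (rule suminf_cong)
    fix j :: nat
    have bj: "b ^ j > 0" using b by simp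
    have "(\<integral>\<^sup>+x. indicator (?A j) x * ennreal (norm x powr (- s)) \<partial>lborel)
       = ennreal ((b ^ j) ^ DIM('a)) * (\<integral>\<^sup>+x. indicator (?A j) ((b ^ j) *\<^sub>R x) * ennreal (norm ((b ^ j) *\<^sub>R x) powr (- s)) \<partial>lborel)"
      by (rule nn_integral_lborel_scale[OF _ bj]) measurable
    also have "\<dots> = ennreal ((b ^ j) ^ DIM('a)) * (\<integral>\<^sup>+x. ennreal ((b ^ j) powr (- s)) * (indicator A x * ennreal (norm x powr (- s))) \<partial>lborel)"
    proof -
      have "indicator (?A j) ((b ^ j) *\<^sub>R x) * ennreal (norm ((b ^ j) *\<^sub>R x) powr (- s))
          = ennreal ((b ^ j) powr (- s)) * (indicator A x * ennreal (norm x powr (- s)))" for x :: 'a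
      proof -
        have "norm ((b ^ j) *\<^sub>R x) powr (- s) = (b ^ j) powr (- s) * norm x powr (- s)"
          using bj by (simp add: powr_mult)
        moreover have "indicator (?A j) ((b ^ j) *\<^sub>R x) = (indicator A x :: ennreal)"
          using b by (simp add: indicator_def)
        ultimately show ?thesis by (simp only: ennreal_mult powr_ge_zero mult.left_commute)
      qed
      then show ?thesis by simp
    qed
    also have "\<dots> = ennreal ((b ^ j) ^ DIM('a)) * (ennreal ((b ^ j) powr (- s)) * ?F)"
      by (subst nn_integral_cmult) auto
    also have "\<dots> = ennreal ((b ^ j) ^ DIM('a) * (b ^ j) powr (- s)) * ?F"
      using bj by (simp add: ennreal_mult mult.assoc)
    also have "(b ^ j) ^ DIM('a) * (b ^ j) powr (- s) = (b ^ j) powr (real DIM('a) - s)"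
      using bj by (simp add: powr_realpow[symmetric] powr_add[symmetric] del: powr_realpow)
    also have "\<dots> = (b powr (real DIM('a) - s)) ^ j"
      using b by (simp add: powr_realpow[symmetric] powr_powr mult.commute powr_power)
    finally show "(\<integral>\<^sup>+x. indicator (?A j) x * ennreal (norm x powr (- s)) \<partial>lborel) = ennreal ((b powr (real DIM('a) - s)) ^ j) * ?F" .
  qed
  finally show ?thesis by (simp add: ennreal_suminf_multc)
qed

lemma ex_dyadic:
  fixes t :: real
  assumes "t \<ge> 1"
  shows "\<exists>j::nat. 2 ^ j \<le> t \<and> t < 2 * 2 ^ j"
proof -
  let ?P = "\<lambda>j::nat. t < 2 ^ j"
  obtain n where "?P n" using real_arch_pow[of 2 t] by auto
  then have l: "?P (LEAST j. ?P j)" by (rule LeastI)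
  with assms have "(LEAST j. ?P j) \<noteq> 0" by (intro notI) simp
  then obtain m where m: "(LEAST j. ?P j) = Suc m" using not0_implies_Suc by blast
  have "\<not> ?P m" using m not_less_Least[of m ?P] by simp
  then show ?thesis using l m by (intro exI[of _ m]) auto
qed

text \<open>The function \<open>g\<close> is arbitrary so that it can be \<open>norm x\<close> as
  well as \<open>1 / norm x\<close>.\<close>

lemma dyadic_disjoint:
  fixes g :: "'a \<Rightarrow> real"
  shows "disjoint_family (\<lambda>j::nat. {x. 2 ^ j \<le> g x \<and> g x < 2 * 2 ^ j})"
proof -
  have "\<not> (2 ^ n \<le> g x \<and> g x < 2 * 2 ^ m)" if "m < n" for m n :: nat and x
  proof -
    have "(2::real) * 2 ^ m = 2 ^ Suc m" by simp
    also have "\<dots> \<le> 2 ^ n" using that by (intro power_increasing) auto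
    finally show ?thesis by auto
  qed
  then show ?thesis
    unfolding disjoint_family_on_def by (auto simp: set_eq_iff neq_iff)
qed

lemma suminf_geometric_ennreal_finite:
  assumes "0 \<le> q" "q < 1"
  shows "(\<Sum>j. ennreal (q ^ j)) < \<infinity>"
  using assms by (subst suminf_ennreal2) (auto intro!: summable_geometric)

lemma suminf_geometric_ennreal_infinite:
  assumes "1 \<le> q"
  shows "(\<Sum>j. ennreal (q ^ j)) = \<infinity>"
proof -
  have "ennreal (real n) \<le> (\<Sum>j. ennreal (q ^ j))" for n
  proof -
    have "ennreal (real n) = (\<Sum>j<n. ennreal 1)" by (simp add: ennreal_of_nat_eq_real_of_nat)
    also have "\<dots> \<le> (\<Sum>j<n. ennreal (q ^ j))"
      using assms by (intro sum_mono ennreal_leI one_le_power)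
    also have "\<dots> \<le> (\<Sum>j. ennreal (q ^ j))" by (rule sum_le_suminf) auto
    finally show ?thesis .
  qed
  then show ?thesis
    by (metis ennreal_of_nat_eq_real_of_nat ennreal_Ex_less_of_nat infinity_ennreal_def leD less_top)
qed

text \<open>On the shell the weight lies between positive constants. For the second claim, if
  \<open>A\<close> were null, so would be its dilate by 2, and by \<open>lower\<close> the two cover
  the open shell between radii 1 and 2. This form of \<open>lower\<close> suits both shells used
  below, the one from 1 to 2 and the one from 1/2 to 1.\<close>

lemma shell_moment:
  fixes A :: "'a::euclidean_space set"
  assumes A [measurable]: "A \<in> sets borel" and lower: "\<And>x. 1 < norm x \<Longrightarrow> norm x < 2 \<Longrightarrow> x \<in> A \<or> (1/2) *\<^sub>R x \<in> A"
    and upper: "\<And>x. x \<in> A \<Longrightarrow> 1/2 \<le> norm x \<and> norm x \<le> 2"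
  shows "(\<integral>\<^sup>+x. indicator A x * ennreal (norm x powr (- s)) \<partial>lborel) < \<infinity>"
    and "(\<integral>\<^sup>+x. indicator A x * ennreal (norm x powr (- s)) \<partial>lborel) \<noteq> 0"
proof -
  let ?F = "\<integral>\<^sup>+x. indicator A x * ennreal (norm x powr (- s)) \<partial>lborel"
  let ?M = "max ((1/2) powr (- s)) (2 powr (- s))"
  have bd: "norm x powr (- s) \<le> ?M" if "x \<in> A" for x
    using upper[OF that]
    by (cases "s \<ge> 0") (auto intro: powr_mono2 powr_mono2' simp: le_max_iff_disj)
  have "?F \<le> (\<integral>\<^sup>+x. ennreal ?M * indicator (cball (0::'a) 2) x \<partial>lborel)"
  proof (rule nn_integral_mono)
    fix x
    show "indicator A x * ennreal (norm x powr (- s)) \<le> ennreal ?M * indicator (cball 0 2) x"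
    proof (cases "x \<in> A")
      case True
      with upper[OF True] show ?thesis using ennreal_leI[OF bd[OF True]] by simp
    qed simp
  qed
  also have "\<dots> = ennreal ?M * emeasure lborel (cball (0::'a) 2)"
    by (subst nn_integral_cmult_indicator) auto
  also have "\<dots> < \<infinity>"
    using emeasure_lborel_cball_finite[of "0::'a" 2] by (simp add: ennreal_mult_less_top)
  finally show "?F < \<infinity>" .
  show "?F \<noteq> 0"
  proof
    assume "?F = 0"
    then have "AE x in lborel. indicator A x * ennreal (norm x powr (- s)) = 0"
      by (subst (asm) nn_integral_0_iff_AE) auto
    then have "AE x in lborel. x \<notin> A"
    proof eventually_elim
      case (elim x)
      then show ?case using upper[of x] by (auto simp: indicator_def split: if_splits)
    qed
    then have notA: "AE x in lebesgue. x \<notin> A" by (rule AE_completion)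
    have "similarity (1/2) (\<lambda>x::'a. (1/2) *\<^sub>R id x + 0)"
      by (rule similarityI) (auto simp: orthogonal_transformation_id)
    from similarity_AE[OF this notA] have "AE x::'a in lebesgue. (1/2) *\<^sub>R x \<notin> A" by simp
    with notA have "AE x::'a in lebesgue. \<not> (1 < norm x \<and> norm x < 2)"
      by eventually_elim (use lower in blast)
    then have "AE x in lebesgue. x \<notin> {x::'a. 1 < norm x \<and> norm x < 2}" by simp
    moreover have "open {x::'a. 1 < norm x \<and> norm x < 2}"
      by (intro open_Collect_conj open_Collect_less continuous_intros)
    moreover have "(3/2) *\<^sub>R (SOME i. i \<in> Basis) \<in> {x::'a. 1 < norm x \<and> norm x < 2}"
      using norm_Basis[of "SOME i::'a. i \<in> Basis"] SOME_Basis by auto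
    ultimately show False using open_AE_empty by blast
  qed
qed

text \<open>The shells \<open>2 ^ j \<le> norm x < 2 * 2 ^ j\<close> give a geometric series of
  ratio \<open>2 powr (N - s)\<close>, which is below 1 exactly for \<open>s > N\<close>; the factor
  \<open>?F\<close> is neither 0 nor infinite.\<close>

lemma nn_integral_powr_outside:
  "(\<integral>\<^sup>+x. indicator {x::'a::euclidean_space. 1 \<le> norm x} x * ennreal (norm x powr (- s)) \<partial>lborel) < \<infinity>
     \<longleftrightarrow> real DIM('a) < s"
proof -
  let ?A = "{x::'a. 1 \<le> norm x \<and> norm x < 2}"
  let ?S = "(\<Sum>j. ennreal ((2 powr (real DIM('a) - s)) ^ j))"
  let ?F = "(\<integral>\<^sup>+x. indicator ?A x * ennreal (norm x powr (- s)) \<partial>lborel)"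
  have eq: "{x. (1 / 2 ^ j) *\<^sub>R x \<in> ?A} = {x. 2 ^ j \<le> norm x \<and> norm x < 2 * 2 ^ j}" for j :: nat
    by (auto simp: field_simps)
  have U: "(\<Union>j. {x. 2 ^ j \<le> norm x \<and> norm x < 2 * 2 ^ j}) = {x::'a. 1 \<le> norm x}"
    using ex_dyadic by (auto intro: order_trans[rotated])
  have Am: "?A \<in> sets borel" by measurable
  have D: "disjoint_family (\<lambda>j::nat. {x. (1 / 2 ^ j) *\<^sub>R x \<in> ?A})"
    unfolding eq by (rule dyadic_disjoint)
  have I: "(\<integral>\<^sup>+x. indicator {x::'a. 1 \<le> norm x} x * ennreal (norm x powr (- s)) \<partial>lborel)
     = ?S * ?F"
    using nn_integral_dyadic_shells[of ?A 2 s, OF Am zero_less_numeral D] unfolding eq U .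
  have F: "?F < \<infinity>"
    "?F \<noteq> 0"
    by (intro shell_moment; force)+
  show ?thesis
  proof (cases "real DIM('a) < s")
    case True
    then have "2 powr (real DIM('a) - s) < 1" by (intro powr_less_one) auto
    then have "?S < \<infinity>"
      by (intro suminf_geometric_ennreal_finite) auto
    then show ?thesis using True F unfolding I by (simp add: ennreal_mult_less_top)
  next
    case False
    then have "2 powr (real DIM('a) - s) \<ge> 1" by (intro ge_one_powr_ge_zero) auto
    then have "?S = \<infinity>"
      by (rule suminf_geometric_ennreal_infinite)
    then show ?thesis using False F unfolding I by (simp add: ennreal_mult_less_top)
  qed
qed

text \<open>Here the ratio is \<open>(1/2) powr (N - s)\<close>. Writing the shells through
  \<open>1 / norm x\<close> makes the dyadic lemmas for numbers at least 1 applicable, and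
  \<open>1 / 0 = 0\<close> keeps the origin out of every shell.\<close>

lemma nn_integral_powr_inside:
  "(\<integral>\<^sup>+x. indicator (cball (0::'a::euclidean_space) 1) x * ennreal (norm x powr (- s)) \<partial>lborel) < \<infinity>
     \<longleftrightarrow> s < real DIM('a)"
proof -
  let ?A = "{x::'a. 1 \<le> 1 / norm x \<and> 1 / norm x < 2}"
  let ?S = "(\<Sum>j. ennreal (((1/2) powr (real DIM('a) - s)) ^ j))"
  let ?F = "(\<integral>\<^sup>+x. indicator ?A x * ennreal (norm x powr (- s)) \<partial>lborel)"
  have eq: "{x. (1 / (1/2) ^ j) *\<^sub>R x \<in> ?A} = {x. 2 ^ j \<le> 1 / norm x \<and> 1 / norm x < 2 * 2 ^ j}" for j :: nat
  proof -
    have n: "1 / norm ((1 / (1/2) ^ j) *\<^sub>R x) = (1 / norm x) / 2 ^ j" for x :: 'a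
      by (simp add: power_one_over)
    have "(1 \<le> t / 2 ^ j \<and> t / 2 ^ j < 2) \<longleftrightarrow> (2 ^ j \<le> t \<and> t < 2 * 2 ^ j)" for t :: real
      by (simp add: pos_le_divide_eq pos_divide_less_eq)
    then show ?thesis by (simp only: mem_Collect_eq n)
  qed
  have U: "(\<Union>j. {x. 2 ^ j \<le> 1 / norm x \<and> 1 / norm x < 2 * 2 ^ j}) = {x::'a. 1 \<le> 1 / norm x}"
    using ex_dyadic by (auto intro: order_trans[rotated])
  have Am: "?A \<in> sets borel" by measurable
  have D: "disjoint_family (\<lambda>j::nat. {x. (1 / (1/2) ^ j) *\<^sub>R x \<in> ?A})"
    unfolding eq by (rule dyadic_disjoint)
  have "(\<integral>\<^sup>+x. indicator {x::'a. 1 \<le> 1 / norm x} x * ennreal (norm x powr (- s)) \<partial>lborel)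
     = ?S * ?F"
    using nn_integral_dyadic_shells[of ?A "1/2" s, OF Am half_gt_zero[OF zero_less_one] D] unfolding eq U .
  \<comment> \<open>The two regions differ only at the origin, where the integrand is 0 because
    \<open>0 powr (- s) = 0\<close>.\<close>
  moreover have "(\<integral>\<^sup>+x. indicator {x::'a. 1 \<le> 1 / norm x} x * ennreal (norm x powr (- s)) \<partial>lborel)
     = (\<integral>\<^sup>+x. indicator (cball (0::'a) 1) x * ennreal (norm x powr (- s)) \<partial>lborel)"
  proof (rule nn_integral_cong)
    fix x :: 'a
    show "indicator {x. 1 \<le> 1 / norm x} x * ennreal (norm x powr - s) = indicator (cball 0 1) x * ennreal (norm x powr - s)"
      by (cases "x = 0") (simp_all add: indicator_def pos_le_divide_eq)
  qed
  ultimately have I: "(\<integral>\<^sup>+x. indicator (cball (0::'a) 1) x * ennreal (norm x powr (- s)) \<partial>lborel)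
     = ?S * ?F"
    by simp
  have F: "?F < \<infinity>"
    "?F \<noteq> 0"
  proof -
    have mem: "x \<in> ?A \<longleftrightarrow> 1/2 < norm x \<and> norm x \<le> 1" for x
      by (cases "x = 0") (auto simp: pos_le_divide_eq pos_divide_less_eq)
    have lower: "x \<in> ?A \<or> (1/2) *\<^sub>R x \<in> ?A" if "1 < norm x" "norm x < 2" for x
      using that unfolding mem by simp
    have upper: "1/2 \<le> norm x \<and> norm x \<le> 2" if "x \<in> ?A" for x
      using that unfolding mem by simp
    show "?F < \<infinity>"
      "?F \<noteq> 0"
      using shell_moment[OF Am lower upper, of s] by simp_all
  qed
  have h: "(1/2) powr (real DIM('a) - s) = 2 powr (s - real DIM('a))"
    by (simp add: powr_divide powr_diff)
  show ?thesis
  proof (cases "s < real DIM('a)")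
    case True
    then have "(1/2) powr (real DIM('a) - s) < (1::real)" unfolding h by (intro powr_less_one) auto
    then have "?S < \<infinity>"
      by (intro suminf_geometric_ennreal_finite) auto
    then show ?thesis using True F unfolding I by (simp add: ennreal_mult_less_top)
  next
    case False
    have "(1/2) powr (real DIM('a) - s) \<ge> 1" unfolding h using False by (intro ge_one_powr_ge_zero) auto
    then have "?S = \<infinity>"
      by (intro suminf_geometric_ennreal_infinite)
    then show ?thesis using False F unfolding I by (simp add: ennreal_mult_less_top)
  qed
qed

section \<open>The fractional Laplacian under similarities\<close>

text \<open>With \<open>K\<close> equal to N + 2\<alpha> this is the reciprocal of the density of
  \<open>omega_measure\<close>.\<close>

abbreviation (input) weight :: "real \<Rightarrow> 'a::real_normed_vector \<Rightarrow> real" where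
  "weight K x \<equiv> 1 + norm x powr K"

text \<open>Multiplying the quotient by the positive weight recovers the measurability of
  \<open>f\<close>, so the equivalence holds for arbitrary \<open>f\<close>.\<close>

lemma omega_integrable_iff:
  fixes f :: "real^'n \<Rightarrow> real"
  shows "integrable (omega_measure \<alpha>) f
     \<longleftrightarrow> integrable lebesgue (\<lambda>x. f x / weight (real CARD('n) + 2 * \<alpha>) x)"
proof -
  let ?w = "\<lambda>x::real^'n. 1 + norm x powr (real CARD('n) + 2 * \<alpha>)"
  have w: "?w x > 0" for x by (smt (verit) powr_ge_zero)
  have [measurable]: "?w \<in> borel_measurable lebesgue"
    by (rule measurable_completion) simp
  have eq: "integrable (omega_measure \<alpha>) f \<longleftrightarrow> integrable lebesgue (\<lambda>x. f x / ?w x)"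
    if [measurable]: "f \<in> borel_measurable lebesgue"
    unfolding omega_measure_def using w by (subst integrable_density) (auto simp: less_imp_le)
  show ?thesis
  proof
    assume L: "integrable (omega_measure \<alpha>) f"
    then have "f \<in> borel_measurable lebesgue"
      using borel_measurable_integrable[OF L] by (simp add: omega_measure_def)
    with L eq show "integrable lebesgue (\<lambda>x. f x / ?w x)" by blast
  next
    assume R: "integrable lebesgue (\<lambda>x. f x / ?w x)"
    have "(\<lambda>x. (f x / ?w x) * ?w x) \<in> borel_measurable lebesgue"
      using borel_measurable_integrable[OF R] by measurable
    moreover have "(\<lambda>x. (f x / ?w x) * ?w x) = f"
      using w by (intro ext) (simp add: less_imp_neq[symmetric])
    ultimately have "f \<in> borel_measurable lebesgue" by simp
    with R eq show "integrable (omega_measure \<alpha>) f" by blast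
  qed
qed

lemma powr_add_le:
  fixes a b K :: real
  assumes "0 \<le> a" "0 \<le> b" "0 \<le> K"
  shows "(a + b) powr K \<le> 2 powr K * (a powr K + b powr K)"
proof -
  have "(a + b) powr K \<le> (2 * max a b) powr K"
    using assms by (intro powr_mono2) auto
  also have "\<dots> = 2 powr K * max a b powr K" using assms by (simp add: powr_mult)
  also have "max a b powr K \<le> a powr K + b powr K" by (simp add: max_def)
  finally show ?thesis by simp
qed

text \<open>Since \<open>l * norm x = norm (T x - T 0)\<close>, the norm of \<open>x\<close> is
  controlled by those of \<open>T x\<close> and \<open>T 0\<close>. The converse comparison comes
  from the inverse similarity. Hence both the decay required of test functions and
  \<omega>-integrability survive a similarity.\<close>

lemma similarity_weight:
  assumes T: "similarity l T" and K: "0 \<le> K"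
  shows "\<exists>D>0. \<forall>x. 1 + norm x powr K \<le> D * weight K (T x)"
proof (intro exI[of _ "1 + (2 / l) powr K * (1 + norm (T 0) powr K)"] conjI allI)
  have l: "l > 0" using similarity_pos[OF T] .
  let ?b = "norm (T 0)"
  show "1 + (2 / l) powr K * (1 + ?b powr K) > 0" by (smt (verit) powr_ge_zero mult_nonneg_nonneg)
  fix x
  have "l * norm x = norm (T x - T 0)" using similarity_dist[OF T, of x 0] by simp
  also have "\<dots> \<le> norm (T x) + ?b" by (rule norm_triangle_ineq4)
  finally have "norm x \<le> (norm (T x) + ?b) / l" using l by (simp add: field_simps)
  then have "norm x powr K \<le> ((norm (T x) + ?b) / l) powr K" using K by (intro powr_mono2) auto
  also have "\<dots> = (1 / l) powr K * (norm (T x) + ?b) powr K" using l by (simp add: powr_divide)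
  also have "\<dots> \<le> (1 / l) powr K * (2 powr K * (norm (T x) powr K + ?b powr K))"
    using K by (intro mult_left_mono powr_add_le) auto
  also have "\<dots> = (2 / l) powr K * (norm (T x) powr K + ?b powr K)" using l by (simp add: powr_divide)
  finally have "norm x powr K \<le> (2 / l) powr K * (norm (T x) powr K + ?b powr K)" .
  also have "\<dots> \<le> (2 / l) powr K * ((1 + ?b powr K) * weight K (T x))"
    by (intro mult_left_mono) (auto simp: algebra_simps)
  finally show "1 + norm x powr K \<le> (1 + (2 / l) powr K * (1 + ?b powr K)) * weight K (T x)"
    by (simp add: algebra_simps add_increasing)
qed

context
  fixes \<alpha> :: real and l :: real and T :: "real^'n \<Rightarrow> real^'n"
  assumes T: "similarity l T"
begin

lemma frac_kernel_similarity:
  "frac_kernel \<alpha> (\<lambda>y. u (T y)) x z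
     = l powr (real CARD('n) + 2 * \<alpha>) * frac_kernel \<alpha> u (T x) (T z)"
  using similarity_pos[OF T] by (simp add: frac_kernel_def similarity_dist[OF T] powr_mult)

lemma truncated_similarity:
  "indicator {z. norm (z - x) > \<epsilon>} z *\<^sub>R frac_kernel \<alpha> (\<lambda>y. u (T y)) x z
     = l powr (real CARD('n) + 2 * \<alpha>) * (indicator {z. norm (z - T x) > l * \<epsilon>} (T z) *\<^sub>R frac_kernel \<alpha> u (T x) (T z))"
  using similarity_pos[OF T] by (simp add: frac_kernel_similarity indicator_def similarity_dist[OF T])

lemma set_integrable_frac_kernel_similarity:
  "set_integrable lebesgue {z. norm (z - x) > \<epsilon>} (frac_kernel \<alpha> (\<lambda>y. u (T y)) x)
     \<longleftrightarrow> set_integrable lebesgue {z. norm (z - T x) > l * \<epsilon>} (frac_kernel \<alpha> u (T x))"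
  unfolding set_integrable_def truncated_similarity
  using similarity_pos[OF T]
    similarity_integrable_iff[OF T, of "\<lambda>z. indicator {z. norm (z - T x) > l * \<epsilon>} z *\<^sub>R frac_kernel \<alpha> u (T x) z"]
  by simp

text \<open>The kernel contributes \<open>l powr (N + 2 * \<alpha>)\<close>, the change of variables
  removes \<open>l ^ N\<close>, and the truncation radius is stretched by \<open>l\<close>.\<close>

lemma frac_lap_eps_similarity:
  "frac_lap_eps \<alpha> \<epsilon> (\<lambda>y. u (T y)) x = l powr (2 * \<alpha>) * frac_lap_eps \<alpha> (l * \<epsilon>) u (T x)"
proof -
  have l: "l > 0" using similarity_pos[OF T] .
  let ?h = "\<lambda>z. indicator {z. norm (z - T x) > l * \<epsilon>} z *\<^sub>R frac_kernel \<alpha> u (T x) z"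
  have "frac_lap_eps \<alpha> \<epsilon> (\<lambda>y. u (T y)) x = - (l powr (real CARD('n) + 2 * \<alpha>) * (LINT z|lebesgue. ?h (T z)))"
    unfolding frac_lap_eps_def set_lebesgue_integral_def truncated_similarity by simp
  also have "l powr (real CARD('n) + 2 * \<alpha>) = l powr (2 * \<alpha>) * l ^ CARD('n)"
    using l by (simp add: powr_add powr_realpow)
  finally show ?thesis
    using similarity_integral[OF T, of ?h]
    by (simp add: frac_lap_eps_def set_lebesgue_integral_def)
qed

lemma frac_lap_similarity:
  assumes "frac_lap_exists \<alpha> u (T x)"
  shows "frac_lap_exists \<alpha> (\<lambda>y. u (T y)) x"
    and "frac_lap \<alpha> (\<lambda>y. u (T y)) x = l powr (2 * \<alpha>) * frac_lap \<alpha> u (T x)"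
proof -
  have l: "l > 0" using similarity_pos[OF T] .
  obtain L where L: "((\<lambda>\<epsilon>. frac_lap_eps \<alpha> \<epsilon> u (T x)) \<longlongrightarrow> L) (at_right 0)"
    using assms by (auto simp: frac_lap_exists_def)
  have "filterlim (\<lambda>\<epsilon>. l * \<epsilon>) (at_right 0) (at_right 0)"
  proof (rule filterlim_at_withinI)
    show "((\<lambda>\<epsilon>. l * \<epsilon>) \<longlongrightarrow> 0) (at_right 0)"
      using tendsto_mult_left[OF tendsto_ident_at, of l 0 "{0<..}"] by simp
    show "\<forall>\<^sub>F \<epsilon> in at_right 0. l * \<epsilon> \<in> {0<..} - {0}"
      using eventually_at_right_less[of 0] by eventually_elim (use l in auto)
  qed
  from filterlim_compose[OF L this]
  have lim: "((\<lambda>\<epsilon>. frac_lap_eps \<alpha> \<epsilon> (\<lambda>y. u (T y)) x) \<longlongrightarrow> l powr (2 * \<alpha>) * L) (at_right 0)"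
    unfolding frac_lap_eps_similarity by (intro tendsto_intros)
  show "frac_lap_exists \<alpha> (\<lambda>y. u (T y)) x"
    unfolding frac_lap_exists_def set_integrable_frac_kernel_similarity
  proof (intro conjI allI impI)
    show "set_integrable lebesgue {z. norm (z - T x) > l * \<epsilon>} (frac_kernel \<alpha> u (T x))" if "\<epsilon> > 0" for \<epsilon>
      using assms that l unfolding frac_lap_exists_def by simp
    show "\<exists>L. ((\<lambda>\<epsilon>. frac_lap_eps \<alpha> \<epsilon> (\<lambda>y. u (T y)) x) \<longlongrightarrow> L) (at_right 0)"
      using lim by blast
  qed
  show "frac_lap \<alpha> (\<lambda>y. u (T y)) x = l powr (2 * \<alpha>) * frac_lap \<alpha> u (T x)"
    unfolding frac_lap_def tendsto_Lim[OF trivial_limit_at_right_real lim] tendsto_Lim[OF trivial_limit_at_right_real L] ..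
qed

text \<open>This allows a similarity to be moved from the solution to the test function in the weak
  identity.\<close>

lemma test_functions_similarity:
  assumes alpha: "0 < \<alpha>" and \<xi>: "\<xi> \<in> test_functions \<alpha>"
  shows "(\<lambda>x. \<xi> (T x)) \<in> test_functions \<alpha>"
proof -
  have l: "l > 0" using similarity_pos[OF T] .
  let ?K = "real CARD('n) + 2 * \<alpha>"
  have cont: "continuous_on UNIV \<xi>" and comp: "compact (closure {x. \<xi> x \<noteq> 0})"
    and ex: "\<And>x. frac_lap_exists \<alpha> \<xi> x"
    using \<xi> by (auto simp: test_functions_def)
  obtain C where C: "C > 0" "\<And>x. \<bar>frac_lap \<alpha> \<xi> x\<bar> \<le> C / weight ?K x"
    using \<xi> by (auto simp: test_functions_def)
  obtain \<phi> e where \<phi>: "integrable lebesgue \<phi>" "e > 0"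
    "\<And>\<epsilon>. \<epsilon> \<in> {0<..e} \<Longrightarrow> AE x in lebesgue. \<bar>frac_lap_eps \<alpha> \<epsilon> \<xi> x\<bar> \<le> \<phi> x"
    using \<xi> by (auto simp: test_functions_def)
  obtain S where S: "similarity (1 / l) S" "\<And>x. S (T x) = x" "\<And>x. T (S x) = x"
    by (rule similarity_inverse[OF T]) (rule that)
  have 1: "continuous_on UNIV (\<lambda>x. \<xi> (T x))"
    using continuous_on_compose2[OF cont similarity_continuous[OF T]] by simp
  have 2: "compact (closure {x. \<xi> (T x) \<noteq> 0})"
  proof -
    have c: "compact (S ` closure {x. \<xi> x \<noteq> 0})"
      using comp by (intro compact_continuous_image similarity_continuous[OF S(1)])
    have "{x. \<xi> (T x) \<noteq> 0} \<subseteq> S ` closure {x. \<xi> x \<noteq> 0}"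
    proof
      fix x assume "x \<in> {x. \<xi> (T x) \<noteq> 0}"
      then have "T x \<in> closure {x. \<xi> x \<noteq> 0}" by (intro closure_subset[THEN subsetD]) simp
      then show "x \<in> S ` closure {x. \<xi> x \<noteq> 0}" by (rule image_eqI[where f=S and x="T x", OF S(2)[of x, symmetric]])
    qed
    then have "bounded {x. \<xi> (T x) \<noteq> 0}" using compact_imp_bounded[OF c] bounded_subset by blast
    then show ?thesis by (simp add: compact_closure)
  qed
  have 3: "\<exists>C>0. \<forall>x. \<bar>frac_lap \<alpha> (\<lambda>x. \<xi> (T x)) x\<bar> \<le> C / weight ?K x"
  proof -
    obtain D where D: "D > 0" "\<And>x. 1 + norm x powr ?K \<le> D * weight ?K (T x)"
      using similarity_weight[OF T, of ?K] alpha by auto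
    have "\<bar>frac_lap \<alpha> (\<lambda>x. \<xi> (T x)) x\<bar> \<le> (l powr (2 * \<alpha>) * C * D) / weight ?K x" for x
    proof -
      have p: "0 < 1 + norm y powr ?K" for y :: "real^'n" by (smt (verit) powr_ge_zero)
      have "1 / weight ?K (T x) \<le> D / weight ?K x"
        using D(2)[of x] p[of x] p[of "T x"] by (simp add: field_simps)
      then have "C * (1 / weight ?K (T x)) \<le> C * (D / weight ?K x)"
        using C(1) by (intro mult_left_mono) auto
      then have "C / weight ?K (T x) \<le> C * D / weight ?K x" by simp
      with C(2)[of "T x"] have "\<bar>frac_lap \<alpha> \<xi> (T x)\<bar> \<le> C * D / weight ?K x" by simp
      then have "l powr (2 * \<alpha>) * \<bar>frac_lap \<alpha> \<xi> (T x)\<bar> \<le> l powr (2 * \<alpha>) * (C * D / weight ?K x)"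
        by (intro mult_left_mono) auto
      then show ?thesis by (simp add: frac_lap_similarity(2)[OF ex] abs_mult mult.assoc)
    qed
    moreover have "l powr (2 * \<alpha>) * C * D > 0" using l C D by simp
    ultimately show ?thesis by blast
  qed
  \<comment> \<open>Truncating the composed function at \<open>\<epsilon>\<close> truncates
    \<open>\<xi>\<close> at \<open>l * \<epsilon>\<close>, hence the threshold
    \<open>e / l\<close>.\<close>
  have 4: "AE x in lebesgue. \<bar>frac_lap_eps \<alpha> \<epsilon> (\<lambda>x. \<xi> (T x)) x\<bar> \<le> l powr (2 * \<alpha>) * \<phi> (T x)"
    if "\<epsilon> \<in> {0<..e / l}" for \<epsilon>
  proof -
    have "l * \<epsilon> \<in> {0<..e}" using that l by (auto simp: field_simps)
    from similarity_AE[OF T \<phi>(3)[OF this]] show ?thesis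
      by eventually_elim (simp add: frac_lap_eps_similarity abs_mult mult_left_mono)
  qed
  have 5: "integrable lebesgue (\<lambda>x. l powr (2 * \<alpha>) * \<phi> (T x))" "e / l > 0"
    using similarity_integrable[OF T \<phi>(1)] \<phi>(2) l by auto
  show ?thesis
    unfolding test_functions_def using 1 2 3 frac_lap_similarity(1)[OF ex] 4 5 by blast
qed

end

text \<open>Write the test function as \<open>\<eta>\<close> composed with \<open>T\<close>. The
  first term of the identity gains \<open>l powr a\<close> from the solution and
  \<open>l powr (2 * \<alpha>)\<close> from the Laplacian, the second gains
  \<open>l powr (a * p)\<close>; these agree by the choice of \<open>a\<close>, for which
  \<open>p \<noteq> 1\<close> is needed. The change of variables divides by \<open>l ^ N\<close>,
  and the origin is fixed, which gives the new mass.\<close>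

lemma weak_solution_similarity:
  fixes u :: "real^'n \<Rightarrow> real" and Q :: "real^'n \<Rightarrow> real^'n"
  assumes alpha: "0 < \<alpha>" and p: "0 < p" "p \<noteq> 1" and l: "0 < l"
    and Q: "orthogonal_transformation Q" and u: "weak_solution \<alpha> p k u"
  defines "a \<equiv> 2 * \<alpha> / (p - 1)"
  shows "weak_solution \<alpha> p (k * l powr (a * p - real CARD('n))) (\<lambda>x. l powr a * u (l *\<^sub>R Q x))"
proof -
  let ?K = "real CARD('n) + 2 * \<alpha>"
  define T where "T = (\<lambda>x. l *\<^sub>R Q x + 0)"
  have T: "similarity l T" unfolding T_def by (rule similarityI[OF l Q])
  have Tx: "l *\<^sub>R Q x = T x" for x by (simp add: T_def)
  have T0: "T 0 = 0" using linear_0[OF orthogonal_transformation_linear[OF Q]] by (simp add: T_def)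
  obtain S where S: "similarity (1 / l) S" "\<And>x. S (T x) = x" "\<And>x. T (S x) = x"
    by (rule similarity_inverse[OF T]) (rule that)
  have S0: "S 0 = 0" using S(2)[of 0] T0 by simp
  have ap: "a * p = a + 2 * \<alpha>" using p by (simp add: a_def field_simps)
  have nonneg: "\<And>x. 0 \<le> u x" and int1: "integrable (omega_measure \<alpha>) u"
    and int2: "integrable (omega_measure \<alpha>) (\<lambda>x. u x powr p)" and lim: "(u \<longlongrightarrow> 0) at_infinity"
    and test: "\<And>\<xi>. \<xi> \<in> test_functions \<alpha> \<Longrightarrow> (LINT x|lebesgue. u x * frac_lap \<alpha> \<xi> x + u x powr p * \<xi> x) = k * \<xi> 0"
    using u by (auto simp: weak_solution_def)
  \<comment> \<open>The weight at \<open>x\<close> is first traded for the weight at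
    \<open>S x\<close>; composing with \<open>T\<close> then restores the original weight.\<close>
  have int: "integrable (omega_measure \<alpha>) (\<lambda>x. c * f (T x))"
    if "integrable (omega_measure \<alpha>) f" for f :: "real^'n \<Rightarrow> real" and c
  proof -
    obtain D where D: "D > 0" "\<And>x. 1 + norm x powr ?K \<le> D * weight ?K (S x)"
      using similarity_weight[OF S(1), of ?K] alpha by auto
    have p0: "0 < 1 + norm y powr ?K" for y :: "real^'n" by (smt (verit) powr_ge_zero)
    have f: "integrable lebesgue (\<lambda>x. f x / weight ?K x)"
      using that by (simp add: omega_integrable_iff)
    have m: "(\<lambda>x. 1 + norm x powr ?K) \<in> borel_measurable lebesgue"
      by (rule measurable_completion) simp
    have mS: "(\<lambda>x. 1 + norm (S x) powr ?K) \<in> borel_measurable lebesgue"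
      by (rule measurable_compose[OF similarity_measurable[OF S(1)] m])
    have "integrable lebesgue (\<lambda>x. D * (f x / weight ?K x))" by (intro integrable_mult_right f)
    then have "integrable lebesgue (\<lambda>x. f x / weight ?K (S x))"
    proof (rule Bochner_Integration.integrable_bound)
      have fm: "f \<in> borel_measurable lebesgue"
        using borel_measurable_integrable[OF that] by (simp add: omega_measure_def)
      then show "(\<lambda>x. f x / weight ?K (S x)) \<in> borel_measurable lebesgue"
        using mS by (rule borel_measurable_divide)
      show "AE x in lebesgue. norm (f x / weight ?K (S x)) \<le> norm (D * (f x / weight ?K x))"
      proof (rule AE_I2)
        fix x
        have "1 / weight ?K (S x) \<le> D / weight ?K x"
          using D(2)[of x] p0[of x] p0[of "S x"] by (simp add: field_simps)
        then have "\<bar>f x\<bar> * (1 / weight ?K (S x)) \<le> \<bar>f x\<bar> * (D / weight ?K x)"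
          by (intro mult_left_mono) auto
        then show "norm (f x / weight ?K (S x)) \<le> norm (D * (f x / weight ?K x))"
          using p0[of x] p0[of "S x"] D(1) by (simp add: abs_mult mult.commute)
      qed
    qed
    from similarity_integrable[OF T this]
    have "integrable lebesgue (\<lambda>x. f (T x) / weight ?K x)" by (simp only: S(2))
    then have "integrable lebesgue (\<lambda>x. c * (f (T x) / weight ?K x))" by (rule integrable_mult_right)
    then show ?thesis unfolding omega_integrable_iff by (simp only: times_divide_eq_right)
  qed
  have vp: "(l powr a * u (T x)) powr p = l powr (a * p) * u (T x) powr p" for x
    using nonneg l by (simp add: powr_mult powr_powr)
  show ?thesis unfolding weak_solution_def Tx
  proof (intro conjI allI ballI)
    show "0 \<le> l powr a * u (T x)" for x using nonneg by simp
    show "integrable (omega_measure \<alpha>) (\<lambda>x. l powr a * u (T x))" by (rule int[OF int1])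
    show "integrable (omega_measure \<alpha>) (\<lambda>x. (l powr a * u (T x)) powr p)"
      unfolding vp by (rule int[OF int2])
    have "filterlim T at_infinity at_infinity"
    proof (rule filterlim_norm_at_top_imp_at_infinity)
      have "norm (T x) = l * norm x" for x using similarity_dist[OF T, of x 0] T0 by simp
      then show "filterlim (\<lambda>x. norm (T x)) at_top at_infinity"
        using filterlim_tendsto_pos_mult_at_top[OF tendsto_const l filterlim_norm_at_top] by simp
    qed
    from filterlim_compose[OF lim this]
    have "((\<lambda>x. l powr a * u (T x)) \<longlongrightarrow> l powr a * 0) at_infinity" by (intro tendsto_intros)
    then show "((\<lambda>x. l powr a * u (T x)) \<longlongrightarrow> 0) at_infinity" by simp
    fix \<xi> :: "real^'n \<Rightarrow> real" assume \<xi>: "\<xi> \<in> test_functions \<alpha>"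
    define \<eta> where "\<eta> = (\<lambda>x. \<xi> (S x))"
    have \<eta>: "\<eta> \<in> test_functions \<alpha>" unfolding \<eta>_def by (rule test_functions_similarity[OF S(1) alpha \<xi>])
    have \<xi>\<eta>: "\<xi> = (\<lambda>x. \<eta> (T x))" by (simp add: \<eta>_def S(2))
    have ex: "frac_lap_exists \<alpha> \<eta> x" for x using \<eta> by (simp add: test_functions_def)
    have "(LINT x|lebesgue. l powr a * u (T x) * frac_lap \<alpha> \<xi> x + (l powr a * u (T x)) powr p * \<xi> x)
       = (LINT x|lebesgue. l powr (a * p) * (u (T x) * frac_lap \<alpha> \<eta> (T x) + u (T x) powr p * \<eta> (T x)))"
      unfolding vp \<xi>\<eta> frac_lap_similarity(2)[OF T ex]
      by (intro Bochner_Integration.integral_cong) (auto simp: ap powr_add algebra_simps)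
    also have "\<dots> = l powr (a * p) * (LINT x|lebesgue. u (T x) * frac_lap \<alpha> \<eta> (T x) + u (T x) powr p * \<eta> (T x))"
      by simp
    also have "\<dots> = l powr (a * p) * ((LINT x|lebesgue. u x * frac_lap \<alpha> \<eta> x + u x powr p * \<eta> x) / l ^ CARD('n))"
      using similarity_integral[OF T, of "\<lambda>x. u x * frac_lap \<alpha> \<eta> x + u x powr p * \<eta> x"] l by simp
    also have "\<dots> = k * l powr (a * p - real CARD('n)) * \<xi> 0"
      unfolding test[OF \<eta>] using l by (simp add: powr_diff powr_realpow \<eta>_def S0)
    finally show "(LINT x|lebesgue. l powr a * u (T x) * frac_lap \<alpha> \<xi> x + (l powr a * u (T x)) powr p * \<xi> x)
      = k * l powr (a * p - real CARD('n)) * \<xi> 0" .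
  qed
qed

section \<open>Kernel integrals and second differences\<close>

lemma integrable_powr_inside:
  assumes "s < real CARD('n)"
  shows "integrable lebesgue (\<lambda>y::real^'n. indicator (cball 0 1) y * norm y powr (- s))"
proof -
  have "integrable lborel (\<lambda>y::real^'n. indicator (cball 0 1) y * norm y powr (- s))"
  proof (rule integrableI_nonneg)
    show "(\<integral>\<^sup>+y. ennreal (indicator (cball (0::real^'n) 1) y * norm y powr (- s)) \<partial>lborel) < \<infinity>"
      using nn_integral_powr_inside[where 'a="real^'n", of s] assms
      by (simp add: ennreal_mult ennreal_indicator)
    show "(\<lambda>y::real^'n. indicator (cball 0 1) y * norm y powr (- s)) \<in> borel_measurable lborel"
      by (intro borel_measurable_times borel_measurable_indicator) simp_all
  qed simp
  then show ?thesis by (subst integrable_completion) (auto dest: borel_measurable_integrable)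
qed

lemma integrable_powr_outside:
  assumes "real CARD('n) < s"
  shows "integrable lebesgue (\<lambda>y::real^'n. indicator {y. 1 \<le> norm y} y * norm y powr (- s))"
proof -
  have "integrable lborel (\<lambda>y::real^'n. indicator {y. 1 \<le> norm y} y * norm y powr (- s))"
  proof (rule integrableI_nonneg)
    show "(\<integral>\<^sup>+y. ennreal (indicator {y::real^'n. 1 \<le> norm y} y * norm y powr (- s)) \<partial>lborel) < \<infinity>"
      using nn_integral_powr_outside[where 'a="real^'n", of s] assms
      by (simp add: ennreal_mult ennreal_indicator)
    show "(\<lambda>y::real^'n. indicator {y. 1 \<le> norm y} y * norm y powr (- s)) \<in> borel_measurable lborel"
      by (intro borel_measurable_times borel_measurable_indicator) simp_all
  qed simp
  then show ?thesis by (subst integrable_completion) (auto dest: borel_measurable_integrable)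
qed

lemma weight_pos: "0 < 1 + norm (x :: real^'n) powr K"
  by (smt (verit) powr_ge_zero)

lemma AE_neq_zero: "AE x::real^'n in lebesgue. x \<noteq> 0"
proof -
  have "{0::real^'n} \<in> null_sets lborel" by (auto simp: null_sets_def)
  then show ?thesis by (intro AE_completion) (rule AE_I'[of "{0}"], auto)
qed

text \<open>In the unit ball |x|^-a is a majorant, integrable because \<open>a < N\<close>; outside
  it \<open>0 \<le> a\<close> makes |x|^-K a majorant, integrable because
  \<open>K > N\<close>.\<close>

lemma integrable_powr_weight:
  assumes a: "0 \<le> a" "a < real CARD('n)" and K: "real CARD('n) < K"
  shows "integrable lebesgue (\<lambda>x::real^'n. norm x powr (- a) / weight K x)"
proof -
  let ?h = "\<lambda>x::real^'n. indicator (cball 0 1) x * norm x powr (- a) + indicator {y. 1 \<le> norm y} x * norm x powr (- K)"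
  have "integrable lebesgue ?h"
    using assms by (intro Bochner_Integration.integrable_add integrable_powr_inside integrable_powr_outside)
  then show ?thesis
  proof (rule Bochner_Integration.integrable_bound)
    show "(\<lambda>x::real^'n. norm x powr (- a) / weight K x) \<in> borel_measurable lebesgue"
      by (rule measurable_completion) simp
    show "AE x in lebesgue. norm (norm x powr (- a) / weight K x) \<le> norm (?h x)"
    proof (rule AE_I2)
      fix x :: "real^'n"
      have w: "0 < weight K x" by (rule weight_pos)
      have "norm x powr (- a) / weight K x \<le> ?h x"
      proof (cases "norm x < 1")
        case True
        have "norm x powr (- a) / weight K x \<le> norm x powr (- a) / 1"
          by (intro divide_left_mono mult_pos_pos w) auto
        then show ?thesis using True by simp
      next
        case False
        have "norm x powr (- a) \<le> norm x powr 0" using False a by (intro powr_mono) auto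
        then have "norm x powr (- a) / weight K x \<le> 1 / weight K x"
          using False w by (intro divide_right_mono) (auto split: if_splits)
        also have "\<dots> \<le> 1 / norm x powr K"
          by (intro divide_left_mono mult_pos_pos w) (use False in auto)
        also have "\<dots> = norm x powr (- K)" by (simp only: powr_minus_divide)
        finally have "norm x powr (- a) / weight K x \<le> norm x powr (- K)" .
        moreover have "0 \<le> indicator (cball 0 1) x * norm x powr (- a)" by simp
        moreover have "indicator {y. 1 \<le> norm y} x = (1::real)" using False by simp
        ultimately show ?thesis by (simp only: mult_1_left)
      qed
      moreover have "0 \<le> norm x powr (- a) / weight K x" using w by simp
      ultimately show "norm (norm x powr (- a) / weight K x) \<le> norm (?h x)"
        by (simp only: real_norm_def)
    qed
  qed
qed

lemma integrable_weight:
  assumes "real CARD('n) < K"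
  shows "integrable lebesgue (\<lambda>x::real^'n. 1 / weight K x)"
proof -
  have "integrable lebesgue (\<lambda>x::real^'n. norm x powr (- 0) / weight K x)"
    using assms by (intro integrable_powr_weight) auto
  moreover have "(\<lambda>x::real^'n. 1 / weight K x) \<in> borel_measurable lebesgue"
    by (rule measurable_completion) simp
  \<comment> \<open>The two sides differ at the origin, where \<open>0 powr 0 = 0\<close>.\<close>
  moreover have "AE x::real^'n in lebesgue. norm x powr (- 0) / weight K x = 1 / weight K x"
    using AE_neq_zero by eventually_elim simp
  ultimately show ?thesis by (rule integrable_cong_AE_imp)
qed

text \<open>By \<open>norm z \<le> norm (z - x) + R\<close> the weight is at most a constant plus a
  multiple of \<open>norm (z - x) powr K\<close>, and the constant is absorbed because
  \<open>norm (z - x) > \<epsilon>\<close>. So the truncated kernel is dominated by the density of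
  \<omega>; that the factor is uniform for \<open>x\<close> in a ball matters for the double
  integral in the integration by parts.\<close>

lemma weight_le_kernel:
  assumes e: "\<epsilon> > 0" and K: "0 \<le> K"
  shows "\<exists>D>0. \<forall>x z :: real^'n. norm x \<le> R \<longrightarrow> norm (z - x) > \<epsilon> \<longrightarrow>
    1 / norm (z - x) powr K \<le> D / weight K z"
proof (intro exI[of _ "(1 + 2 powr K * R powr K) / \<epsilon> powr K + 2 powr K"] conjI allI impI)
  let ?D = "(1 + 2 powr K * R powr K) / \<epsilon> powr K + 2 powr K"
  have "1 + 2 powr K * R powr K > 0" by (smt (verit) powr_ge_zero mult_nonneg_nonneg)
  then show "?D > 0" using e by (simp add: add_pos_nonneg)
  fix x z :: "real^'n" assume x: "norm x \<le> R" and z: "norm (z - x) > \<epsilon>"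
  then have pz: "norm (z - x) powr K > 0" using e by auto
  have ge: "1 \<le> norm (z - x) powr K / \<epsilon> powr K"
    using z e K powr_mono2[of K \<epsilon> "norm (z - x)"] by simp
  have "norm z powr K \<le> (norm (z - x) + R) powr K"
    using K x norm_triangle_ineq[of "z - x" x] by (intro powr_mono2) auto
  also have "\<dots> \<le> 2 powr K * (norm (z - x) powr K + R powr K)"
    using K x order_trans[OF norm_ge_zero x] by (intro powr_add_le) auto
  finally have "1 + norm z powr K \<le> (1 + 2 powr K * R powr K) * 1 + 2 powr K * norm (z - x) powr K"
    by (simp add: algebra_simps)
  also have "\<dots> \<le> (1 + 2 powr K * R powr K) * (norm (z - x) powr K / \<epsilon> powr K) + 2 powr K * norm (z - x) powr K"
    using ge by (intro add_right_mono mult_left_mono) auto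
  also have "\<dots> = ?D * norm (z - x) powr K" by (simp add: distrib_right)
  finally show "1 / norm (z - x) powr K \<le> ?D / weight K z"
    using pz weight_pos[of z K] by (simp add: pos_divide_le_eq pos_le_divide_eq)
qed

lemma set_integrable_frac_kernel:
  fixes f :: "real^'n \<Rightarrow> real"
  assumes alpha: "\<alpha> > 0" and f: "integrable (omega_measure \<alpha>) f" and e: "\<epsilon> > 0"
  shows "set_integrable lebesgue {z. norm (z - x) > \<epsilon>} (frac_kernel \<alpha> f x)"
proof -
  let ?K = "real CARD('n) + 2 * \<alpha>"
  obtain D where D: "D > 0" "\<And>z. norm (z - x) > \<epsilon> \<Longrightarrow> 1 / norm (z - x) powr ?K \<le> D / weight ?K z"
    using weight_le_kernel[OF e, of ?K "norm x"] alpha by auto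
  have fi: "integrable lebesgue (\<lambda>z. f z / weight ?K z)" using f by (simp add: omega_integrable_iff)
  have wi: "integrable lebesgue (\<lambda>z::real^'n. 1 / weight ?K z)" using alpha by (intro integrable_weight) auto
  have [measurable]: "f \<in> borel_measurable lebesgue"
    using borel_measurable_integrable[OF f] by (simp add: omega_measure_def)
  have [measurable]: "(\<lambda>z. norm (z - x) powr ?K) \<in> borel_measurable lebesgue"
    "{z. norm (z - x) > \<epsilon>} \<in> sets lebesgue"
    by (auto intro!: measurable_completion sets_completionI_sets)
  have "integrable lebesgue (\<lambda>z. D * (\<bar>f z / weight ?K z\<bar> + \<bar>f x\<bar> * (1 / weight ?K z)))"
    by (intro integrable_mult_right Bochner_Integration.integrable_add integrable_abs fi wi)
  then show ?thesis
    unfolding set_integrable_def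
  proof (rule Bochner_Integration.integrable_bound)
    show "(\<lambda>z. indicator {z. norm (z - x) > \<epsilon>} z *\<^sub>R frac_kernel \<alpha> f x z) \<in> borel_measurable lebesgue"
      unfolding frac_kernel_def by measurable
    show "AE z in lebesgue. norm (indicator {z. norm (z - x) > \<epsilon>} z *\<^sub>R frac_kernel \<alpha> f x z)
       \<le> norm (D * (\<bar>f z / weight ?K z\<bar> + \<bar>f x\<bar> * (1 / weight ?K z)))"
    proof (rule AE_I2)
      fix z
      show "norm (indicator {z. norm (z - x) > \<epsilon>} z *\<^sub>R frac_kernel \<alpha> f x z)
       \<le> norm (D * (\<bar>f z / weight ?K z\<bar> + \<bar>f x\<bar> * (1 / weight ?K z)))"
      proof (cases "norm (z - x) > \<epsilon>")
        case True
        have "norm (frac_kernel \<alpha> f x z) = \<bar>f z - f x\<bar> * (1 / norm (z - x) powr ?K)"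
          by (simp add: frac_kernel_def abs_divide)
        also have "\<dots> \<le> (\<bar>f z\<bar> + \<bar>f x\<bar>) * (D / weight ?K z)"
          using D(2)[OF True] by (intro mult_mono) auto
        also have "\<dots> = D * (\<bar>f z / weight ?K z\<bar> + \<bar>f x\<bar> * (1 / weight ?K z))"
          by (simp only: abs_divide abs_of_pos[OF weight_pos]) (simp add: distrib_left distrib_right add_divide_distrib mult.commute)
        finally show ?thesis using True by simp
      qed simp
    qed
  qed
qed

text \<open>The kernel is even, so averaging over \<open>x + y\<close> and \<open>x - y\<close>
  replaces first differences by second ones. Their bound turns the singularity into
  \<open>norm y powr (2 - K)\<close>, with K = N + 2\<alpha>, which is integrable near 0 because
  \<alpha> < 1. The second claim bounds the truncations uniformly in the radius and later serves as
  domination.\<close>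

lemma second_difference_lap:
  fixes f :: "real^'n \<Rightarrow> real" and x :: "real^'n"
  assumes alpha: "0 < \<alpha>" "\<alpha> < 1"
    and int: "\<And>\<epsilon>. \<epsilon> > 0 \<Longrightarrow> set_integrable lebesgue {z. norm (z - x) > \<epsilon>} (frac_kernel \<alpha> f x)"
    and r: "0 < r" "r \<le> 1" and B: "0 \<le> B"
    and diff: "\<And>y. norm y \<le> r \<Longrightarrow> \<bar>f (x + y) + f (x - y) - 2 * f x\<bar> \<le> B * (norm y)\<^sup>2"
  defines "c \<equiv> (LINT y|lebesgue. indicator (cball 0 1) y * norm (y::real^'n) powr (- (real CARD('n) + 2 * \<alpha> - 2)))"
  shows "frac_lap_exists \<alpha> f x"
    and "\<And>\<epsilon>. 0 < \<epsilon> \<Longrightarrow> \<epsilon> \<le> r \<Longrightarrow> \<bar>frac_lap_eps \<alpha> \<epsilon> f x\<bar> \<le> B * c + \<bar>frac_lap_eps \<alpha> r f x\<bar>"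
proof -
  let ?K = "real CARD('n) + 2 * \<alpha>"
  let ?d = "\<lambda>y::real^'n. indicator (cball 0 1) y * norm y powr (- (?K - 2))"
  define h where "h y = indicator (cball 0 r) y * ((f (x + y) + f (x - y) - 2 * f x) / norm y powr ?K)" for y
  define k where "k \<epsilon> z = indicator {z. norm (z - x) > \<epsilon>} z * frac_kernel \<alpha> f x z" for \<epsilon> z
  have ki: "integrable lebesgue (k \<epsilon>)" if "\<epsilon> > 0" for \<epsilon>
    using int[OF that] by (simp add: k_def[abs_def] set_integrable_def)
  have lap: "frac_lap_eps \<alpha> \<epsilon> f x = - (LINT z|lebesgue. k \<epsilon> z)" for \<epsilon>
    by (simp add: frac_lap_eps_def set_lebesgue_integral_def k_def)
  have di: "integrable lebesgue ?d" using alpha by (intro integrable_powr_inside) auto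
  have plus: "similarity 1 (\<lambda>y. 1 *\<^sub>R id y + x)"
    by (rule similarityI) (auto simp: orthogonal_transformation_id)
  have minus: "similarity 1 (\<lambda>y. 1 *\<^sub>R (- y) + x)"
    by (rule similarityI) (auto simp: orthogonal_transformation_def linear_uminus)
  have T: "integrable lebesgue (\<lambda>y. g (x + y))" "(LINT y|lebesgue. g (x + y)) = integral\<^sup>L lebesgue g"
     "integrable lebesgue (\<lambda>y. g (x - y))" "(LINT y|lebesgue. g (x - y)) = integral\<^sup>L lebesgue g"
     if "integrable lebesgue g" for g :: "real^'n \<Rightarrow> real"
    using similarity_integrable[OF plus that] similarity_integrable[OF minus that]
      similarity_integral[OF plus, of g] similarity_integral[OF minus, of g]
    by (simp_all add: add.commute)
  have hb: "\<bar>h y\<bar> \<le> B * ?d y" for y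
  proof (cases "norm y \<le> r \<and> y \<noteq> 0")
    case True
    then have "\<bar>h y\<bar> = \<bar>f (x + y) + f (x - y) - 2 * f x\<bar> / norm y powr ?K" by (simp add: h_def abs_divide)
    also have "\<dots> \<le> B * (norm y)\<^sup>2 / norm y powr ?K"
      using diff[of y] True by (intro divide_right_mono) auto
    also have "(norm y)\<^sup>2 = norm y powr 2" using True by (simp add: powr_numeral)
    also have "B * norm y powr 2 / norm y powr ?K = B * norm y powr (- (?K - 2))"
      by (simp only: minus_diff_eq powr_diff times_divide_eq_right)
    finally show ?thesis using True r by simp
  next
    case False
    then show ?thesis using B by (auto simp: h_def indicator_def)
  qed
  \<comment> \<open>The shell between \<open>\<epsilon>\<close> and \<open>r\<close> carries only
    the second difference, while the part beyond \<open>r\<close> does not depend on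
    \<open>\<epsilon>\<close>. Integrating counts each side twice, hence the division by 2 in
    \<open>I(2)\<close>.\<close>
  have split: "k \<epsilon> (x + y) + k \<epsilon> (x - y) = indicator {y. norm y > \<epsilon>} y * h y + (k r (x + y) + k r (x - y))"
    if "0 < \<epsilon>" "\<epsilon> \<le> r" for \<epsilon> y
    using that by (auto simp: k_def h_def indicator_def frac_kernel_def add_divide_distrib diff_divide_distrib)
  have I: "integrable lebesgue (\<lambda>y. indicator {y. norm y > \<epsilon>} y * h y)"
    "frac_lap_eps \<alpha> \<epsilon> f x = frac_lap_eps \<alpha> r f x - (LINT y|lebesgue. indicator {y. norm y > \<epsilon>} y * h y) / 2"
    if e: "0 < \<epsilon>" "\<epsilon> \<le> r" for \<epsilon>
  proof -
    have eq: "indicator {y. norm y > \<epsilon>} y * h y = (k \<epsilon> (x + y) + k \<epsilon> (x - y)) - (k r (x + y) + k r (x - y))" for y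
      using split[OF e, of y] by simp
    note ke = ki[OF e(1)] and kr = ki[OF r(1)]
    show "integrable lebesgue (\<lambda>y. indicator {y. norm y > \<epsilon>} y * h y)"
      unfolding eq by (intro Bochner_Integration.integrable_diff Bochner_Integration.integrable_add T ke kr)
    have "(LINT y|lebesgue. indicator {y. norm y > \<epsilon>} y * h y) = 2 * integral\<^sup>L lebesgue (k \<epsilon>) - 2 * integral\<^sup>L lebesgue (k r)"
      unfolding eq using T[OF ke] T[OF kr] by simp
    then show "frac_lap_eps \<alpha> \<epsilon> f x = frac_lap_eps \<alpha> r f x - (LINT y|lebesgue. indicator {y. norm y > \<epsilon>} y * h y) / 2"
      unfolding lap by linarith
  qed
  have lim0: "(\<lambda>n. indicator {y. norm y > S n} y * h y) \<longlonglongrightarrow> h y" if S: "S \<longlonglongrightarrow> 0" for y and S :: "nat \<Rightarrow> real"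
  proof (cases "y = 0")
    case True then show ?thesis by (simp add: h_def)
  next
    case False
    then have "\<forall>\<^sub>F n in sequentially. S n < norm y" using order_tendstoD(2)[OF S, of "norm y"] by simp
    then have "\<forall>\<^sub>F n in sequentially. indicator {y. norm y > S n} y * h y = h y"
      by eventually_elim simp
    then show ?thesis by (rule tendsto_eventually)
  qed
  \<comment> \<open>Measurability of \<open>h\<close> is inherited from its truncations, which are
    integrable as differences of truncated kernels.\<close>
  have hm: "h \<in> borel_measurable lebesgue"
  proof (rule borel_measurable_LIMSEQ_real)
    have "(\<lambda>n. r / real (Suc n)) \<longlonglongrightarrow> 0"
      using LIMSEQ_Suc[OF lim_const_over_n[of r]] by simp
    then show "(\<lambda>n. indicator {y. norm y > r / real (Suc n)} y * h y) \<longlonglongrightarrow> h y" for y by (rule lim0)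
    show "(\<lambda>y. indicator {y. norm y > r / real (Suc n)} y * h y) \<in> borel_measurable lebesgue" for n
      using r by (intro borel_measurable_integrable I(1)) (auto simp: field_simps)
  qed
  have Bd: "integrable lebesgue (\<lambda>y. B * ?d y)" by (intro integrable_mult_right di)
  have "((\<lambda>\<epsilon>. frac_lap_eps \<alpha> \<epsilon> f x) \<longlongrightarrow> frac_lap_eps \<alpha> r f x - integral\<^sup>L lebesgue h / 2) (at_right 0)"
  proof (rule tendsto_at_right_sequentially[OF r(1)])
    fix S :: "nat \<Rightarrow> real" assume S: "\<And>n. 0 < S n" "\<And>n. S n < r" "S \<longlonglongrightarrow> 0"
    have "(\<lambda>n. LINT y|lebesgue. indicator {y. norm y > S n} y * h y) \<longlonglongrightarrow> integral\<^sup>L lebesgue h"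
    proof (rule integral_dominated_convergence[OF hm _ Bd])
      show "(\<lambda>y. indicator {y. norm y > S n} y * h y) \<in> borel_measurable lebesgue" for n
        using S(1)[of n] S(2)[of n] by (intro borel_measurable_integrable I(1)) auto
      show "AE y in lebesgue. (\<lambda>n. indicator {y. norm y > S n} y * h y) \<longlonglongrightarrow> h y"
        using lim0[OF S(3)] by simp
      show "AE y in lebesgue. norm (indicator {y. norm y > S n} y * h y) \<le> B * ?d y" for n
      proof (rule AE_I2)
        fix y
        have "norm (indicator {y. norm y > S n} y * h y) \<le> \<bar>h y\<bar>" by (simp add: indicator_def)
        with hb[of y] show "norm (indicator {y. norm y > S n} y * h y) \<le> B * ?d y" by linarith
      qed
    qed
    then have "(\<lambda>n. frac_lap_eps \<alpha> r f x - (LINT y|lebesgue. indicator {y. norm y > S n} y * h y) / 2) \<longlonglongrightarrow> frac_lap_eps \<alpha> r f x - integral\<^sup>L lebesgue h / 2"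
      by (intro tendsto_intros) auto
    then show "(\<lambda>n. frac_lap_eps \<alpha> (S n) f x) \<longlonglongrightarrow> frac_lap_eps \<alpha> r f x - integral\<^sup>L lebesgue h / 2"
      using I(2)[OF S(1) less_imp_le[OF S(2)]] by simp
  qed
  then show "frac_lap_exists \<alpha> f x" using int unfolding frac_lap_exists_def by blast
  fix \<epsilon> :: real assume e: "0 < \<epsilon>" "\<epsilon> \<le> r"
  have "\<bar>LINT y|lebesgue. indicator {y. norm y > \<epsilon>} y * h y\<bar> \<le> (LINT y|lebesgue. B * ?d y)"
  proof (rule order_trans[OF integral_abs_bound integral_mono])
    show "integrable lebesgue (\<lambda>y. \<bar>indicator {y. norm y > \<epsilon>} y * h y\<bar>)" using I(1)[OF e] by simp
    show "integrable lebesgue (\<lambda>y. B * ?d y)" by fact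
    fix y
    have "\<bar>indicator {y. norm y > \<epsilon>} y * h y\<bar> \<le> \<bar>h y\<bar>" by (simp add: indicator_def)
    with hb[of y] show "\<bar>indicator {y. norm y > \<epsilon>} y * h y\<bar> \<le> B * ?d y" by linarith
  qed
  also have "\<dots> = B * c" by (simp add: c_def)
  finally show "\<bar>frac_lap_eps \<alpha> \<epsilon> f x\<bar> \<le> B * c + \<bar>frac_lap_eps \<alpha> r f x\<bar>"
    unfolding I(2)[OF e] by linarith
qed

section \<open>A test function\<close>

text \<open>With \<open>m = (norm y)\<^sup>2\<close> and \<open>l = 2 * (x \<bullet> y)\<close> the
  arguments of \<open>\<phi>\<close> are \<open>(norm x)\<^sup>2 + (m + l)\<close> and
  \<open>(norm x)\<^sup>2 + (m - l)\<close>. The term linear in \<open>l\<close> cancels in the sum;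
  what remains is \<open>2 * d * m\<close> and two quadratic errors, all of order
  \<open>(norm y)\<^sup>2\<close>. Here \<open>d\<close> stands for the derivative of
  \<open>\<phi>\<close> at \<open>(norm x)\<^sup>2\<close>. The lemma serves the bump and the powers
  of the norm.\<close>

lemma radial_second_difference:
  fixes x y :: "'a::real_inner"
  assumes y: "norm y \<le> 1" and B: "0 \<le> B"
    and quad: "\<And>h. \<bar>h\<bar> \<le> (norm y)\<^sup>2 + 2 * norm x * norm y \<Longrightarrow>
      \<bar>\<phi> ((norm x)\<^sup>2 + h) - \<phi> ((norm x)\<^sup>2) - d * h\<bar> \<le> B * h\<^sup>2"
  shows "\<bar>\<phi> ((norm (x + y))\<^sup>2) + \<phi> ((norm (x - y))\<^sup>2) - 2 * \<phi> ((norm x)\<^sup>2)\<bar>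
    \<le> (2 * \<bar>d\<bar> + 2 * B * (1 + 4 * (norm x)\<^sup>2)) * (norm y)\<^sup>2"
proof -
  define m l where "m = (norm y)\<^sup>2" and "l = 2 * (x \<bullet> y)"
  have m: "0 \<le> m" "m \<le> 1" using y by (auto simp: m_def power_le_one)
  have ab: "\<bar>x \<bullet> y\<bar> \<le> norm x * norm y" by (rule Cauchy_Schwarz_ineq2)
  then have la: "\<bar>l\<bar> \<le> 2 * norm x * norm y" by (simp add: l_def abs_mult)
  then have "\<bar>l\<bar>\<^sup>2 \<le> (2 * norm x * norm y)\<^sup>2" by (intro power_mono) auto
  then have l2: "l\<^sup>2 \<le> 4 * (norm x)\<^sup>2 * m" by (simp add: m_def power_mult_distrib)
  have m2: "m\<^sup>2 \<le> m" using m by (simp add: power2_eq_square mult_left_le)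
  have p: "(norm (x + y))\<^sup>2 = (norm x)\<^sup>2 + (m + l)" and n: "(norm (x - y))\<^sup>2 = (norm x)\<^sup>2 + (m - l)"
    unfolding m_def l_def power2_norm_eq_inner by (simp_all add: inner_simps inner_commute)
  have q1: "\<bar>\<phi> ((norm x)\<^sup>2 + (m + l)) - \<phi> ((norm x)\<^sup>2) - d * (m + l)\<bar> \<le> B * (m + l)\<^sup>2"
    and q2: "\<bar>\<phi> ((norm x)\<^sup>2 + (m - l)) - \<phi> ((norm x)\<^sup>2) - d * (m - l)\<bar> \<le> B * (m - l)\<^sup>2"
    using la m(1) by (intro quad; simp add: m_def[symmetric]; linarith)+
  have "\<bar>\<phi> ((norm (x + y))\<^sup>2) + \<phi> ((norm (x - y))\<^sup>2) - 2 * \<phi> ((norm x)\<^sup>2) - 2 * d * m\<bar> \<le> B * (m + l)\<^sup>2 + B * (m - l)\<^sup>2"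
    using q1 q2 unfolding p n by (simp add: algebra_simps)
  also have "\<dots> = B * (2 * (m\<^sup>2 + l\<^sup>2))" by (simp add: power2_eq_square algebra_simps)
  also have "\<dots> \<le> B * (2 * (m + 4 * (norm x)\<^sup>2 * m))" using m2 l2 B by (intro mult_left_mono) auto
  finally have "\<bar>\<phi> ((norm (x + y))\<^sup>2) + \<phi> ((norm (x - y))\<^sup>2) - 2 * \<phi> ((norm x)\<^sup>2)\<bar>
     \<le> \<bar>2 * d * m\<bar> + B * (2 * (m + 4 * (norm x)\<^sup>2 * m))" by linarith
  also have "\<bar>2 * d * m\<bar> = 2 * \<bar>d\<bar> * m" using m by (simp add: abs_mult)
  finally show ?thesis by (simp add: m_def[symmetric] algebra_simps)
qed

text \<open>Squaring the positive part gives a function with Lipschitz gradient. Its second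
  differences are then bounded by an explicit multiple of \<open>(norm y)\<^sup>2\<close>, which
  suffices for a test function.\<close>

definition bump :: "real^'n \<Rightarrow> real" where
  "bump x = (max 0 (1 - (norm x)\<^sup>2))\<^sup>2"

lemma bump_continuous: "continuous_on UNIV bump"
  unfolding bump_def by (intro continuous_intros)

lemma bump_measurable [measurable]: "bump \<in> borel_measurable borel"
  using bump_continuous by (rule borel_measurable_continuous_onI)

lemma bump_pos_iff: "0 < bump x \<longleftrightarrow> norm x < 1"
proof -
  have "norm x < 1 \<longleftrightarrow> 0 < 1 - (norm x)\<^sup>2" using abs_square_less_1[of "norm x"] by simp
  then show ?thesis unfolding bump_def by (auto simp: max_def)
qed

lemma bump_nonneg: "0 \<le> bump x"
  by (simp add: bump_def)

lemma bump_le_1: "bump x \<le> 1"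
  unfolding bump_def by (intro power_le_one) auto

lemma bump_eq_0: "1 \<le> norm x \<Longrightarrow> bump x = 0"
  using bump_pos_iff[of x] bump_nonneg[of x] by linarith

text \<open>The square of the positive part has a derivative with Lipschitz constant 2, so its first
  order Taylor remainder is at most \<open>h\<^sup>2\<close>.\<close>

lemma positive_part_square:
  fixes t h :: real
  shows "\<bar>(max 0 (1 - (t + h)))\<^sup>2 - (max 0 (1 - t))\<^sup>2 - (- 2 * max 0 (1 - t)) * h\<bar> \<le> 1 * h\<^sup>2"
proof -
  define A where "A = 1 - t"
  have e: "1 - (t + h) = A - h" by (simp add: A_def)
  have "\<bar>(max 0 (A - h))\<^sup>2 - (max 0 A)\<^sup>2 + 2 * max 0 A * h\<bar> \<le> h\<^sup>2"
  proof (cases "A \<ge> 0")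
    case True
    show ?thesis
    proof (cases "A - h \<ge> 0")
      case True
      then have "(max 0 (A - h))\<^sup>2 - (max 0 A)\<^sup>2 + 2 * max 0 A * h = h\<^sup>2"
        using \<open>A \<ge> 0\<close> by (simp add: max_def power2_eq_square algebra_simps)
      then show ?thesis by simp
    next
      case False
      then have m: "max 0 (A - h) = 0" "max 0 A = A" using \<open>A \<ge> 0\<close> by auto
      have "0 \<le> A * (2 * h - A)" using False \<open>A \<ge> 0\<close> by (intro mult_nonneg_nonneg) auto
      moreover have "0 \<le> (A - h)\<^sup>2" by simp
      ultimately show ?thesis unfolding m by (simp add: power2_eq_square algebra_simps)
    qed
  next
    case False
    show ?thesis
    proof (cases "A - h \<ge> 0")
      case True
      then have "\<bar>A - h\<bar> \<le> \<bar>h\<bar>" using False by simp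
      then show ?thesis using True False by (simp add: max_def abs_le_square_iff[symmetric])
    qed (use False in simp)
  qed
  then show ?thesis unfolding e by (simp add: A_def)
qed

text \<open>For \<open>norm x \<le> 2\<close> the slope is at most 2 in absolute value and
  \<open>(norm x)\<^sup>2 \<le> 4\<close>, whence 2 * 2 + 2 * (1 + 4 * 4) = 38. Farther out all
  three values of the bump are 0.\<close>

lemma bump_second_difference:
  fixes x y :: "real^'n"
  assumes y: "norm y \<le> 1"
  shows "\<bar>bump (x + y) + bump (x - y) - 2 * bump x\<bar> \<le> 38 * (norm y)\<^sup>2"
proof (cases "norm x \<le> 2")
  case True
  let ?d = "- 2 * max 0 (1 - (norm x)\<^sup>2)"
  have "\<bar>bump (x + y) + bump (x - y) - 2 * bump x\<bar> \<le> (2 * \<bar>?d\<bar> + 2 * 1 * (1 + 4 * (norm x)\<^sup>2)) * (norm y)\<^sup>2"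
    unfolding bump_def
    by (rule radial_second_difference[OF y, where \<phi> = "\<lambda>t. (max 0 (1 - t))\<^sup>2"]) (simp, rule positive_part_square)
  also have "\<dots> \<le> 38 * (norm y)\<^sup>2"
  proof (rule mult_right_mono)
    have "(norm x)\<^sup>2 \<le> 4" using True power_mono[of "norm x" 2 2] by simp
    moreover have "\<bar>?d\<bar> \<le> 2" by (simp add: max_def)
    moreover have "2 * t + 2 * 1 * (1 + 4 * s) \<le> 38" if "s \<le> 4" "t \<le> 2" for s t :: real
      using that by simp
    ultimately show "2 * \<bar>?d\<bar> + 2 * 1 * (1 + 4 * (norm x)\<^sup>2) \<le> 38" by blast
  qed simp
  finally show ?thesis .
next
  case False
  then have "1 \<le> norm (x + y)" "1 \<le> norm (x - y)" "1 \<le> norm x"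
    using y norm_triangle_ineq2[of x "- y"] norm_triangle_ineq2[of x y] by auto
  then show ?thesis by (simp add: bump_eq_0)
qed

context
  fixes \<alpha> :: real
  assumes alpha: "0 < \<alpha>" "\<alpha> < 1"
begin

lemma bump_omega: "integrable (omega_measure \<alpha>) (bump :: real^'n \<Rightarrow> real)"
proof -
  let ?K = "real CARD('n) + 2 * \<alpha>"
  have "integrable lebesgue (\<lambda>x::real^'n. 1 / weight ?K x)"
    using alpha by (intro integrable_weight) auto
  then have "integrable lebesgue (\<lambda>x::real^'n. bump x / weight ?K x)"
  proof (rule Bochner_Integration.integrable_bound)
    show "(\<lambda>x::real^'n. bump x / weight ?K x) \<in> borel_measurable lebesgue"
      by (rule measurable_completion) simp
    show "AE x::real^'n in lebesgue. norm (bump x / weight ?K x) \<le> norm (1 / weight ?K x)"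
      by (intro AE_I2) (simp add: abs_divide abs_of_nonneg[OF bump_nonneg] bump_le_1 divide_right_mono)
  qed
  then show ?thesis by (simp add: omega_integrable_iff)
qed

lemma bump_kernel:
  assumes "\<epsilon> > 0"
  shows "set_integrable lebesgue {z. norm (z - x) > \<epsilon>} (frac_kernel \<alpha> (bump :: real^'n \<Rightarrow> real) x)"
  using set_integrable_frac_kernel[OF alpha(1) bump_omega assms] .

lemma bump_frac_lap_exists: "frac_lap_exists \<alpha> bump (x :: real^'n)"
  by (rule second_difference_lap(1)[OF alpha, where r = 1 and B = 38])
     (auto intro: bump_kernel bump_second_difference)

text \<open>Split at radius 1: inside, second differences give \<open>38 * c\<close>; outside, the
  values of the bump lie in [0, 1], so the integral of the bare kernel is a bound. Neither depends
  on \<open>x\<close>.\<close>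

lemma bump_lap_eps_near:
  "\<exists>M\<ge>0. \<forall>\<epsilon>\<in>{0<..1}. \<forall>x::real^'n. \<bar>frac_lap_eps \<alpha> \<epsilon> bump x\<bar> \<le> M"
proof -
  let ?K = "real CARD('n) + 2 * \<alpha>"
  let ?g = "\<lambda>y::real^'n. indicator {y. 1 \<le> norm y} y * norm y powr (- ?K)"
  have g: "integrable lebesgue ?g" using alpha by (intro integrable_powr_outside) auto
  define c where "c = (LINT y|lebesgue. indicator (cball 0 1) y * norm (y::real^'n) powr (- (?K - 2)))"
  have c0: "c \<ge> 0" unfolding c_def by (rule Bochner_Integration.integral_nonneg) simp
  have one: "\<bar>frac_lap_eps \<alpha> 1 bump x\<bar> \<le> integral\<^sup>L lebesgue ?g" for x :: "real^'n"
  proof -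
    have T: "similarity 1 (\<lambda>z. 1 *\<^sub>R id z + (- x))"
      by (rule similarityI) (auto simp: orthogonal_transformation_id)
    let ?k = "\<lambda>z. indicator {z. norm (z - x) > 1} z *\<^sub>R frac_kernel \<alpha> bump x z"
    have ki: "integrable lebesgue ?k" using bump_kernel[of 1 x] by (simp add: set_integrable_def)
    have gi: "integrable lebesgue (\<lambda>z. ?g (z - x))" using similarity_integrable[OF T g] by simp
    have "\<bar>frac_lap_eps \<alpha> 1 bump x\<bar> = \<bar>LINT z|lebesgue. ?k z\<bar>"
      by (simp add: frac_lap_eps_def set_lebesgue_integral_def)
    also have "\<dots> \<le> (LINT z|lebesgue. ?g (z - x))"
    proof (rule order_trans[OF integral_abs_bound integral_mono])
      show "integrable lebesgue (\<lambda>z. \<bar>?k z\<bar>)" using ki by (rule integrable_abs)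
      show "integrable lebesgue (\<lambda>z. ?g (z - x))" by fact
      fix z
      show "\<bar>?k z\<bar> \<le> ?g (z - x)"
      proof (cases "norm (z - x) > 1")
        case True
        have "\<bar>bump z - bump x\<bar> \<le> 1" using bump_nonneg[of z] bump_nonneg[of x] bump_le_1[of z] bump_le_1[of x] by linarith
        then have "\<bar>frac_kernel \<alpha> bump x z\<bar> \<le> 1 / norm (z - x) powr ?K"
          unfolding frac_kernel_def abs_divide by (simp add: divide_right_mono)
        then have "\<bar>frac_kernel \<alpha> bump x z\<bar> \<le> norm (z - x) powr (- ?K)"
          by (simp only: powr_minus_divide)
        then show ?thesis using True by simp
      qed simp
    qed
    also have "\<dots> = integral\<^sup>L lebesgue ?g" using similarity_integral[OF T, of ?g] by simp
    finally show ?thesis .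
  qed
  have "\<bar>frac_lap_eps \<alpha> \<epsilon> bump x\<bar> \<le> 38 * c + integral\<^sup>L lebesgue ?g" if "\<epsilon> \<in> {0<..1}" for \<epsilon> and x :: "real^'n"
  proof -
    have "\<bar>frac_lap_eps \<alpha> \<epsilon> bump x\<bar> \<le> 38 * c + \<bar>frac_lap_eps \<alpha> 1 bump x\<bar>"
      unfolding c_def using that
      by (intro second_difference_lap(2)[OF alpha]) (auto intro: bump_kernel bump_second_difference)
    with one[of x] show ?thesis by linarith
  qed
  moreover have "38 * c + integral\<^sup>L lebesgue ?g \<ge> 0" using c0 by (intro add_nonneg_nonneg Bochner_Integration.integral_nonneg) auto
  ultimately show ?thesis by blast
qed

text \<open>Here \<open>bump x = 0\<close>, so only \<open>z\<close> in the unit ball contributes,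
  and there \<open>norm (z - x)\<close> is at least half of \<open>norm x\<close>.\<close>

lemma bump_lap_eps_far:
  fixes x :: "real^'n"
  assumes x: "norm x \<ge> 2" and e: "\<epsilon> > 0"
  shows "\<bar>frac_lap_eps \<alpha> \<epsilon> bump x\<bar> \<le> measure lebesgue (cball (0::real^'n) 1) * 2 powr (real CARD('n) + 2 * \<alpha>) * norm x powr (- (real CARD('n) + 2 * \<alpha>))"
proof -
  let ?K = "real CARD('n) + 2 * \<alpha>"
  let ?k = "\<lambda>z. indicator {z. norm (z - x) > \<epsilon>} z *\<^sub>R frac_kernel \<alpha> bump x z"
  let ?g = "\<lambda>z::real^'n. indicator (cball 0 1) z * (2 powr ?K * norm x powr (- ?K))"
  have ki: "integrable lebesgue ?k" using bump_kernel[OF e, of x] by (simp add: set_integrable_def)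
  have gi: "integrable lebesgue ?g" by (rule integrable_mult_left) (rule integrable_indicator_cball(2))
  have "\<bar>frac_lap_eps \<alpha> \<epsilon> bump x\<bar> = \<bar>LINT z|lebesgue. ?k z\<bar>"
    by (simp add: frac_lap_eps_def set_lebesgue_integral_def)
  also have "\<dots> \<le> (LINT z|lebesgue. ?g z)"
  proof (rule order_trans[OF integral_abs_bound integral_mono])
    show "integrable lebesgue (\<lambda>z. \<bar>?k z\<bar>)" using ki by (rule integrable_abs)
    fix z
    show "\<bar>?k z\<bar> \<le> ?g z"
    proof (cases "norm z \<le> 1")
      case True
      have nz: "norm x / 2 \<le> norm (z - x)" using True x norm_triangle_ineq2[of x z] by (simp add: norm_minus_commute)
      have "\<bar>frac_kernel \<alpha> bump x z\<bar> \<le> 1 / norm (z - x) powr ?K"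
        using x bump_le_1[of z] bump_nonneg[of z] by (simp add: frac_kernel_def abs_divide bump_eq_0 divide_right_mono)
      also have "\<dots> \<le> 1 / (norm x / 2) powr ?K"
      proof (intro divide_left_mono powr_mono2 mult_pos_pos)
        have "0 < norm (z - x)" "0 < norm x / 2" using nz x by linarith+
        then show "0 < norm (z - x) powr ?K" "0 < (norm x / 2) powr ?K" by (simp_all only: powr_gt_zero)
      qed (use nz x alpha in auto)
      also have "\<dots> = 2 powr ?K * norm x powr (- ?K)"
        unfolding powr_minus_divide using x by (simp add: powr_divide)
      finally have "\<bar>frac_kernel \<alpha> bump x z\<bar> \<le> 2 powr ?K * norm x powr (- ?K)" .
      then show ?thesis using True by (simp add: indicator_def)
    next
      case False
      then have "frac_kernel \<alpha> bump x z = 0" using x by (simp add: frac_kernel_def bump_eq_0)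
      then show ?thesis by simp
    qed
  qed (rule gi)
  finally show ?thesis by simp
qed

lemma bump_lap_eps_decay:
  "\<exists>C>0. \<forall>\<epsilon>\<in>{0<..1}. \<forall>x::real^'n. \<bar>frac_lap_eps \<alpha> \<epsilon> bump x\<bar> \<le> C / weight (real CARD('n) + 2 * \<alpha>) x"
proof -
  let ?K = "real CARD('n) + 2 * \<alpha>"
  obtain M where M: "M \<ge> 0" "\<And>\<epsilon> x. \<epsilon> \<in> {0<..1} \<Longrightarrow> \<bar>frac_lap_eps \<alpha> \<epsilon> (bump :: real^'n \<Rightarrow> real) x\<bar> \<le> M"
    using bump_lap_eps_near by blast
  define V where "V = measure lebesgue (cball (0::real^'n) 1) * 2 powr ?K"
  have V: "V \<ge> 0" by (simp add: V_def)
  \<comment> \<open>One constant for both regimes: \<open>M * (1 + 2 powr ?K)\<close> serves for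
    \<open>norm x < 2\<close> and \<open>2 * V\<close> for the rest; adding 1 makes it
    positive.\<close>
  have "\<bar>frac_lap_eps \<alpha> \<epsilon> bump x\<bar> \<le> (M * (1 + 2 powr ?K) + 2 * V + 1) / weight ?K x"
    if e: "\<epsilon> \<in> {0<..1}" for \<epsilon> and x :: "real^'n"
  proof (cases "norm x \<ge> 2")
    case True
    then have "1 powr ?K \<le> norm x powr ?K" using alpha by (intro powr_mono2) auto
    then have x1: "1 \<le> norm x powr ?K" by simp
    have "\<bar>frac_lap_eps \<alpha> \<epsilon> bump x\<bar> \<le> V * norm x powr (- ?K)"
      unfolding V_def using e by (intro bump_lap_eps_far[OF True]) auto
    also have "\<dots> \<le> V * (2 / weight ?K x)"
    proof (rule mult_left_mono[OF _ V])
      show "norm x powr (- ?K) \<le> 2 / weight ?K x"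
        unfolding powr_minus_divide using x1 weight_pos[of x ?K] by (simp add: divide_simps)
    qed
    also have "\<dots> = 2 * V / weight ?K x" by simp
    also have "\<dots> \<le> (M * (1 + 2 powr ?K) + 2 * V + 1) / weight ?K x"
      using M(1) by (intro divide_right_mono less_imp_le[OF weight_pos]) (simp add: add_nonneg_nonneg)
    finally show ?thesis .
  next
    case False
    have w: "1 + norm x powr ?K \<le> 1 + 2 powr ?K" using False alpha by (simp add: powr_mono2)
    have "\<bar>frac_lap_eps \<alpha> \<epsilon> bump x\<bar> \<le> M" by (rule M(2)[OF e])
    also have "\<dots> \<le> M * (1 + 2 powr ?K) / weight ?K x"
      using w M(1) weight_pos[of x ?K] by (simp add: pos_le_divide_eq mult_left_mono)
    also have "\<dots> \<le> (M * (1 + 2 powr ?K) + 2 * V + 1) / weight ?K x"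
      using V by (intro divide_right_mono less_imp_le[OF weight_pos]) simp
    finally show ?thesis .
  qed
  moreover have "M * (1 + 2 powr ?K) + 2 * V + 1 > 0" using M(1) V by (simp add: add_nonneg_pos)
  ultimately show ?thesis by blast
qed

lemma bump_integral_pos: "integrable lebesgue (bump :: real^'n \<Rightarrow> real)" "0 < (LINT z|lebesgue. bump (z :: real^'n))"
proof -
  show i: "integrable lebesgue (bump :: real^'n \<Rightarrow> real)"
  proof (rule Bochner_Integration.integrable_bound[OF integrable_indicator_cball(2)])
    show "(bump :: real^'n \<Rightarrow> real) \<in> borel_measurable lebesgue"
      by (rule measurable_completion) simp
    show "AE x::real^'n in lebesgue. norm (bump x) \<le> norm (indicator (cball 0 1) x :: real)"
      by (intro AE_I2) (auto simp: indicator_def abs_of_nonneg[OF bump_nonneg] bump_le_1 bump_eq_0)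
  qed
  have "(LINT z|lebesgue. bump (z :: real^'n)) \<noteq> 0"
  proof
    assume "(LINT z|lebesgue. bump (z :: real^'n)) = 0"
    then have "AE z::real^'n in lebesgue. bump z = 0"
      using integral_nonneg_eq_0_iff_AE[OF i] by (simp add: bump_nonneg)
    then have "AE z::real^'n in lebesgue. \<not> norm z < 1"
      by eventually_elim (metis bump_pos_iff less_irrefl)
    then have "AE z in lebesgue. z \<notin> ball (0::real^'n) 1" by simp
    then show False using open_AE_empty[of "ball (0::real^'n) 1"] by simp
  qed
  moreover have "0 \<le> (LINT z|lebesgue. bump (z :: real^'n))" by (intro Bochner_Integration.integral_nonneg bump_nonneg)
  ultimately show "0 < (LINT z|lebesgue. bump (z :: real^'n))" by linarith
qed

text \<open>Outside the support the integrand is nonnegative. For \<open>norm z < 1\<close> the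
  distance to \<open>x\<close> lies between 1 and \<open>2 * norm x\<close>, so truncation below
  radius 1 removes nothing and the integral is at least the total mass of the bump divided by
  \<open>(2 * norm x) powr K\<close>, K = N + 2\<alpha>.\<close>

lemma bump_lap_negative:
  "\<exists>c>0. \<forall>x::real^'n. norm x \<ge> 2 \<longrightarrow> frac_lap \<alpha> bump x \<le> - c / weight (real CARD('n) + 2 * \<alpha>) x"
proof -
  let ?K = "real CARD('n) + 2 * \<alpha>"
  let ?I = "LINT z|lebesgue. bump (z :: real^'n)"
  have "frac_lap \<alpha> bump x \<le> - (?I / 2 powr ?K) / weight ?K x" if x: "norm x \<ge> 2" for x :: "real^'n"
  proof -
    have xp: "norm x powr ?K > 0" using x by (subst powr_gt_zero) auto
    have eps: "frac_lap_eps \<alpha> \<epsilon> bump x \<le> - (?I / 2 powr ?K) / weight ?K x" if e: "0 < \<epsilon>" "\<epsilon> < 1" for \<epsilon>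
    proof -
      let ?k = "\<lambda>z. indicator {z. norm (z - x) > \<epsilon>} z *\<^sub>R frac_kernel \<alpha> bump x z"
      have ki: "integrable lebesgue ?k" using bump_kernel[OF e(1), of x] by (simp add: set_integrable_def)
      have "?I / (2 * norm x) powr ?K = (LINT z|lebesgue. bump (z :: real^'n) / (2 * norm x) powr ?K)" by simp
      also have "\<dots> \<le> (LINT z|lebesgue. ?k z)"
      proof (rule integral_mono)
        show "integrable lebesgue (\<lambda>z::real^'n. bump z / (2 * norm x) powr ?K)"
          by (rule integrable_divide_zero) (rule bump_integral_pos(1))
        show "integrable lebesgue ?k" by fact
        fix z
        show "bump z / (2 * norm x) powr ?K \<le> ?k z"
        proof (cases "norm z < 1")
          case True
          then have z: "norm (z - x) > 1" "norm (z - x) \<le> 2 * norm x"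
            using x norm_triangle_ineq2[of x z] norm_triangle_ineq4[of z x] by (auto simp: norm_minus_commute)
          have "bump z / (2 * norm x) powr ?K \<le> bump z / norm (z - x) powr ?K"
          proof (intro divide_left_mono powr_mono2 mult_pos_pos)
            have "0 < norm (z - x)" "0 < 2 * norm x" using z x by linarith+
            then show "0 < norm (z - x) powr ?K" "0 < (2 * norm x) powr ?K" by (simp_all only: powr_gt_zero)
          qed (use z alpha x bump_nonneg[of z] in auto)
          then show ?thesis using z e x by (simp add: frac_kernel_def bump_eq_0)
        qed (use x in \<open>simp add: bump_eq_0 frac_kernel_def\<close>)
      qed
      finally have "frac_lap_eps \<alpha> \<epsilon> bump x \<le> - (?I / (2 * norm x) powr ?K)"
        by (simp add: frac_lap_eps_def set_lebesgue_integral_def)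
      also have "?I / (2 * norm x) powr ?K = (?I / 2 powr ?K) / norm x powr ?K"
        using x by (simp add: powr_mult)
      also have "- \<dots> \<le> - ((?I / 2 powr ?K) / weight ?K x)"
        by (intro le_imp_neg_le divide_left_mono mult_pos_pos weight_pos xp
              divide_nonneg_nonneg less_imp_le[OF bump_integral_pos(2)]) simp_all
      finally show ?thesis by simp
    qed
    obtain L where L: "((\<lambda>\<epsilon>. frac_lap_eps \<alpha> \<epsilon> bump x) \<longlongrightarrow> L) (at_right 0)"
      using bump_frac_lap_exists[of x] by (auto simp: frac_lap_exists_def)
    have "L \<le> - (?I / 2 powr ?K) / weight ?K x"
    proof (rule tendsto_upperbound[OF L])
      show "\<forall>\<^sub>F \<epsilon> in at_right 0. frac_lap_eps \<alpha> \<epsilon> bump x \<le> - (?I / 2 powr ?K) / weight ?K x"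
        using eventually_at_right_real[OF zero_less_one] by eventually_elim (use eps in auto)
    qed simp
    then show ?thesis unfolding frac_lap_def tendsto_Lim[OF trivial_limit_at_right_real L] .
  qed
  moreover have "?I / 2 powr ?K > 0" by (intro divide_pos_pos bump_integral_pos(2)) simp
  ultimately show ?thesis by blast
qed

lemma bump_test_function: "(bump :: real^'n \<Rightarrow> real) \<in> test_functions \<alpha>"
proof -
  let ?K = "real CARD('n) + 2 * \<alpha>"
  obtain C where C: "C > 0" "\<And>\<epsilon> x. \<epsilon> \<in> {0<..1} \<Longrightarrow> \<bar>frac_lap_eps \<alpha> \<epsilon> (bump :: real^'n \<Rightarrow> real) x\<bar> \<le> C / weight ?K x"
    using bump_lap_eps_decay by blast
  have b: "\<bar>frac_lap \<alpha> bump x\<bar> \<le> C / weight ?K x" for x :: "real^'n"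
  proof -
    obtain L where L: "((\<lambda>\<epsilon>. frac_lap_eps \<alpha> \<epsilon> bump x) \<longlongrightarrow> L) (at_right 0)"
      using bump_frac_lap_exists[of x] by (auto simp: frac_lap_exists_def)
    have "\<bar>L\<bar> \<le> C / weight ?K x"
    proof (rule tendsto_upperbound[OF tendsto_rabs[OF L]])
      show "\<forall>\<^sub>F \<epsilon> in at_right 0. \<bar>frac_lap_eps \<alpha> \<epsilon> bump x\<bar> \<le> C / weight ?K x"
        using eventually_at_right_real[OF zero_less_one] by eventually_elim (use C(2) in auto)
    qed simp
    then show ?thesis unfolding frac_lap_def tendsto_Lim[OF trivial_limit_at_right_real L] .
  qed
  have "bounded {x::real^'n. bump x \<noteq> 0}"
    by (rule bounded_subset[OF bounded_cball[of 0 1]]) (auto simp: bump_eq_0 intro: ccontr)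
  then have comp: "compact (closure {x::real^'n. bump x \<noteq> 0})" by (simp add: compact_closure)
  have "integrable lebesgue (\<lambda>x::real^'n. C * (1 / weight ?K x))"
    using alpha by (intro integrable_mult_right integrable_weight) auto
  then have "integrable lebesgue (\<lambda>x::real^'n. C / weight ?K x)" by simp
  moreover have "\<forall>\<epsilon>\<in>{0<..1}. AE x::real^'n in lebesgue. \<bar>frac_lap_eps \<alpha> \<epsilon> bump x\<bar> \<le> C / weight ?K x"
    using C(2) by simp
  ultimately have "\<exists>\<phi> \<epsilon>\<^sub>0. integrable lebesgue \<phi> \<and> \<epsilon>\<^sub>0 > 0 \<and>
        (\<forall>\<epsilon>\<in>{0<..\<epsilon>\<^sub>0}. AE x::real^'n in lebesgue. \<bar>frac_lap_eps \<alpha> \<epsilon> bump x\<bar> \<le> \<phi> x)"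
    by (intro exI[of _ "\<lambda>x. C / weight ?K x"] exI[of _ 1]) auto
  then show ?thesis
    unfolding test_functions_def using bump_continuous comp bump_frac_lap_exists C(1) b by blast
qed

end

section \<open>Limits, multiples and measurability of the fractional Laplacian\<close>

lemma frac_lap_tendsto:
  assumes "frac_lap_exists \<alpha> f x"
  shows "((\<lambda>\<epsilon>. frac_lap_eps \<alpha> \<epsilon> f x) \<longlongrightarrow> frac_lap \<alpha> f x) (at_right 0)"
proof -
  obtain L where L: "((\<lambda>\<epsilon>. frac_lap_eps \<alpha> \<epsilon> f x) \<longlongrightarrow> L) (at_right 0)"
    using assms by (auto simp: frac_lap_exists_def)
  then show ?thesis
    unfolding frac_lap_def tendsto_Lim[OF trivial_limit_at_right_real L] .
qed

lemma frac_lapI: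
  assumes "((\<lambda>\<epsilon>. frac_lap_eps \<alpha> \<epsilon> f x) \<longlongrightarrow> L) (at_right 0)"
  shows "frac_lap \<alpha> f x = L"
  unfolding frac_lap_def by (rule tendsto_Lim[OF trivial_limit_at_right_real assms])

lemma
  shows frac_lap_eps_cmult: "frac_lap_eps \<alpha> \<epsilon> (\<lambda>y. c * f y) x = c * frac_lap_eps \<alpha> \<epsilon> f x"
    and frac_lap_exists_cmult: "frac_lap_exists \<alpha> f x \<Longrightarrow> frac_lap_exists \<alpha> (\<lambda>y. c * f y) x"
    and frac_lap_cmult: "frac_lap_exists \<alpha> f x \<Longrightarrow> frac_lap \<alpha> (\<lambda>y. c * f y) x = c * frac_lap \<alpha> f x"
proof -
  have k: "frac_kernel \<alpha> (\<lambda>y. c * f y) x = (\<lambda>z. c * frac_kernel \<alpha> f x z)"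
    by (simp add: fun_eq_iff frac_kernel_def right_diff_distrib)
  show eps: "frac_lap_eps \<alpha> \<epsilon> (\<lambda>y. c * f y) x = c * frac_lap_eps \<alpha> \<epsilon> f x" for \<epsilon>
    unfolding frac_lap_eps_def k by simp
  assume ex: "frac_lap_exists \<alpha> f x"
  have lim: "((\<lambda>\<epsilon>. frac_lap_eps \<alpha> \<epsilon> (\<lambda>y. c * f y) x) \<longlongrightarrow> c * frac_lap \<alpha> f x) (at_right 0)"
    unfolding eps by (intro tendsto_intros frac_lap_tendsto ex)
  then show "frac_lap \<alpha> (\<lambda>y. c * f y) x = c * frac_lap \<alpha> f x" by (rule frac_lapI)
  show "frac_lap_exists \<alpha> (\<lambda>y. c * f y) x"
    using ex lim unfolding frac_lap_exists_def k by auto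
qed

text \<open>With \<open>lborel\<close> in place of its completion the integrand is measurable on a
  product of Borel spaces, so measurability in the parameter \<open>x\<close> and Fubini
  apply.\<close>

lemma frac_lap_eps_lborel:
  fixes f :: "real^'n \<Rightarrow> real"
  assumes [measurable]: "f \<in> borel_measurable borel"
  shows "frac_lap_eps \<alpha> \<epsilon> f x = - (LINT z|lborel. (if norm (z - x) > \<epsilon> then frac_kernel \<alpha> f x z else 0))"
proof -
  have "frac_lap_eps \<alpha> \<epsilon> f x = - (LINT z|lebesgue. (if norm (z - x) > \<epsilon> then frac_kernel \<alpha> f x z else 0))"
    unfolding frac_lap_eps_def set_lebesgue_integral_def
    by (intro arg_cong[where f=uminus] Bochner_Integration.integral_cong) (auto simp: indicator_def)
  also have "(LINT z|lebesgue. (if norm (z - x) > \<epsilon> then frac_kernel \<alpha> f x z else 0))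
    = (LINT z|lborel. (if norm (z - x) > \<epsilon> then frac_kernel \<alpha> f x z else 0))"
    unfolding frac_kernel_def by (rule integral_completion) measurable
  finally show ?thesis .
qed

lemma frac_lap_eps_measurable [measurable]:
  fixes f :: "real^'n \<Rightarrow> real"
  assumes [measurable]: "f \<in> borel_measurable borel"
  shows "frac_lap_eps \<alpha> \<epsilon> f \<in> borel_measurable borel"
proof -
  have "(\<lambda>x. LINT z|lborel. (if norm (z - x) > \<epsilon> then frac_kernel \<alpha> f x z else 0)) \<in> borel_measurable borel"
    unfolding frac_kernel_def by (intro lborel.borel_measurable_lebesgue_integral) simp
  then show ?thesis
    unfolding frac_lap_eps_lborel[OF assms, abs_def] by simp
qed

lemma inverse_Suc_at_right: "filterlim (\<lambda>n. c / real (Suc n)) (at_right 0) sequentially" if "c > 0"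
proof (rule filterlim_at_withinI)
  show "(\<lambda>n. c / real (Suc n)) \<longlonglongrightarrow> 0" using LIMSEQ_Suc[OF lim_const_over_n[of c]] by simp
  show "\<forall>\<^sub>F n in sequentially. c / real (Suc n) \<in> {0<..} - {0}" using that by simp
qed

lemma frac_lap_measurable:
  fixes f :: "real^'n \<Rightarrow> real"
  assumes f: "f \<in> borel_measurable borel" and ex: "\<And>x. frac_lap_exists \<alpha> f x"
  shows "frac_lap \<alpha> f \<in> borel_measurable borel"
proof (rule borel_measurable_LIMSEQ_real)
  show "(\<lambda>n. frac_lap_eps \<alpha> (1 / real (Suc n)) f x) \<longlonglongrightarrow> frac_lap \<alpha> f x" for x
    by (rule filterlim_compose[OF frac_lap_tendsto[OF ex] inverse_Suc_at_right]) simp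
  show "frac_lap_eps \<alpha> (1 / real (Suc n)) f \<in> borel_measurable borel" for n
    using f by measurable
qed

lemma divide_le_transfer:
  fixes p q :: real
  assumes "0 < p" "0 < q" "p \<le> D * q" "0 \<le> C"
  shows "C / q \<le> C * D / p"
proof -
  have "C * p \<le> C * (D * q)" using assms by (intro mult_left_mono) auto
  then show ?thesis using assms(1,2) by (simp add: pos_divide_le_eq pos_le_divide_eq mult.assoc)
qed

text \<open>Everything is transported by the translation to \<open>x0\<close>; the comparisons of
  the weights at \<open>x\<close> and at \<open>x - x0\<close>, one in each direction, account for
  \<open>D\<close> and \<open>D'\<close> in the two constants.\<close>

lemma translated_bump:
  fixes x0 :: "real^'n"
  assumes alpha: "0 < \<alpha>" "\<alpha> < 1"
  obtains \<xi> C c where "\<xi> \<in> test_functions \<alpha>" "\<xi> \<in> borel_measurable borel"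
    "\<And>x. 0 \<le> \<xi> x" "\<And>x. \<xi> x \<le> 1" "\<And>x. 0 < \<xi> x \<longleftrightarrow> norm (x - x0) < 1"
    "C > 0" "\<And>\<epsilon> x. \<epsilon> \<in> {0<..1} \<Longrightarrow> \<bar>frac_lap_eps \<alpha> \<epsilon> \<xi> x\<bar> \<le> C / weight (real CARD('n) + 2 * \<alpha>) x"
    "c > 0" "\<And>x. norm (x - x0) \<ge> 2 \<Longrightarrow> frac_lap \<alpha> \<xi> x \<le> - c / weight (real CARD('n) + 2 * \<alpha>) x"
proof -
  let ?K = "real CARD('n) + 2 * \<alpha>"
  define T where "T = (\<lambda>x. 1 *\<^sub>R id x + (- x0))"
  have T: "similarity 1 T" unfolding T_def by (rule similarityI) (auto simp: orthogonal_transformation_id)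
  have Tx: "T x = x - x0" for x by (simp add: T_def)
  obtain S where S: "similarity (1 / 1) S" "\<And>x. S (T x) = x" "\<And>x. T (S x) = x"
    by (rule similarity_inverse[OF T]) (rule that)
  obtain D where D: "D > 0" "\<And>x. 1 + norm x powr ?K \<le> D * weight ?K (T x)"
    using similarity_weight[OF T, of ?K] alpha by auto
  obtain D' where D': "D' > 0" "\<And>x. 1 + norm x powr ?K \<le> D' * weight ?K (S x)"
    using similarity_weight[OF S(1), of ?K] alpha by auto
  obtain C where C: "C > 0" "\<And>\<epsilon> x. \<epsilon> \<in> {0<..1} \<Longrightarrow> \<bar>frac_lap_eps \<alpha> \<epsilon> (bump :: real^'n \<Rightarrow> real) x\<bar> \<le> C / weight ?K x"
    using bump_lap_eps_decay[OF alpha] by blast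
  obtain c where c: "c > 0" "\<And>x::real^'n. norm x \<ge> 2 \<Longrightarrow> frac_lap \<alpha> bump x \<le> - c / weight ?K x"
    using bump_lap_negative[OF alpha] by blast
  define \<xi> where "\<xi> = (\<lambda>x. bump (T x))"
  show thesis
  proof (rule that[of \<xi> "C * D" "c / D'"])
    show "\<xi> \<in> test_functions \<alpha>"
      unfolding \<xi>_def by (rule test_functions_similarity[OF T alpha(1) bump_test_function[OF alpha]])
    show "\<xi> \<in> borel_measurable borel" unfolding \<xi>_def Tx by simp
    show "0 \<le> \<xi> x" "\<xi> x \<le> 1" "0 < \<xi> x \<longleftrightarrow> norm (x - x0) < 1" for x
      by (simp_all add: \<xi>_def Tx bump_nonneg bump_le_1 bump_pos_iff)
    show "C * D > 0" "c / D' > 0" using C c D D' by simp_all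
    show "\<bar>frac_lap_eps \<alpha> \<epsilon> \<xi> x\<bar> \<le> C * D / weight ?K x" if "\<epsilon> \<in> {0<..1}" for \<epsilon> x
    proof -
      have "\<bar>frac_lap_eps \<alpha> \<epsilon> \<xi> x\<bar> \<le> C / weight ?K (T x)"
        using C(2)[OF that, of "T x"] unfolding \<xi>_def frac_lap_eps_similarity[OF T] by simp
      also have "\<dots> \<le> C * D / weight ?K x"
        by (rule divide_le_transfer[OF weight_pos weight_pos D(2) less_imp_le[OF C(1)]])
      finally show ?thesis .
    qed
    show "frac_lap \<alpha> \<xi> x \<le> - (c / D') / weight ?K x" if "norm (x - x0) \<ge> 2" for x
    proof -
      have "frac_lap \<alpha> \<xi> x = frac_lap \<alpha> bump (T x)"
        unfolding \<xi>_def using frac_lap_similarity(2)[OF T bump_frac_lap_exists[OF alpha]] by simp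
      also have "\<dots> \<le> - c / weight ?K (T x)" using c(2)[of "T x"] that by (simp add: Tx)
      also have "\<dots> \<le> - (c / D') / weight ?K x"
      proof -
        have "1 + norm (T x) powr ?K \<le> D' * weight ?K x" using D'(2)[of "T x"] by (simp add: S(2))
        moreover have "0 \<le> c / D'" using c(1) D'(1) by simp
        ultimately have "(c / D') / weight ?K x \<le> c / D' * D' / weight ?K (T x)"
          by (intro divide_le_transfer weight_pos)
        then show ?thesis using D'(1) by simp
      qed
      finally show ?thesis .
    qed
  qed
qed

lemma powr_omega:
  assumes "0 < \<alpha>" "0 < a" "a < real CARD('n)"
  shows "integrable (omega_measure \<alpha>) (\<lambda>x::real^'n. norm x powr (- a))"
  unfolding omega_integrable_iff using assms by (intro integrable_powr_weight) auto

text \<open>Second order Taylor expansion at 1 on the interval from 1/4 to 7/4, where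
  \<open>t powr (d - 2)\<close> is largest at 1/4 because \<open>d < 0\<close>.\<close>

lemma powr_quadratic:
  fixes d h :: real
  assumes d: "d < 0" and h: "\<bar>h\<bar> \<le> 3/4"
  shows "\<bar>(1 + h) powr d - 1 - d * h\<bar> \<le> \<bar>d * (d - 1)\<bar> * (1/4) powr (d - 2) * h\<^sup>2"
proof (cases "h = 0")
  case False
  define df :: "nat \<Rightarrow> real \<Rightarrow> real" where
    "df m t = (if m = 0 then t powr d else if m = 1 then d * t powr (d - 1) else d * (d - 1) * t powr (d - 2))" for m t
  have "\<exists>t. (if 1 + h < 1 then 1 + h < t \<and> t < 1 else 1 < t \<and> t < 1 + h) \<and>
      (1 + h) powr d = (\<Sum>m<2. df m 1 / fact m * (1 + h - 1) ^ m) + df 2 t / fact 2 * (1 + h - 1) ^ 2"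
  proof (rule Taylor[where a = "1/4" and b = "7/4"])
    show "\<forall>m t. m < 2 \<and> 1 / 4 \<le> t \<and> t \<le> 7 / 4 \<longrightarrow> (df m has_real_derivative df (Suc m) t) (at t)"
    proof (intro allI impI)
      fix m :: nat and t :: real assume mt: "m < 2 \<and> 1 / 4 \<le> t \<and> t \<le> 7 / 4"
      then consider "m = 0" | "m = 1" by linarith
      then show "(df m has_real_derivative df (Suc m) t) (at t)"
      proof cases
        case 1
        have "((\<lambda>t. t powr d) has_real_derivative d * t powr (d - 1)) (at t)"
          using mt by (auto intro!: derivative_eq_intros)
        then show ?thesis using 1 by (simp add: df_def[abs_def])
      next
        case 2
        have "((\<lambda>t. d * t powr (d - 1)) has_real_derivative d * ((d - 1) * t powr (d - 1 - 1))) (at t)"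
          using mt by (auto intro!: derivative_eq_intros)
        then show ?thesis using 2 by (simp add: df_def[abs_def] mult.assoc)
      qed
    qed
  qed (use h False in \<open>auto simp: df_def\<close>)
  then obtain t where c: "if 1 + h < 1 then 1 + h < t \<and> t < 1 else 1 < t \<and> t < 1 + h"
    and eq: "(1 + h) powr d = (\<Sum>m<2. df m 1 / fact m * (1 + h - 1) ^ m) + df 2 t / fact 2 * (1 + h - 1) ^ 2"
    by blast
  have t: "1 / 4 \<le> t" using c h by (auto split: if_splits)
  have e: "(1 + h) powr d - 1 - d * h = d * (d - 1) * (t powr (d - 2) / 2) * h\<^sup>2"
    unfolding eq by (simp add: df_def numeral_2_eq_2)
  have "\<bar>(1 + h) powr d - 1 - d * h\<bar> = \<bar>d * (d - 1)\<bar> * (t powr (d - 2) / 2) * h\<^sup>2"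
    unfolding e by (simp add: abs_mult)
  also have "\<dots> \<le> \<bar>d * (d - 1)\<bar> * (1/4) powr (d - 2) * h\<^sup>2"
  proof (intro mult_right_mono mult_left_mono)
    have "t powr (d - 2) \<le> (1/4) powr (d - 2)" using t d by (intro powr_mono2') auto
    then show "t powr (d - 2) / 2 \<le> (1/4) powr (d - 2)" using powr_ge_zero[of t "d - 2"] by linarith
  qed auto
  finally show ?thesis .
qed simp

section \<open>Integration by parts against power functions\<close>

text \<open>After the terms with \<open>w x * \<xi> x\<close> cancel, the integrand in
  \<open>x\<close> and \<open>z\<close> is the antisymmetric part of \<open>w x * \<xi> z\<close>
  times a symmetric kernel, and its double integral vanishes. Truncation is what makes that integral
  absolutely convergent.\<close>

lemma integration_by_parts_truncated:
  fixes w \<xi> :: "real^'n \<Rightarrow> real"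
  assumes alpha: "0 < \<alpha>" and e: "0 < \<epsilon>"
    and w [measurable]: "w \<in> borel_measurable borel" and wi: "integrable (omega_measure \<alpha>) w"
    and xi [measurable]: "\<xi> \<in> borel_measurable borel" and xi_bound: "\<And>x. \<bar>\<xi> x\<bar> \<le> 1"
    and xi_supp: "\<And>x. norm x > R \<Longrightarrow> \<xi> x = 0"
  shows "(LINT x|lborel. w x * frac_lap_eps \<alpha> \<epsilon> \<xi> x - \<xi> x * frac_lap_eps \<alpha> \<epsilon> w x) = 0"
proof -
  let ?LL = "lborel \<Otimes>\<^sub>M (lborel :: (real^'n) measure)"
  let ?K = "real CARD('n) + 2 * \<alpha>"
  define k :: "real^'n \<Rightarrow> real^'n \<Rightarrow> real" where "k x z = (if norm (z - x) > \<epsilon> then 1 / norm (z - x) powr ?K else 0)" for x z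
  have km [measurable]: "(\<lambda>(x, z). k x z) \<in> borel_measurable (borel \<Otimes>\<^sub>M borel)"
    unfolding k_def by measurable
  have ksym: "k x z = k z x" for x z by (simp add: k_def norm_minus_commute)
  define P where "P = (\<lambda>(x, z). w x * \<xi> z * k x z)"
  obtain D where D: "D > 0" "\<And>x z :: real^'n. norm x \<le> R \<Longrightarrow> norm (z - x) > \<epsilon> \<Longrightarrow> 1 / norm (z - x) powr ?K \<le> D / weight ?K z"
    using weight_le_kernel[OF e, of ?K R] alpha by auto
  have xi_int: "integrable lborel \<xi>" using xi_bound xi_supp by (rule integrable_lborel_bounded_support[OF xi])
  have xi_omega: "integrable (omega_measure \<alpha>) \<xi>"
  proof -
    have "integrable lebesgue \<xi>" using xi_int by (simp add: integrable_completion)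
    then have "integrable lebesgue (\<lambda>x. \<xi> x / weight ?K x)"
    proof (rule Bochner_Integration.integrable_bound)
      show "(\<lambda>x. \<xi> x / weight ?K x) \<in> borel_measurable lebesgue"
        by (rule measurable_completion) simp
      have "\<bar>\<xi> x\<bar> / weight ?K x \<le> \<bar>\<xi> x\<bar> / 1" for x
        by (intro divide_left_mono mult_pos_pos weight_pos) auto
      then show "AE x in lebesgue. norm (\<xi> x / weight ?K x) \<le> norm (\<xi> x)"
        by (intro AE_I2) (simp add: abs_divide abs_of_pos[OF weight_pos])
    qed
    then show ?thesis by (simp add: omega_integrable_iff)
  qed
  have w_int: "integrable lborel (\<lambda>x. w x / weight ?K x)"
    using wi unfolding omega_integrable_iff by (subst (asm) integrable_completion) auto
  \<comment> \<open>Since \<open>\<xi> z\<close> vanishes for \<open>norm z > R\<close>,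
    \<open>weight_le_kernel\<close> replaces the kernel by \<open>D\<close> over the weight at
    \<open>x\<close>; the majorant is then a product of a function of \<open>x\<close> and a
    function of \<open>z\<close>.\<close>
  have prod: "integrable ?LL (\<lambda>(x, z). (w x / weight ?K x) * (D * \<xi> z))"
  proof (rule lborel_pair.Fubini_integrable)
    show "(\<lambda>(x, z). (w x / weight ?K x) * (D * \<xi> z)) \<in> borel_measurable ?LL"
      by simp
    have "(\<lambda>x. LINT z|lborel. norm (case (x, z) of (x, z) \<Rightarrow> (w x / weight ?K x) * (D * \<xi> z)))
      = (\<lambda>x. norm (w x / weight ?K x) * (LINT z|lborel. norm (D * \<xi> z)))"
      by (simp only: prod.case norm_mult[of "w _ / _"] integral_mult_right_zero)
    moreover have "integrable lborel (\<lambda>x. norm (w x / weight ?K x) * (LINT z|lborel. norm (D * \<xi> z)))"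
      by (intro integrable_mult_left integrable_norm w_int)
    ultimately show "integrable lborel (\<lambda>x. LINT z|lborel. norm (case (x, z) of (x, z) \<Rightarrow> (w x / weight ?K x) * (D * \<xi> z)))"
      by simp
    show "AE x in lborel. integrable lborel (\<lambda>z. case (x, z) of (x, z) \<Rightarrow> (w x / weight ?K x) * (D * \<xi> z))"
      unfolding prod.case by (intro AE_I2 integrable_mult_right xi_int)
  qed
  have P: "integrable ?LL P"
    using prod
  proof (rule Bochner_Integration.integrable_bound)
    show "P \<in> borel_measurable ?LL" unfolding P_def by measurable
    show "AE y in lborel \<Otimes>\<^sub>M lborel. norm (P y) \<le> norm (case y of (x, z) \<Rightarrow> (w x / weight ?K x) * (D * \<xi> z))"
    proof (rule AE_I2)
      fix y :: "(real^'n) \<times> (real^'n)"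
      obtain x z where y: "y = (x, z)" by fastforce
      have kn: "0 \<le> k x z" by (simp add: k_def)
      have "\<bar>\<xi> z\<bar> * k x z \<le> \<bar>\<xi> z\<bar> * (D / weight ?K x)"
      proof (cases "norm z \<le> R")
        case True
        have "k x z \<le> D / weight ?K x"
          using D(2)[OF True, of x] D(1) weight_pos[of x ?K] by (simp add: k_def norm_minus_commute)
        then show ?thesis by (intro mult_left_mono) auto
      next
        case False
        then show ?thesis using xi_supp[of z] by simp
      qed
      then have "\<bar>w x\<bar> * (\<bar>\<xi> z\<bar> * k x z) \<le> \<bar>w x\<bar> * (\<bar>\<xi> z\<bar> * (D / weight ?K x))"
        by (rule mult_left_mono) simp
      moreover have "norm (P y) = \<bar>w x\<bar> * (\<bar>\<xi> z\<bar> * k x z)"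
        using kn by (simp add: y P_def abs_mult ac_simps)
      moreover have "norm (case y of (x, z) \<Rightarrow> (w x / weight ?K x) * (D * \<xi> z)) = \<bar>w x\<bar> * (\<bar>\<xi> z\<bar> * (D / weight ?K x))"
        using D(1) by (simp add: y abs_mult abs_divide abs_of_pos[OF weight_pos])
      ultimately show "norm (P y) \<le> norm (case y of (x, z) \<Rightarrow> (w x / weight ?K x) * (D * \<xi> z))"
        by (simp only:)
    qed
  qed
  have P': "integrable ?LL (\<lambda>(x, z). P (z, x))"
    using lborel_pair.integrable_product_swap[OF P] .
  have swap: "integral\<^sup>L ?LL (\<lambda>(x, z). P (z, x)) = integral\<^sup>L ?LL P"
    using lborel_pair.integral_product_swap[OF borel_measurable_integrable[OF P]] by simp
  define G where "G = (\<lambda>y. P y - (case y of (x, z) \<Rightarrow> P (z, x)))"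
  have G: "integrable ?LL G"
    unfolding G_def by (intro Bochner_Integration.integrable_diff P P')
  have G0: "integral\<^sup>L ?LL G = 0"
    unfolding G_def by (subst Bochner_Integration.integral_diff[OF P P']) (simp add: swap)
  have ker: "integrable lborel (\<lambda>z. if norm (z - x) > \<epsilon> then frac_kernel \<alpha> f x z else 0)"
    if [measurable]: "f \<in> borel_measurable borel" and f: "integrable (omega_measure \<alpha>) f" for f x
  proof -
    have "integrable lebesgue (\<lambda>z. indicator {z. norm (z - x) > \<epsilon>} z *\<^sub>R frac_kernel \<alpha> f x z)"
      using set_integrable_frac_kernel[OF alpha f e, of x] by (simp add: set_integrable_def)
    also have "(\<lambda>z. indicator {z. norm (z - x) > \<epsilon>} z *\<^sub>R frac_kernel \<alpha> f x z) = (\<lambda>z. if norm (z - x) > \<epsilon> then frac_kernel \<alpha> f x z else 0)"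
      by (auto simp: fun_eq_iff)
    finally show ?thesis
    proof (subst (asm) integrable_completion)
      show "(\<lambda>z. if norm (z - x) > \<epsilon> then frac_kernel \<alpha> f x z else 0) \<in> lborel \<rightarrow>\<^sub>M borel"
        unfolding frac_kernel_def by measurable
    qed
  qed
  have "w x * frac_lap_eps \<alpha> \<epsilon> \<xi> x - \<xi> x * frac_lap_eps \<alpha> \<epsilon> w x = - (LINT z|lborel. G (x, z))" for x
  proof -
    have "(LINT z|lborel. G (x, z)) = (LINT z|lborel. w x * (if norm (z - x) > \<epsilon> then frac_kernel \<alpha> \<xi> x z else 0)
        - \<xi> x * (if norm (z - x) > \<epsilon> then frac_kernel \<alpha> w x z else 0))"
      by (intro Bochner_Integration.integral_cong)
         (auto simp: G_def P_def ksym[of _ x] k_def frac_kernel_def diff_divide_distrib norm_minus_commute[of x] algebra_simps)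
    also have "\<dots> = w x * (LINT z|lborel. (if norm (z - x) > \<epsilon> then frac_kernel \<alpha> \<xi> x z else 0))
       - \<xi> x * (LINT z|lborel. (if norm (z - x) > \<epsilon> then frac_kernel \<alpha> w x z else 0))"
      using ker[OF xi xi_omega, of x] ker[OF w wi, of x]
      by (subst Bochner_Integration.integral_diff) auto
    finally show ?thesis by (simp add: frac_lap_eps_lborel)
  qed
  then show ?thesis
    using lborel_pair.integral_fst'[OF G] G0 by simp
qed

context
  fixes \<alpha> a :: real
  assumes alpha: "0 < \<alpha>" "\<alpha> < 1" and a: "0 < a"
begin

text \<open>Writing |x|^-a as \<open>((norm x)\<^sup>2) powr (- a / 2)\<close> brings it under
  \<open>radial_second_difference\<close>. Near a unit vector the argument stays away from 0, and
  \<open>a < N\<close> makes the function \<omega>-integrable.\<close>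

lemma powr_lap_unit:
  fixes e :: "real^'n"
  assumes aN: "a < real CARD('n)" and e: "norm e = 1"
  shows "frac_lap_exists \<alpha> (\<lambda>x. norm x powr (- a)) e"
    and "\<exists>M\<ge>0. \<forall>\<epsilon>\<in>{0<..1/4}. \<bar>frac_lap_eps \<alpha> \<epsilon> (\<lambda>x. norm x powr (- a)) e\<bar> \<le> M"
proof -
  define d where "d = - a / 2"
  let ?w = "\<lambda>x::real^'n. norm x powr (- a)"
  define B where "B = \<bar>d * (d - 1)\<bar> * (1/4) powr (d - 2)"
  have B: "B \<ge> 0" by (simp add: B_def)
  have d: "d < 0" using a by (simp add: d_def)
  have w: "?w x = ((norm x)\<^sup>2) powr d" for x :: "real^'n"
  proof (cases "x = 0")
    case False
    then have "((norm x)\<^sup>2) powr d = (norm x powr 2) powr d" by (simp add: powr_numeral)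
    also have "\<dots> = norm x powr (- a)" by (simp only: powr_powr) (simp add: d_def)
    finally show ?thesis by simp
  qed simp
  \<comment> \<open>For \<open>norm y \<le> 1/4\<close> the increment is at most 1/16 + 1/2, within
    the 3/4 allowed by \<open>powr_quadratic\<close>. The factor \<open>10 * B\<close> is
    \<open>2 * B * (1 + 4 * (norm e)\<^sup>2)\<close> with \<open>norm e = 1\<close>.\<close>
  have diff: "\<bar>?w (e + y) + ?w (e - y) - 2 * ?w e\<bar> \<le> (2 * \<bar>d\<bar> + 10 * B) * (norm y)\<^sup>2"
    if y: "norm y \<le> 1/4" for y
  proof -
    have "\<bar>((norm (e + y))\<^sup>2) powr d + ((norm (e - y))\<^sup>2) powr d - 2 * ((norm e)\<^sup>2) powr d\<bar>
      \<le> (2 * \<bar>d\<bar> + 2 * B * (1 + 4 * (norm e)\<^sup>2)) * (norm y)\<^sup>2"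
    proof (rule radial_second_difference[OF _ B, where \<phi> = "\<lambda>t. t powr d"])
      show "norm y \<le> 1" using y by simp
      fix h assume "\<bar>h\<bar> \<le> (norm y)\<^sup>2 + 2 * norm e * norm y"
      moreover have "(norm y)\<^sup>2 \<le> (1/4)\<^sup>2" using y by (intro power_mono) auto
      ultimately have "\<bar>h\<bar> \<le> 3/4" using y e by (simp add: power2_eq_square)
      from powr_quadratic[OF d this]
      show "\<bar>((norm e)\<^sup>2 + h) powr d - ((norm e)\<^sup>2) powr d - d * h\<bar> \<le> B * h\<^sup>2"
        using e by (simp add: B_def)
    qed
    then show ?thesis unfolding w using e by simp
  qed
  have int: "set_integrable lebesgue {z. norm (z - e) > \<epsilon>} (frac_kernel \<alpha> ?w e)" if "\<epsilon> > 0" for \<epsilon>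
    by (rule set_integrable_frac_kernel[OF alpha(1) powr_omega[OF alpha(1) a aN] that])
  have B2: "0 \<le> 2 * \<bar>d\<bar> + 10 * B" using B by simp
  note L = second_difference_lap[OF alpha, where r = "1/4" and f = ?w and x = e, OF int _ _ B2 diff]
  show "frac_lap_exists \<alpha> ?w e" by (rule L(1)) auto
  let ?c = "(LINT y|lebesgue. indicator (cball 0 1) y * norm (y::real^'n) powr (- (real CARD('n) + 2 * \<alpha> - 2)))"
  have "\<bar>frac_lap_eps \<alpha> \<epsilon> ?w e\<bar> \<le> \<bar>(2 * \<bar>d\<bar> + 10 * B) * ?c + \<bar>frac_lap_eps \<alpha> (1/4) ?w e\<bar>\<bar>" if "\<epsilon> \<in> {0<..1/4}" for \<epsilon>
    by (rule order_trans[OF L(2) abs_ge_self]) (use that in auto)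
  then show "\<exists>M\<ge>0. \<forall>\<epsilon>\<in>{0<..1/4}. \<bar>frac_lap_eps \<alpha> \<epsilon> ?w e\<bar> \<le> M"
    by (intro exI[of _ "\<bar>(2 * \<bar>d\<bar> + 10 * B) * ?c + \<bar>frac_lap_eps \<alpha> (1/4) ?w e\<bar>\<bar>"]) auto
qed

text \<open>A rotation and the dilation by \<open>1 / norm x\<close> carry \<open>x\<close> to a
  fixed unit vector, which leaves a single unknown constant \<open>l0\<close>.\<close>

lemma powr_lap:
  assumes aN: "a < real CARD('n)"
  obtains l0 M where "\<And>x::real^'n. x \<noteq> 0 \<Longrightarrow> frac_lap_exists \<alpha> (\<lambda>x. norm x powr (- a)) x"
    "\<And>x::real^'n. x \<noteq> 0 \<Longrightarrow> frac_lap \<alpha> (\<lambda>x. norm x powr (- a)) x = l0 * norm x powr (- (a + 2 * \<alpha>))"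
    "\<And>(x::real^'n) \<epsilon>. norm x \<ge> 1 \<Longrightarrow> \<epsilon> \<in> {0<..1/4} \<Longrightarrow> \<bar>frac_lap_eps \<alpha> \<epsilon> (\<lambda>x. norm x powr (- a)) x\<bar> \<le> M"
proof -
  let ?w = "\<lambda>x::real^'n. norm x powr (- a)"
  obtain e :: "real^'n" where e: "norm e = 1" using vector_choose_size[of 1] by auto
  obtain M where M: "M \<ge> 0" "\<And>\<epsilon>. \<epsilon> \<in> {0<..1/4} \<Longrightarrow> \<bar>frac_lap_eps \<alpha> \<epsilon> ?w e\<bar> \<le> M"
    using powr_lap_unit(2)[OF aN e] by blast
  have key: "frac_lap_exists \<alpha> ?w x \<and> frac_lap \<alpha> ?w x = frac_lap \<alpha> ?w e * norm x powr (- (a + 2 * \<alpha>))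
    \<and> (\<forall>\<epsilon>. frac_lap_eps \<alpha> \<epsilon> ?w x = norm x powr (- (a + 2 * \<alpha>)) * frac_lap_eps \<alpha> (\<epsilon> / norm x) ?w e)"
    if x: "x \<noteq> 0" for x
  proof -
    have "norm (x /\<^sub>R norm x) = norm e" using x e by simp
    then obtain Q where Q: "orthogonal_transformation Q" "Q (x /\<^sub>R norm x) = e"
      by (rule orthogonal_transformation_exists)
    define T where "T = (\<lambda>y. (1 / norm x) *\<^sub>R Q y + 0)"
    have T: "similarity (1 / norm x) T" unfolding T_def using x Q(1) by (intro similarityI) auto
    have Tx: "T x = e"
      using Q x by (simp add: T_def linear_scale[OF orthogonal_transformation_linear] divide_inverse)
    have wT: "norm (T y) powr (- a) = norm x powr a * ?w y" for y
      using x by (simp add: T_def orthogonal_transformation_norm[OF Q(1)] powr_divide powr_minus field_simps)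
    have eqw: "?w = (\<lambda>y. norm x powr (- a) * norm (T y) powr (- a))"
      unfolding wT using x by (simp add: fun_eq_iff powr_minus)
    have ex: "frac_lap_exists \<alpha> (\<lambda>y. ?w (T y)) x"
      and lap: "frac_lap \<alpha> (\<lambda>y. ?w (T y)) x = (1 / norm x) powr (2 * \<alpha>) * frac_lap \<alpha> ?w e"
      using frac_lap_similarity[OF T, of \<alpha> ?w x] powr_lap_unit(1)[OF aN e] unfolding Tx by auto
    have scale: "norm x powr (- a) * (1 / norm x) powr (2 * \<alpha>) = norm x powr (- (a + 2 * \<alpha>))"
    proof -
      have "(1 / norm x) powr (2 * \<alpha>) = norm x powr (- (2 * \<alpha>))" using x by (simp add: powr_divide powr_minus_divide)
      then show ?thesis by (simp add: powr_add[symmetric])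
    qed
    have 1: "frac_lap_exists \<alpha> ?w x" by (subst eqw) (rule frac_lap_exists_cmult[OF ex])
    have 2: "frac_lap \<alpha> ?w x = frac_lap \<alpha> ?w e * norm x powr (- (a + 2 * \<alpha>))"
      by (subst eqw) (simp only: frac_lap_cmult[OF ex] lap mult.assoc[symmetric] scale mult.commute[of "frac_lap \<alpha> ?w e"])
    have 3: "frac_lap_eps \<alpha> \<epsilon> ?w x = norm x powr (- (a + 2 * \<alpha>)) * frac_lap_eps \<alpha> (\<epsilon> / norm x) ?w e" for \<epsilon>
      using frac_lap_eps_similarity[OF T, of \<alpha> \<epsilon> ?w x] unfolding Tx
      by (subst eqw) (simp only: frac_lap_eps_cmult scale[symmetric], simp)
    from 1 2 3 show ?thesis by blast
  qed
  show thesis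
  proof (rule that)
    show "frac_lap_exists \<alpha> ?w x" "frac_lap \<alpha> ?w x = frac_lap \<alpha> ?w e * norm x powr (- (a + 2 * \<alpha>))" if "x \<noteq> 0" for x
      using key[OF that] by auto
    \<comment> \<open>For \<open>norm x \<ge> 1\<close> the rescaled radius
      \<open>\<epsilon> / norm x\<close> stays within 1/4 and the homogeneity factor is at most 1,
      so the bound at the unit vector carries over.\<close>
    show "\<bar>frac_lap_eps \<alpha> \<epsilon> ?w x\<bar> \<le> M" if x: "norm x \<ge> 1" and \<epsilon>: "\<epsilon> \<in> {0<..1/4}" for x \<epsilon>
    proof -
      have x0: "x \<noteq> 0" using x by auto
      have "\<epsilon> / norm x \<le> \<epsilon> / 1" using x \<epsilon> by (intro divide_left_mono) auto
      then have "\<epsilon> / norm x \<le> 1 / 4" using \<epsilon> by (simp only: greaterThanAtMost_iff div_by_1) linarith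
      moreover have "0 < \<epsilon> / norm x" using \<epsilon> x0 by simp
      ultimately have "\<bar>frac_lap_eps \<alpha> (\<epsilon> / norm x) ?w e\<bar> \<le> M" by (intro M(2)) (simp only: greaterThanAtMost_iff)
      moreover have "norm x powr (- (a + 2 * \<alpha>)) \<le> norm x powr 0" using x alpha a by (intro powr_mono) auto
      then have "norm x powr (- (a + 2 * \<alpha>)) \<le> 1" using x0 by simp
      ultimately have "norm x powr (- (a + 2 * \<alpha>)) * \<bar>frac_lap_eps \<alpha> (\<epsilon> / norm x) ?w e\<bar> \<le> 1 * M"
        by (intro mult_mono) auto
      then show ?thesis using key[OF x0] by (simp add: abs_mult)
    qed
  qed
qed

text \<open>Let the truncation radius tend to 0 in \<open>integration_by_parts_truncated\<close>. On
  the side of \<open>\<xi>\<close> the decay bound times |x|^-a dominates; on the side of the power,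
  \<open>\<xi>\<close> lives where \<open>norm x \<ge> 1\<close>, and
  \<open>M * \<bar>\<xi> x\<bar>\<close> dominates.\<close>

lemma powr_lap_weak:
  assumes aN: "a < real CARD('n)"
  obtains l0 where "\<And>x::real^'n. x \<noteq> 0 \<Longrightarrow> frac_lap_exists \<alpha> (\<lambda>x. norm x powr (- a)) x"
    "\<And>x::real^'n. x \<noteq> 0 \<Longrightarrow> frac_lap \<alpha> (\<lambda>x. norm x powr (- a)) x = l0 * norm x powr (- (a + 2 * \<alpha>))"
    "\<And>(\<xi> :: real^'n \<Rightarrow> real) C R. \<xi> \<in> test_functions \<alpha> \<Longrightarrow> \<xi> \<in> borel_measurable borel \<Longrightarrow>
       (\<And>x. \<bar>\<xi> x\<bar> \<le> 1) \<Longrightarrow> (\<And>x. \<xi> x \<noteq> 0 \<Longrightarrow> 1 \<le> norm x \<and> norm x \<le> R) \<Longrightarrow>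
       (\<And>\<epsilon> x. \<epsilon> \<in> {0<..1} \<Longrightarrow> \<bar>frac_lap_eps \<alpha> \<epsilon> \<xi> x\<bar> \<le> C / weight (real CARD('n) + 2 * \<alpha>) x) \<Longrightarrow>
       (LINT x|lebesgue. norm x powr (- a) * frac_lap \<alpha> \<xi> x) = l0 * (LINT x|lebesgue. norm x powr (- (a + 2 * \<alpha>)) * \<xi> x)"
proof -
  let ?w = "\<lambda>x::real^'n. norm x powr (- a)"
  let ?K = "real CARD('n) + 2 * \<alpha>"
  obtain l0 M where ex: "\<And>x::real^'n. x \<noteq> 0 \<Longrightarrow> frac_lap_exists \<alpha> ?w x"
    and lap: "\<And>x::real^'n. x \<noteq> 0 \<Longrightarrow> frac_lap \<alpha> ?w x = l0 * norm x powr (- (a + 2 * \<alpha>))"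
    and M: "\<And>(x::real^'n) \<epsilon>. norm x \<ge> 1 \<Longrightarrow> \<epsilon> \<in> {0<..1/4} \<Longrightarrow> \<bar>frac_lap_eps \<alpha> \<epsilon> ?w x\<bar> \<le> M"
    using powr_lap[OF aN] by blast
  show thesis
  proof (rule that[OF ex lap])
    fix \<xi> :: "real^'n \<Rightarrow> real" and C R :: real
    assume test: "\<xi> \<in> test_functions \<alpha>" and xm [measurable]: "\<xi> \<in> borel_measurable borel"
      and x1: "\<And>x. \<bar>\<xi> x\<bar> \<le> 1" and supp: "\<And>x. \<xi> x \<noteq> 0 \<Longrightarrow> 1 \<le> norm x \<and> norm x \<le> R"
      and C: "\<And>\<epsilon> x. \<epsilon> \<in> {0<..1} \<Longrightarrow> \<bar>frac_lap_eps \<alpha> \<epsilon> \<xi> x\<bar> \<le> C / weight ?K x"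
    have xex: "frac_lap_exists \<alpha> \<xi> x" for x using test by (simp add: test_functions_def)
    have wm [measurable]: "?w \<in> borel_measurable borel" by simp
    have wo: "integrable (omega_measure \<alpha>) ?w" by (rule powr_omega[OF alpha(1) a aN])
    have wi: "integrable lborel (\<lambda>x. ?w x / weight ?K x)"
      using wo unfolding omega_integrable_iff by (subst (asm) integrable_completion) auto
    have Lm [measurable]: "frac_lap \<alpha> \<xi> \<in> borel_measurable borel" by (rule frac_lap_measurable[OF xm xex])
    have xi_int: "integrable lborel \<xi>"
      by (rule integrable_lborel_bounded_support[OF xm x1, of R]) (use supp in force)
    define \<epsilon> where "\<epsilon> n = (1/4) / real (Suc n)" for n
    have e: "\<epsilon> n \<in> {0<..1/4}" for n by (simp add: \<epsilon>_def field_simps)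
    have elim: "filterlim \<epsilon> (at_right 0) sequentially"
      unfolding \<epsilon>_def by (rule inverse_Suc_at_right) simp
    have Ci: "integrable lborel (\<lambda>x. C * (?w x / weight ?K x))" by (intro integrable_mult_right wi)
    have Mi: "integrable lborel (\<lambda>x. M * \<bar>\<xi> x\<bar>)" by (intro integrable_mult_right integrable_abs xi_int)
    have b1: "norm (?w x * frac_lap_eps \<alpha> (\<epsilon> n) \<xi> x) \<le> C * (?w x / weight ?K x)" for n x
    proof -
      have "?w x * \<bar>frac_lap_eps \<alpha> (\<epsilon> n) \<xi> x\<bar> \<le> ?w x * (C / weight ?K x)"
        using e[of n] by (intro mult_left_mono C) auto
      then show ?thesis by (simp add: abs_mult ac_simps)
    qed
    have b2: "norm (\<xi> x * frac_lap_eps \<alpha> (\<epsilon> n) ?w x) \<le> M * \<bar>\<xi> x\<bar>" for n x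
    proof (cases "\<xi> x = 0")
      case False
      then have "\<bar>frac_lap_eps \<alpha> (\<epsilon> n) ?w x\<bar> \<le> M" using supp e by (intro M) auto
      then have "\<bar>\<xi> x\<bar> * \<bar>frac_lap_eps \<alpha> (\<epsilon> n) ?w x\<bar> \<le> \<bar>\<xi> x\<bar> * M" by (intro mult_left_mono) auto
      then show ?thesis by (simp add: abs_mult ac_simps)
    qed simp
    have lim1: "(\<lambda>n. LINT x|lborel. ?w x * frac_lap_eps \<alpha> (\<epsilon> n) \<xi> x) \<longlonglongrightarrow> (LINT x|lborel. ?w x * frac_lap \<alpha> \<xi> x)"
    proof (rule integral_dominated_convergence[OF _ _ Ci])
      show "AE x in lborel. (\<lambda>n. ?w x * frac_lap_eps \<alpha> (\<epsilon> n) \<xi> x) \<longlonglongrightarrow> ?w x * frac_lap \<alpha> \<xi> x"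
        by (intro AE_I2 tendsto_intros filterlim_compose[OF frac_lap_tendsto[OF xex] elim])
      show "AE x in lborel. norm (?w x * frac_lap_eps \<alpha> (\<epsilon> n) \<xi> x) \<le> C * (?w x / weight ?K x)" for n
        using b1 by simp
    qed measurable
    have lim2: "(\<lambda>n. LINT x|lborel. \<xi> x * frac_lap_eps \<alpha> (\<epsilon> n) ?w x) \<longlonglongrightarrow> (LINT x|lborel. \<xi> x * (l0 * norm x powr (- (a + 2 * \<alpha>))))"
    proof (rule integral_dominated_convergence[OF _ _ Mi])
      show "AE x in lborel. (\<lambda>n. \<xi> x * frac_lap_eps \<alpha> (\<epsilon> n) ?w x) \<longlonglongrightarrow> \<xi> x * (l0 * norm x powr (- (a + 2 * \<alpha>)))"
      proof (rule AE_I2)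
        fix x
        show "(\<lambda>n. \<xi> x * frac_lap_eps \<alpha> (\<epsilon> n) ?w x) \<longlonglongrightarrow> \<xi> x * (l0 * norm x powr (- (a + 2 * \<alpha>)))"
        proof (cases "\<xi> x = 0")
          case False
          then have x0: "x \<noteq> 0" using supp[of x] by auto
          show ?thesis
            unfolding lap[OF x0, symmetric]
            by (intro tendsto_intros filterlim_compose[OF frac_lap_tendsto[OF ex[OF x0]] elim])
        qed simp
      qed
      show "AE x in lborel. norm (\<xi> x * frac_lap_eps \<alpha> (\<epsilon> n) ?w x) \<le> M * \<bar>\<xi> x\<bar>" for n
        using b2 by simp
    qed measurable
    have "(LINT x|lborel. ?w x * frac_lap_eps \<alpha> (\<epsilon> n) \<xi> x) = (LINT x|lborel. \<xi> x * frac_lap_eps \<alpha> (\<epsilon> n) ?w x)" for n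
    proof -
      have i1: "integrable lborel (\<lambda>x. ?w x * frac_lap_eps \<alpha> (\<epsilon> n) \<xi> x)"
        by (rule Bochner_Integration.integrable_bound[OF Ci]) (measurable, use order_trans[OF b1 abs_ge_self] in \<open>simp add: real_norm_def\<close>)
      have i2: "integrable lborel (\<lambda>x. \<xi> x * frac_lap_eps \<alpha> (\<epsilon> n) ?w x)"
        by (rule Bochner_Integration.integrable_bound[OF Mi]) (measurable, use order_trans[OF b2 abs_ge_self] in \<open>simp add: real_norm_def\<close>)
      have "(LINT x|lborel. ?w x * frac_lap_eps \<alpha> (\<epsilon> n) \<xi> x - \<xi> x * frac_lap_eps \<alpha> (\<epsilon> n) ?w x) = 0"
        using e[of n] supp by (intro integration_by_parts_truncated[OF alpha(1) _ wm wo xm x1, of _ R]) force+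
      then show ?thesis using Bochner_Integration.integral_diff[OF i1 i2] by simp
    qed
    then have "(LINT x|lborel. ?w x * frac_lap \<alpha> \<xi> x) = (LINT x|lborel. \<xi> x * (l0 * norm x powr (- (a + 2 * \<alpha>))))"
      using LIMSEQ_unique[OF lim1] lim2 by simp
    also have "\<dots> = l0 * (LINT x|lborel. norm x powr (- (a + 2 * \<alpha>)) * \<xi> x)"
      by (subst integral_mult_right_zero[symmetric]) (simp only: ac_simps)
    finally show "(LINT x|lebesgue. ?w x * frac_lap \<alpha> \<xi> x) = l0 * (LINT x|lebesgue. norm x powr (- (a + 2 * \<alpha>)) * \<xi> x)"
      by (subst (1 2) integral_completion) (auto intro!: borel_measurable_times)
  qed
qed

end

section \<open>Families of weak solutions\<close>

lemma AE_eq_imp_eq_punctured: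
  fixes f g :: "real^'n \<Rightarrow> real"
  assumes "continuous_on (- {0}) f" "continuous_on (- {0}) g"
    and ae: "AE x in lebesgue. f x = g x" and x: "x \<noteq> 0"
  shows "f x = g x"
proof (rule ccontr)
  assume "f x \<noteq> g x"
  let ?U = "(- {0}) \<inter> (\<lambda>x. f x - g x) -` (- {0})"
  have "continuous_on (- {0}) (\<lambda>x. f x - g x)" using assms by (intro continuous_intros)
  then have "open ?U" by (intro continuous_open_preimage) auto
  moreover have "x \<in> ?U" using \<open>f x \<noteq> g x\<close> x by simp
  moreover have "AE x in lebesgue. x \<notin> ?U" using ae by eventually_elim simp
  ultimately show False using open_AE_empty[of ?U] by blast
qed

text \<open>\<open>K\<close>, \<open>a\<close> and \<open>\<sigma>\<close> are parameters pinned
  down by equations, so they act as abbreviations. At \<open>p = 1\<close> the value of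
  \<open>a\<close> is 0 by division by zero and has no scaling meaning.\<close>

locale weak_solution_family =
  fixes \<alpha> p K a \<sigma> :: real and u :: "real \<Rightarrow> real^'n \<Rightarrow> real"
  assumes K_def: "K = real CARD('n) + 2 * \<alpha>" and a_def: "a = 2 * \<alpha> / (p - 1)"
    and sigma_def: "\<sigma> = a * p - real CARD('n)"
    and N: "CARD('n) \<ge> 2"
    and alpha: "0 < \<alpha>" "\<alpha> < 1"
    and p: "0 < p" "p < real CARD('n) / (real CARD('n) - 2 * \<alpha>)"
    and weak: "\<And>k. k > 0 \<Longrightarrow> weak_solution \<alpha> p k (u k)"
    and unique: "\<And>k v. k > 0 \<Longrightarrow> weak_solution \<alpha> p k v \<Longrightarrow> AE x in lebesgue. v x = u k x"
    and classical: "\<And>k. k > 0 \<Longrightarrow> classical_solution \<alpha> p (u k)"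
    and nondecreasing: "\<And>k l x. 0 < k \<Longrightarrow> k \<le> l \<Longrightarrow> x \<noteq> 0 \<Longrightarrow> u k x \<le> u l x"
begin

lemma u_nonneg: "k > 0 \<Longrightarrow> 0 \<le> u k x"
  using weak[of k] by (simp add: weak_solution_def)

lemma u_continuous: "k > 0 \<Longrightarrow> continuous_on (- {0}) (u k)"
  using classical[of k] by (simp add: classical_solution_def)

lemma u_omega: "k > 0 \<Longrightarrow> integrable lebesgue (\<lambda>x. u k x / weight K x)"
  using weak[of k] by (simp add: weak_solution_def omega_integrable_iff K_def)

lemma u_powr_omega: "k > 0 \<Longrightarrow> integrable lebesgue (\<lambda>x. u k x powr p / weight K x)"
  using weak[of k] by (simp add: weak_solution_def omega_integrable_iff K_def)

lemma u_measurable: "k > 0 \<Longrightarrow> u k \<in> borel_measurable lebesgue"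
  using weak[of k] by (auto simp: weak_solution_def omega_measure_def dest: borel_measurable_integrable)

lemma u_weak: "k > 0 \<Longrightarrow> \<xi> \<in> test_functions \<alpha> \<Longrightarrow>
    (LINT x|lebesgue. u k x * frac_lap \<alpha> \<xi> x + u k x powr p * \<xi> x) = k * \<xi> 0"
  using weak[of k] by (simp add: weak_solution_def)

section \<open>The limit in k as a supremum\<close>

lemma pointwise_value_mono:
  assumes "0 < k" "k \<le> l"
  shows "pointwise_value (u k) x \<le> pointwise_value (u l) x"
  using nondecreasing[OF assms, of x] by (simp add: pointwise_value_def ennreal_leI)

lemma pointwise_value_tendsto_SUP:
  "((\<lambda>k. pointwise_value (u k) x) \<longlongrightarrow> (SUP k\<in>{0<..}. pointwise_value (u k) x)) at_top"
proof (rule order_tendstoI)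
  fix b assume "b < (SUP k\<in>{0<..}. pointwise_value (u k) x)"
  then obtain k where k: "k > 0" "b < pointwise_value (u k) x" by (auto simp: less_SUP_iff)
  show "\<forall>\<^sub>F l in at_top. b < pointwise_value (u l) x"
    using eventually_ge_at_top[of k]
    by eventually_elim (rule less_le_trans[OF k(2) pointwise_value_mono[OF k(1)]])
next
  fix b assume b: "(SUP k\<in>{0<..}. pointwise_value (u k) x) < b"
  show "\<forall>\<^sub>F l in at_top. pointwise_value (u l) x < b"
    using eventually_gt_at_top[of "0::real"]
    by eventually_elim (rule le_less_trans[OF SUP_upper b], simp)
qed

lemma u_infty_eq_SUP: "u_infty u x = (SUP k\<in>{0<..}. pointwise_value (u k) x)"
  unfolding u_infty_def by (rule tendsto_Lim[OF _ pointwise_value_tendsto_SUP]) simp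

lemma u_infty_tendsto: "((\<lambda>k. pointwise_value (u k) x) \<longlongrightarrow> u_infty u x) at_top"
  unfolding u_infty_eq_SUP by (rule pointwise_value_tendsto_SUP)

lemma u_infty_zero: "u_infty u 0 = \<infinity>"
  unfolding u_infty_eq_SUP by (simp add: pointwise_value_def)

lemma u_le_u_infty: "k > 0 \<Longrightarrow> x \<noteq> 0 \<Longrightarrow> ennreal (u k x) \<le> u_infty u x"
  unfolding u_infty_eq_SUP by (rule SUP_upper2[of k]) (auto simp: pointwise_value_def)

section \<open>Scaling and rotation of the family\<close>

lemma u_unique:
  assumes "k > 0" "weak_solution \<alpha> p k v" "continuous_on (- {0}) v" "x \<noteq> 0"
  shows "v x = u k x"
  using AE_eq_imp_eq_punctured[OF assms(3) u_continuous[OF assms(1)] unique[OF assms(1,2)] assms(4)] .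

lemma u_similarity:
  assumes p1: "p \<noteq> 1" and k: "k > 0" and l: "l > 0" and Q: "orthogonal_transformation Q" and x: "x \<noteq> 0"
  shows "l powr a * u k (l *\<^sub>R Q x) = u (k * l powr \<sigma>) x"
proof (rule u_unique)
  show "k * l powr \<sigma> > 0" using k l by simp
  show "weak_solution \<alpha> p (k * l powr \<sigma>) (\<lambda>x. l powr a * u k (l *\<^sub>R Q x))"
    unfolding sigma_def a_def by (rule weak_solution_similarity[OF alpha(1) p(1) p1 l Q weak[OF k]])
  have Q0: "Q x \<noteq> 0" if "x \<noteq> 0" for x using that orthogonal_transformation_norm[OF Q, of x] by auto
  have "continuous_on UNIV Q"
    using linear_continuous_on orthogonal_transformation_linear[OF Q] linear_conv_bounded_linear by blast
  then have "continuous_on (- {0}) Q" by (rule continuous_on_subset) simp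
  then have cont: "continuous_on (- {0}) (\<lambda>x. l *\<^sub>R Q x)"
    by (intro continuous_on_scaleR continuous_on_const)
  have sub: "(\<lambda>x. l *\<^sub>R Q x) ` (- {0}) \<subseteq> - {0}"
  proof (rule image_subsetI)
    fix x :: "real^'n" assume "x \<in> - {0}"
    then have "Q x \<noteq> 0" by (intro Q0) simp
    then show "l *\<^sub>R Q x \<in> - {0}" using l by simp
  qed
  have "continuous_on (- {0}) (\<lambda>x. u k (l *\<^sub>R Q x))"
    by (rule continuous_on_compose2[where f = "\<lambda>x. l *\<^sub>R Q x" and g = "u k", OF u_continuous[OF k] cont sub])
  then show "continuous_on (- {0}) (\<lambda>x. l powr a * u k (l *\<^sub>R Q x))"
    by (rule continuous_on_mult_left)
qed (rule x)

text \<open>Take the dilation by \<open>norm x\<close> and a rotation carrying \<open>e\<close> to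
  the direction of \<open>x\<close>. The whole family is thereby encoded in the one function
  \<open>k \<mapsto> u k e\<close>.\<close>

lemma u_radial:
  assumes p1: "p \<noteq> 1" and k: "k > 0" and e: "norm e = 1" and x: "x \<noteq> 0"
  shows "u k x = norm x powr (- a) * u (k * norm x powr \<sigma>) e"
proof -
  have "norm e = norm (x /\<^sub>R norm x)" using x e by simp
  then obtain Q where Q: "orthogonal_transformation Q" "Q e = x /\<^sub>R norm x"
    by (rule orthogonal_transformation_exists)
  have "norm x powr a * u k (norm x *\<^sub>R Q e) = u (k * norm x powr \<sigma>) e"
    using x e by (intro u_similarity[OF p1 k _ Q(1)]) auto
  moreover have "norm x *\<^sub>R Q e = x" using x by (simp add: Q(2))
  ultimately have "u (k * norm x powr \<sigma>) e = norm x powr a * u k x" by simp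
  then show ?thesis using x by (simp add: powr_minus)
qed

text \<open>For fixed \<open>x\<close> the product \<open>k * norm x powr \<sigma>\<close> runs
  through all positive numbers with \<open>k\<close>, so the supremum does not depend on
  \<open>x\<close>. It may be infinite.\<close>

lemma u_infty_power:
  assumes p1: "p \<noteq> 1" and e: "norm e = 1" and x: "x \<noteq> 0"
  shows "u_infty u x = ennreal (norm x powr (- a)) * (SUP k\<in>{0<..}. ennreal (u k e))"
proof -
  have s: "norm x powr \<sigma> > 0" using x by simp
  have "u_infty u x = (SUP k\<in>{0<..}. ennreal (norm x powr (- a)) * ennreal (u (k * norm x powr \<sigma>) e))"
    unfolding u_infty_eq_SUP
    by (rule SUP_cong) (use x s in \<open>simp_all add: pointwise_value_def u_radial[OF p1 _ e x] ennreal_mult u_nonneg\<close>)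
  also have "\<dots> = ennreal (norm x powr (- a)) * (SUP k\<in>{0<..}. ennreal (u (k * norm x powr \<sigma>) e))"
    by (subst SUP_mult_left_ennreal) simp
  also have "(SUP k\<in>{0<..}. ennreal (u (k * norm x powr \<sigma>) e)) = (SUP k\<in>(\<lambda>k. k * norm x powr \<sigma>) ` {0<..}. ennreal (u k e))"
    by (simp add: image_image)
  also have "(\<lambda>k. k * norm x powr \<sigma>) ` {0<..} = {0<..}"
  proof (intro set_eqI iffI)
    fix y :: real assume "y \<in> {0<..}"
    then have "y = (y / norm x powr \<sigma>) * norm x powr \<sigma>" "y / norm x powr \<sigma> \<in> {0<..}"
      using s by auto
    then show "y \<in> (\<lambda>k. k * norm x powr \<sigma>) ` {0<..}" by blast
  qed (use s in auto)
  finally show ?thesis .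
qed

section \<open>Positivity, and the linear case\<close>

lemma u_not_zero:
  assumes k: "k > 0"
  shows "\<exists>x. x \<noteq> 0 \<and> 0 < u k x"
proof (rule ccontr)
  assume "\<not> (\<exists>x. x \<noteq> 0 \<and> 0 < u k x)"
  then have z: "u k x = 0" if "x \<noteq> 0" for x using that u_nonneg[OF k, of x] by force
  obtain \<xi> :: "real^'n \<Rightarrow> real" where xi: "\<xi> \<in> test_functions \<alpha>" "\<And>x. 0 < \<xi> x \<longleftrightarrow> norm (x - 0) < 1"
    by (rule translated_bump[OF alpha, of 0]) (rule that)
  have "(LINT x|lebesgue. u k x * frac_lap \<alpha> \<xi> x + u k x powr p * \<xi> x) = 0"
  proof (rule integral_eq_zero_AE)
    show "AE x in lebesgue. u k x * frac_lap \<alpha> \<xi> x + u k x powr p * \<xi> x = 0"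
      using AE_neq_zero by eventually_elim (simp add: z)
  qed
  then have "k * \<xi> 0 = 0" using u_weak[OF k xi(1)] by simp
  moreover have "\<xi> 0 > 0" using xi(2)[of 0] by simp
  ultimately show False using k by simp
qed

text \<open>Strong maximum principle: at a zero of \<open>u k\<close> the equation makes the
  fractional Laplacian 0, while each truncated integral has a nonnegative integrand. So
  \<open>u k\<close> vanishes almost everywhere, against \<open>u_not_zero\<close>.\<close>

lemma u_positive:
  assumes k: "k > 0" and x: "x \<noteq> 0"
  shows "0 < u k x"
proof (rule ccontr)
  assume "\<not> 0 < u k x"
  then have ux: "u k x = 0" using u_nonneg[OF k, of x] by simp
  obtain y where y: "y \<noteq> 0" "0 < u k y" using u_not_zero[OF k] by blast
  \<comment> \<open>Half the distance, so that a neighbourhood of \<open>y\<close> lies in the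
    region kept by the truncation at \<open>e\<close>.\<close>
  define e where "e = norm (y - x) / 2"
  have yx: "y \<noteq> x" using y ux by auto
  then have e: "e > 0" by (simp add: e_def)
  let ?g = "\<lambda>\<epsilon> z. indicator {z. norm (z - x) > \<epsilon>} z *\<^sub>R frac_kernel \<alpha> (u k) x z"
  have ex: "frac_lap_exists \<alpha> (u k) x" and lap: "frac_lap \<alpha> (u k) x = 0"
    using classical[OF k] x ux by (auto simp: classical_solution_def)
  have gi: "integrable lebesgue (?g \<epsilon>)" if "\<epsilon> > 0" for \<epsilon>
    using ex that by (simp add: frac_lap_exists_def set_integrable_def)
  have g0: "0 \<le> ?g \<epsilon> z" for \<epsilon> z
    using u_nonneg[OF k] by (simp add: frac_kernel_def ux)
  have eps: "frac_lap_eps \<alpha> \<epsilon> (u k) x = - (LINT z|lebesgue. ?g \<epsilon> z)" for \<epsilon>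
    by (simp add: frac_lap_eps_def set_lebesgue_integral_def)
  have "frac_lap \<alpha> (u k) x \<le> - (LINT z|lebesgue. ?g e z)"
  proof (rule tendsto_upperbound[OF frac_lap_tendsto[OF ex]])
    show "\<forall>\<^sub>F \<epsilon> in at_right 0. frac_lap_eps \<alpha> \<epsilon> (u k) x \<le> - (LINT z|lebesgue. ?g e z)"
      using eventually_at_right_real[OF e]
    proof eventually_elim
      case (elim \<epsilon>)
      have "(LINT z|lebesgue. ?g e z) \<le> (LINT z|lebesgue. ?g \<epsilon> z)"
      proof (rule integral_mono)
        fix z show "?g e z \<le> ?g \<epsilon> z"
          using elim g0[of \<epsilon> z] by (auto simp: indicator_def)
      qed (use elim gi e in auto)
      then show ?case by (simp add: eps)
    qed
  qed simp
  moreover have "0 \<le> (LINT z|lebesgue. ?g e z)"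
    by (rule Bochner_Integration.integral_nonneg) (rule g0)
  ultimately have "(LINT z|lebesgue. ?g e z) = 0" using lap by linarith
  then have "AE z in lebesgue. ?g e z = 0"
    using integral_nonneg_eq_0_iff_AE[OF gi[OF e]] g0 by simp
  let ?U = "((- {0}) \<inter> u k -` {0<..}) \<inter> {z. norm (z - x) > e}"
  have "open ?U"
    using u_continuous[OF k]
    by (intro open_Int continuous_open_preimage open_Collect_less continuous_intros) auto
  moreover have "y \<in> ?U" using y e by (simp add: e_def)
  moreover have "AE z in lebesgue. z \<notin> ?U"
    using \<open>AE z in lebesgue. ?g e z = 0\<close>
  proof eventually_elim
    case (elim z)
    then show ?case using e by (auto simp: frac_kernel_def ux indicator_def split: if_splits)
  qed
  ultimately show False using open_AE_empty[of ?U] by blast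
qed

lemma u_infty_linear:
  assumes p1: "p = 1" and x: "x \<noteq> 0"
  shows "u_infty u x = \<infinity>"
proof -
  have scale: "u k x = k * u 1 x" if k: "k > 0" for k
  proof -
    have "weak_solution \<alpha> p k (\<lambda>x. k * u 1 x)"
      unfolding weak_solution_def
    proof (intro conjI allI ballI)
      note W = weak[OF zero_less_one, unfolded weak_solution_def]
      show "0 \<le> k * u 1 x" for x using k u_nonneg[of 1] by simp
      show "integrable (omega_measure \<alpha>) (\<lambda>x. k * u 1 x)"
        using W by (intro integrable_mult_right) auto
      have "integrable (omega_measure \<alpha>) (\<lambda>x. k * u 1 x powr p)"
        using W by (intro integrable_mult_right) auto
      then show "integrable (omega_measure \<alpha>) (\<lambda>x. (k * u 1 x) powr p)"
        using k u_nonneg[of 1] by (simp add: p1)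
      have "((\<lambda>x. k * u 1 x) \<longlongrightarrow> k * 0) at_infinity" using W by (intro tendsto_intros) auto
      then show "((\<lambda>x. k * u 1 x) \<longlongrightarrow> 0) at_infinity" by simp
      fix \<xi> :: "real^'n \<Rightarrow> real" assume xi: "\<xi> \<in> test_functions \<alpha>"
      have "(LINT x|lebesgue. k * u 1 x * frac_lap \<alpha> \<xi> x + (k * u 1 x) powr p * \<xi> x)
        = (LINT x|lebesgue. k * (u 1 x * frac_lap \<alpha> \<xi> x + u 1 x powr p * \<xi> x))"
        using k u_nonneg[of 1] by (intro Bochner_Integration.integral_cong) (auto simp: p1 algebra_simps)
      also have "\<dots> = k * \<xi> 0" using u_weak[OF zero_less_one xi] by simp
      finally show "(LINT x|lebesgue. k * u 1 x * frac_lap \<alpha> \<xi> x + (k * u 1 x) powr p * \<xi> x) = k * \<xi> 0" .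
    qed
    then show ?thesis
      using u_continuous[OF zero_less_one] k x by (intro u_unique[symmetric]) (auto intro!: continuous_intros)
  qed
  have pos: "0 < u 1 x" by (rule u_positive[OF zero_less_one x])
  have "filterlim (\<lambda>k. u 1 x * k) at_top at_top"
    by (rule filterlim_tendsto_pos_mult_at_top[OF tendsto_const pos filterlim_ident])
  then have "((\<lambda>k. ennreal (k * u 1 x)) \<longlongrightarrow> \<infinity>) at_top"
    by (simp add: ennreal_tendsto_top_eq_at_top mult.commute)
  moreover have "\<forall>\<^sub>F k in at_top. ennreal (k * u 1 x) = pointwise_value (u k) x"
    using eventually_gt_at_top[of 0]
  proof eventually_elim
    case (elim k)
    show ?case unfolding scale[OF elim, symmetric] using x by (simp add: pointwise_value_def)
  qed
  ultimately have "((\<lambda>k. pointwise_value (u k) x) \<longlongrightarrow> \<infinity>) at_top"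
    by (rule Lim_transform_eventually)
  then show ?thesis by (rule tendsto_unique[OF trivial_limit_at_top_linorder u_infty_tendsto])
qed

section \<open>Testing on an annulus: mass against local size\<close>

text \<open>The bump is centred at a point of norm 3, so its support lies between radii 2 and 4, and
  points with norm below 1 or above 5 are at distance at least 2 from the centre, where the
  Laplacian is negative. Avoiding the origin removes the Dirac mass and makes all moments
  finite.\<close>

lemma annulus_bump:
  obtains \<xi> :: "real^'n \<Rightarrow> real" and C c where "\<xi> \<in> test_functions \<alpha>" "\<xi> \<in> borel_measurable borel"
    "\<And>x. 0 \<le> \<xi> x" "\<And>x. \<xi> x \<le> 1" "\<And>x. \<xi> x \<noteq> 0 \<Longrightarrow> 2 \<le> norm x \<and> norm x \<le> 4"
    "\<And>b. integrable lebesgue (\<lambda>x. norm x powr b * \<xi> x)" "\<And>b. 0 < (LINT x|lebesgue. norm x powr b * \<xi> x)"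
    "C > 0" "\<And>\<epsilon> x. \<epsilon> \<in> {0<..1} \<Longrightarrow> \<bar>frac_lap_eps \<alpha> \<epsilon> \<xi> x\<bar> \<le> C / weight K x"
    "\<And>x. \<bar>frac_lap \<alpha> \<xi> x\<bar> \<le> C / weight K x"
    "c > 0" "\<And>x. norm x < 1 \<or> norm x > 5 \<Longrightarrow> frac_lap \<alpha> \<xi> x \<le> - c / weight K x"
proof -
  obtain x0 :: "real^'n" where x0: "norm x0 = 3" using vector_choose_size[of 3] by auto
  obtain \<xi> C c where xi: "\<xi> \<in> test_functions \<alpha>" and xm [measurable]: "\<xi> \<in> borel_measurable borel"
    and x01: "\<And>x. 0 \<le> \<xi> x" "\<And>x. \<xi> x \<le> 1" and xpos: "\<And>x. 0 < \<xi> x \<longleftrightarrow> norm (x - x0) < 1"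
    and C: "C > 0" "\<And>\<epsilon> x. \<epsilon> \<in> {0<..1} \<Longrightarrow> \<bar>frac_lap_eps \<alpha> \<epsilon> \<xi> x\<bar> \<le> C / weight (real CARD('n) + 2 * \<alpha>) x"
    and c: "c > 0" "\<And>x. norm (x - x0) \<ge> 2 \<Longrightarrow> frac_lap \<alpha> \<xi> x \<le> - c / weight (real CARD('n) + 2 * \<alpha>) x"
    by (rule translated_bump[OF alpha, of x0]) (rule that)
  have supp: "2 \<le> norm x \<and> norm x \<le> 4" if "\<xi> x \<noteq> 0" for x
  proof -
    have "norm (x - x0) < 1" using that x01(1)[of x] xpos[of x] by linarith
    then show ?thesis using x0 norm_triangle_ineq2[of x x0] norm_triangle_ineq2[of x0 x] by (simp add: norm_minus_commute)
  qed
  have ex: "frac_lap_exists \<alpha> \<xi> x" for x using xi by (simp add: test_functions_def)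
  have int: "integrable lebesgue (\<lambda>x. norm x powr b * \<xi> x)" for b
  proof -
    let ?m = "max (2 powr b) (4 powr b)"
    have "integrable lebesgue (\<lambda>x::real^'n. ?m * indicator (cball 0 4) x)"
      by (intro integrable_mult_right integrable_indicator_cball)
    then show ?thesis
    proof (rule Bochner_Integration.integrable_bound)
      show "(\<lambda>x. norm x powr b * \<xi> x) \<in> borel_measurable lebesgue" by (rule measurable_completion) simp
      show "AE x in lebesgue. norm (norm x powr b * \<xi> x) \<le> norm (?m * indicator (cball (0::real^'n) 4) x)"
      proof (rule AE_I2)
        fix x :: "real^'n"
        show "norm (norm x powr b * \<xi> x) \<le> norm (?m * indicator (cball (0::real^'n) 4) x)"
        proof (cases "\<xi> x = 0")
          case False
          note s = supp[OF False]
          have "norm x powr b \<le> ?m"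
          proof (cases "b \<ge> 0")
            case True
            then have "norm x powr b \<le> 4 powr b" using s by (intro powr_mono2) auto
            then show ?thesis by simp
          next
            case False
            then have "norm x powr b \<le> 2 powr b" using s by (intro powr_mono2') auto
            then show ?thesis by simp
          qed
          moreover have m0: "0 \<le> ?m" by (simp add: le_max_iff_disj)
          ultimately have "norm x powr b * \<xi> x \<le> ?m * 1" using x01 by (intro mult_mono) auto
          then show ?thesis using s x01(1)[of x] by (simp add: abs_mult abs_of_nonneg[OF m0])
        qed simp
      qed
    qed
  qed
  have pos: "0 < (LINT x|lebesgue. norm x powr b * \<xi> x)" for b
  proof -
    have "(LINT x|lebesgue. norm x powr b * \<xi> x) \<noteq> 0"
    proof
      assume "(LINT x|lebesgue. norm x powr b * \<xi> x) = 0"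
      then have "AE x in lebesgue. norm x powr b * \<xi> x = 0"
        using integral_nonneg_eq_0_iff_AE[OF int] x01(1) by simp
      then have "AE x in lebesgue. x \<notin> ball x0 1"
      proof eventually_elim
        case (elim x)
        show ?case
        proof
          assume "x \<in> ball x0 1"
          then have "\<xi> x > 0" using xpos[of x] by (simp add: dist_norm norm_minus_commute)
          moreover have "norm x \<noteq> 0" using supp[of x] \<open>\<xi> x > 0\<close> by auto
          ultimately show False using elim by simp
        qed
      qed
      then show False using open_AE_empty[of "ball x0 1"] by simp
    qed
    moreover have "0 \<le> (LINT x|lebesgue. norm x powr b * \<xi> x)"
      by (rule Bochner_Integration.integral_nonneg) (simp add: x01)
    ultimately show ?thesis by linarith
  qed
  have lapC: "\<bar>frac_lap \<alpha> \<xi> x\<bar> \<le> C / weight K x" for x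
  proof (rule tendsto_upperbound[OF tendsto_rabs[OF frac_lap_tendsto[OF ex]]])
    show "\<forall>\<^sub>F \<epsilon> in at_right 0. \<bar>frac_lap_eps \<alpha> \<epsilon> \<xi> x\<bar> \<le> C / weight K x"
      using eventually_at_right_real[OF zero_less_one] by eventually_elim (use C(2) in \<open>auto simp: K_def\<close>)
  qed simp
  have far: "frac_lap \<alpha> \<xi> x \<le> - c / weight K x" if "norm x < 1 \<or> norm x > 5" for x
    unfolding K_def using that x0 norm_triangle_ineq2[of x x0] norm_triangle_ineq2[of x0 x]
    by (intro c(2)) (auto simp: norm_minus_commute)
  show thesis
    by (rule that[OF xi xm x01 supp int pos C(1) _ lapC c(1) far]) (use C(2) in \<open>auto simp: K_def\<close>)
qed

text \<open>The weak identity concerns the integral of a sum. The decay of the Laplacian of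
  \<open>\<xi>\<close> and the bounded support of \<open>\<xi>\<close> make both terms integrable,
  so the sum may be split; the right-hand side is \<open>k * \<xi> 0 = 0\<close>.\<close>

lemma u_test_integrable:
  assumes k: "k > 0" and xi: "\<xi> \<in> test_functions \<alpha>" and xm: "\<xi> \<in> borel_measurable borel"
    and x01: "\<And>x. 0 \<le> \<xi> x" "\<And>x. \<xi> x \<le> 1" and supp: "\<And>x. \<xi> x \<noteq> 0 \<Longrightarrow> 2 \<le> norm x \<and> norm x \<le> 4"
    and C: "\<And>x. \<bar>frac_lap \<alpha> \<xi> x\<bar> \<le> C / weight K x"
  shows "integrable lebesgue (\<lambda>x. u k x * frac_lap \<alpha> \<xi> x)" "integrable lebesgue (\<lambda>x. u k x powr p * \<xi> x)"
    and "(LINT x|lebesgue. u k x * frac_lap \<alpha> \<xi> x) + (LINT x|lebesgue. u k x powr p * \<xi> x) = 0"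
proof -
  have ex: "frac_lap_exists \<alpha> \<xi> x" for x using xi by (simp add: test_functions_def)
  have [measurable]: "frac_lap \<alpha> \<xi> \<in> borel_measurable lebesgue" "\<xi> \<in> borel_measurable lebesgue"
    "u k \<in> borel_measurable lebesgue"
    using frac_lap_measurable[OF xm ex] xm u_measurable[OF k] by (auto intro: measurable_completion)
  have "integrable lebesgue (\<lambda>x. C * (u k x / weight K x))"
    by (intro integrable_mult_right u_omega k)
  then show i1: "integrable lebesgue (\<lambda>x. u k x * frac_lap \<alpha> \<xi> x)"
  proof (rule Bochner_Integration.integrable_bound)
    show "AE x in lebesgue. norm (u k x * frac_lap \<alpha> \<xi> x) \<le> norm (C * (u k x / weight K x))"
    proof (rule AE_I2)
      fix x :: "real^'n"
      have "u k x * \<bar>frac_lap \<alpha> \<xi> x\<bar> \<le> u k x * (C / weight K x)"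
        by (intro mult_left_mono C u_nonneg k)
      also have "\<dots> = C * (u k x / weight K x)" by simp
      finally show "norm (u k x * frac_lap \<alpha> \<xi> x) \<le> norm (C * (u k x / weight K x))"
        using u_nonneg[OF k, of x] by (simp only: real_norm_def abs_mult[of "u k x"] abs_of_nonneg[of "u k x"])
    qed
  qed (measurable)
  have "integrable lebesgue (\<lambda>x. (1 + 4 powr K) * (u k x powr p / weight K x))"
    by (intro integrable_mult_right u_powr_omega k)
  then show i2: "integrable lebesgue (\<lambda>x. u k x powr p * \<xi> x)"
  proof (rule Bochner_Integration.integrable_bound)
    show "AE x in lebesgue. norm (u k x powr p * \<xi> x) \<le> norm ((1 + 4 powr K) * (u k x powr p / weight K x))"
    proof (rule AE_I2)
      fix x :: "real^'n"
      have w: "0 < 1 + norm x powr K" by (rule weight_pos)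
      have "\<xi> x \<le> (1 + 4 powr K) / weight K x"
      proof (cases "\<xi> x = 0")
        case False
        have "norm x powr K \<le> 4 powr K" using supp[OF False] alpha by (intro powr_mono2) (auto simp: K_def)
        then have "1 \<le> (1 + 4 powr K) / weight K x" using w by simp
        then show ?thesis using x01(2)[of x] by linarith
      next
        case True
        have "0 \<le> (1 + 4 powr K) / weight K x" by (intro divide_nonneg_nonneg add_nonneg_nonneg) auto
        then show ?thesis using True by linarith
      qed
      then have "u k x powr p * \<xi> x \<le> u k x powr p * ((1 + 4 powr K) / weight K x)"
        by (rule mult_left_mono) simp
      also have "\<dots> = (1 + 4 powr K) * (u k x powr p / weight K x)" by simp
      finally have "u k x powr p * \<xi> x \<le> (1 + 4 powr K) * (u k x powr p / weight K x)" .
      moreover have "0 \<le> u k x powr p * \<xi> x" using x01 by simp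
      ultimately show "norm (u k x powr p * \<xi> x) \<le> norm ((1 + 4 powr K) * (u k x powr p / weight K x))"
        by (simp only: real_norm_def)
    qed
  qed measurable
  have "\<xi> 0 = 0" using supp[of 0] by auto
  then show "(LINT x|lebesgue. u k x * frac_lap \<alpha> \<xi> x) + (LINT x|lebesgue. u k x powr p * \<xi> x) = 0"
    using u_weak[OF k xi] Bochner_Integration.integral_add[OF i1 i2] by simp
qed

text \<open>Add \<open>c\<close> times the \<omega>-mass to the test identity. Outside the annulus
  from 1 to 5 the negative Laplacian absorbs it, so what remains is controlled by values of
  \<open>u k\<close> on that annulus, with a constant independent of \<open>k\<close>.\<close>

lemma omega_mass_upper:
  "\<exists>A\<ge>0. \<forall>k>0. \<forall>V\<ge>0. (\<forall>x. 1 \<le> norm x \<and> norm x \<le> 5 \<longrightarrow> u k x \<le> V) \<longrightarrow>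
     (LINT x|lebesgue. u k x / weight K x) \<le> A * (V + V powr p)"
proof -
  obtain \<xi> :: "real^'n \<Rightarrow> real" and C c where xi: "\<xi> \<in> test_functions \<alpha>" "\<xi> \<in> borel_measurable borel"
    and x01: "\<And>x. 0 \<le> \<xi> x" "\<And>x. \<xi> x \<le> 1" and supp: "\<And>x. \<xi> x \<noteq> 0 \<Longrightarrow> 2 \<le> norm x \<and> norm x \<le> 4"
    and C: "C > 0" "\<And>x. \<bar>frac_lap \<alpha> \<xi> x\<bar> \<le> C / weight K x"
    and c: "c > 0" "\<And>x. norm x < 1 \<or> norm x > 5 \<Longrightarrow> frac_lap \<alpha> \<xi> x \<le> - c / weight K x"
    by (rule annulus_bump) (rule that)
  define v where "v = measure lebesgue (cball (0::real^'n) 5)"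
  have v: "v \<ge> 0" by (simp add: v_def)
  have main: "(LINT x|lebesgue. u k x / weight K x) \<le> ((1 + C + c) * v / c) * (V + V powr p)"
    if k: "k > 0" and V: "V \<ge> 0" and uV: "\<And>x. 1 \<le> norm x \<Longrightarrow> norm x \<le> 5 \<Longrightarrow> u k x \<le> V" for k V
  proof -
    note T = u_test_integrable[OF k xi x01 supp C(2)]
    \<comment> \<open>The three summands bound, on the annulus, the power term, the Laplacian term
      and the added mass term.\<close>
    define B where "B = V powr p + V * C + c * V"
    have pt: "c * (u k x / weight K x) + (u k x * frac_lap \<alpha> \<xi> x + u k x powr p * \<xi> x) \<le> B * indicator (cball 0 5) x" for x
    proof (cases "norm x < 1 \<or> norm x > 5")
      case True
      then have "\<xi> x = 0" using supp[of x] by force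
      have "u k x * frac_lap \<alpha> \<xi> x \<le> u k x * (- c / weight K x)"
        by (intro mult_left_mono c(2) True u_nonneg k)
      then have "c * (u k x / weight K x) + u k x * frac_lap \<alpha> \<xi> x \<le> 0" by (simp add: mult.commute)
      moreover have "0 \<le> B * indicator (cball 0 5) x"
        using V C(1) c(1) by (simp add: B_def)
      ultimately show ?thesis using \<open>\<xi> x = 0\<close> by simp
    next
      case False
      then have x: "1 \<le> norm x" "norm x \<le> 5" by auto
      have w: "1 \<le> 1 + norm x powr K" by simp
      note u0 = u_nonneg[OF k, of x] and ub = uV[OF x]
      have "u k x / weight K x \<le> u k x / 1"
        by (intro divide_left_mono w u0 mult_pos_pos weight_pos) simp
      then have 1: "c * (u k x / weight K x) \<le> c * V" using ub c(1) by (intro mult_left_mono) auto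
      have "C / weight K x \<le> C / 1" using C(1) by (intro divide_left_mono w mult_pos_pos weight_pos) auto
      then have "frac_lap \<alpha> \<xi> x \<le> C" using C(2)[of x] by linarith
      then have 2: "u k x * frac_lap \<alpha> \<xi> x \<le> V * C"
        using u0 ub C(1) order_trans[OF mult_left_mono mult_right_mono] by (metis less_imp_le)
      have "u k x powr p * \<xi> x \<le> V powr p * 1"
        using u0 ub p(1) x01 by (intro mult_mono powr_mono2) auto
      with 1 2 show ?thesis using x by (simp add: B_def)
    qed
    have cu: "integrable lebesgue (\<lambda>x. c * (u k x / weight K x))"
      by (intro integrable_mult_right u_omega k)
    have uu: "integrable lebesgue (\<lambda>x. u k x * frac_lap \<alpha> \<xi> x + u k x powr p * \<xi> x)"
      by (intro Bochner_Integration.integrable_add T)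
    have "c * (LINT x|lebesgue. u k x / weight K x) = (LINT x|lebesgue. c * (u k x / weight K x))"
      by (rule integral_mult_right_zero[symmetric])
    also have "\<dots> = (LINT x|lebesgue. c * (u k x / weight K x) + (u k x * frac_lap \<alpha> \<xi> x + u k x powr p * \<xi> x))"
      using Bochner_Integration.integral_add[OF cu uu] Bochner_Integration.integral_add[OF T(1,2)] T(3) by linarith
    also have "\<dots> \<le> (LINT x|lebesgue. B * indicator (cball (0::real^'n) 5) x)"
      by (intro integral_mono pt integrable_mult_right integrable_indicator_cball Bochner_Integration.integrable_add T u_omega k)
    also have "\<dots> = B * v" by (simp add: v_def)
    also have "\<dots> \<le> (1 + C + c) * (V + V powr p) * v"
    proof (rule mult_right_mono[OF _ v])
      have "0 \<le> V + (C + c) * V powr p" using V C(1) c(1) by simp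
      then show "B \<le> (1 + C + c) * (V + V powr p)" by (simp add: B_def algebra_simps)
    qed
    finally show ?thesis using c(1) by (simp add: field_simps)
  qed
  show ?thesis
    using main C(1) c(1) v by (intro exI[of _ "(1 + C + c) * v / c"]) auto
qed

text \<open>The same identity read the other way: the integral of
  \<open>u k x powr p * \<xi> x\<close> is minus that of \<open>u k\<close> against the Laplacian of
  \<open>\<xi>\<close>, hence at most \<open>C\<close> times the \<omega>-mass.\<close>

lemma omega_mass_lower:
  "\<exists>A\<ge>0. \<forall>k>0. \<forall>m\<ge>0. (\<forall>x. 2 \<le> norm x \<and> norm x \<le> 4 \<longrightarrow> m \<le> u k x) \<longrightarrow>
     m powr p \<le> A * (LINT x|lebesgue. u k x / weight K x)"
proof -
  obtain \<xi> :: "real^'n \<Rightarrow> real" and C where xi: "\<xi> \<in> test_functions \<alpha>" "\<xi> \<in> borel_measurable borel"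
    and x01: "\<And>x. 0 \<le> \<xi> x" "\<And>x. \<xi> x \<le> 1" and supp: "\<And>x. \<xi> x \<noteq> 0 \<Longrightarrow> 2 \<le> norm x \<and> norm x \<le> 4"
    and I: "\<And>b. integrable lebesgue (\<lambda>x. norm x powr b * \<xi> x)" "\<And>b. 0 < (LINT x|lebesgue. norm x powr b * \<xi> x)"
    and C: "C > 0" "\<And>x. \<bar>frac_lap \<alpha> \<xi> x\<bar> \<le> C / weight K x"
    by (rule annulus_bump) (rule that)
  \<comment> \<open>\<open>norm x powr 0\<close> is 1 off the origin and \<open>\<xi>\<close>
    vanishes at the origin, so \<open>J\<close> is the integral of \<open>\<xi>\<close>.\<close>
  define J where "J = (LINT x|lebesgue. norm x powr 0 * \<xi> x)"
  have J: "J > 0" unfolding J_def by (rule I(2))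
  have main: "m powr p \<le> (C / J) * (LINT x|lebesgue. u k x / weight K x)"
    if k: "k > 0" and m: "m \<ge> 0" and um: "\<And>x. 2 \<le> norm x \<Longrightarrow> norm x \<le> 4 \<Longrightarrow> m \<le> u k x" for k m
  proof -
    note T = u_test_integrable[OF k xi x01 supp C(2)]
    have "m powr p * J = (LINT x|lebesgue. m powr p * (norm x powr 0 * \<xi> x))" by (simp only: J_def integral_mult_right_zero)
    also have "\<dots> \<le> (LINT x|lebesgue. u k x powr p * \<xi> x)"
    proof (rule integral_mono)
      show "integrable lebesgue (\<lambda>x. m powr p * (norm x powr 0 * \<xi> x))" by (intro integrable_mult_right I(1))
      show "integrable lebesgue (\<lambda>x. u k x powr p * \<xi> x)" by (rule T(2))
      fix x :: "real^'n"
      show "m powr p * (norm x powr 0 * \<xi> x) \<le> u k x powr p * \<xi> x"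
      proof (cases "\<xi> x = 0")
        case False
        then have "m powr p \<le> u k x powr p" using supp um m p(1) by (intro powr_mono2) auto
        then have "m powr p * \<xi> x \<le> u k x powr p * \<xi> x" using x01(1) by (rule mult_right_mono)
        then show ?thesis using supp[OF False] by auto
      qed simp
    qed
    also have "\<dots> = (LINT x|lebesgue. - (u k x * frac_lap \<alpha> \<xi> x))" using T(3) by simp
    also have "\<dots> \<le> (LINT x|lebesgue. C * (u k x / weight K x))"
    proof (rule integral_mono)
      show "integrable lebesgue (\<lambda>x. - (u k x * frac_lap \<alpha> \<xi> x))" using T(1) by simp
      show "integrable lebesgue (\<lambda>x. C * (u k x / weight K x))" by (intro integrable_mult_right u_omega k)
      fix x :: "real^'n"
      have "- frac_lap \<alpha> \<xi> x \<le> C / weight K x" using C(2)[of x] by linarith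
      then have "u k x * (- frac_lap \<alpha> \<xi> x) \<le> u k x * (C / weight K x)"
        using u_nonneg[OF k, of x] by (rule mult_left_mono)
      then show "- (u k x * frac_lap \<alpha> \<xi> x) \<le> C * (u k x / weight K x)" by (simp add: mult.commute)
    qed
    also have "\<dots> = C * (LINT x|lebesgue. u k x / weight K x)" by (rule integral_mult_right_zero)
    finally show ?thesis using J by (simp add: field_simps)
  qed
  show ?thesis using main J C(1) by (intro exI[of _ "C / J"]) auto
qed

section \<open>A finite profile and the subcritical range\<close>

lemma u_seq_tendsto:
  assumes p1: "p \<noteq> 1" and e: "norm e = 1" and x: "x \<noteq> 0"
    and c: "(SUP k\<in>{0<..}. ennreal (u k e)) = ennreal c" "c \<ge> 0"
  shows "(\<lambda>n. u (real (Suc n)) x) \<longlonglongrightarrow> c * norm x powr (- a)"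
    and "\<And>k. k > 0 \<Longrightarrow> u k x \<le> c * norm x powr (- a)"
proof -
  have U: "u_infty u x = ennreal (c * norm x powr (- a))"
    using u_infty_power[OF p1 e x] c by (simp add: ennreal_mult mult.commute)
  have "filterlim (\<lambda>n. real (Suc n)) at_top sequentially"
    using filterlim_compose[OF filterlim_real_sequentially filterlim_Suc] .
  from filterlim_compose[OF u_infty_tendsto this, of x]
  have "(\<lambda>n. ennreal (u (real (Suc n)) x)) \<longlonglongrightarrow> ennreal (c * norm x powr (- a))"
    using x by (simp add: U pointwise_value_def)
  then show "(\<lambda>n. u (real (Suc n)) x) \<longlonglongrightarrow> c * norm x powr (- a)"
    using c(2) by (subst (asm) tendsto_ennreal_iff) (auto simp: u_nonneg)
  fix k :: real assume k: "k > 0"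
  show "u k x \<le> c * norm x powr (- a)"
    using u_le_u_infty[OF k x] c(2) by (simp add: U ennreal_le_iff)
qed

text \<open>A finite supremum bounds \<open>u k\<close> on the annulus from 1 to 5 uniformly in
  \<open>k\<close>, so \<open>omega_mass_upper\<close> bounds the masses uniformly. Fatou's lemma
  passes this to the limit profile, a positive multiple of |x|^-a.\<close>

lemma finite_imp_powr_omega:
  assumes p1: "p \<noteq> 1" and e: "norm e = 1" and fin: "(SUP k\<in>{0<..}. ennreal (u k e)) \<noteq> \<infinity>"
  shows "(\<integral>\<^sup>+x. ennreal (norm x powr (- a) / weight K (x::real^'n)) \<partial>lebesgue) < \<infinity>"
proof -
  obtain c where c: "(SUP k\<in>{0<..}. ennreal (u k e)) = ennreal c" "c \<ge> 0"
    using fin by (cases "SUP k\<in>{0<..}. ennreal (u k e)") auto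
  have e0: "e \<noteq> 0" using e by auto
  have "0 < u 1 e" by (rule u_positive) (use e0 in auto)
  also have "u 1 e \<le> c * norm e powr (- a)" by (rule u_seq_tendsto(2)[OF p1 e e0 c]) simp
  finally have cpos: "c > 0" using e by simp
  obtain A where A: "A \<ge> 0" "\<forall>k>0. \<forall>V\<ge>0. (\<forall>x. 1 \<le> norm x \<and> norm x \<le> 5 \<longrightarrow> u k x \<le> V) \<longrightarrow>
     (LINT x|lebesgue. u k x / weight K x) \<le> A * (V + V powr p)"
    using omega_mass_upper by (elim exE conjE) (rule that)
  \<comment> \<open>The maximum of \<open>c * norm x powr (- a)\<close> for
    \<open>1 \<le> norm x \<le> 5\<close>: it is attained at radius 1 or 5 according to the sign of
    \<open>a\<close>, which is negative for \<open>p < 1\<close>.\<close>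
  define V where "V = c * max 1 (5 powr (- a))"
  have uV: "u k x \<le> V" if "k > 0" "1 \<le> norm x" "norm x \<le> 5" for k x
  proof -
    have "norm x powr (- a) \<le> max 1 (5 powr (- a))"
    proof (cases "- a \<ge> 0")
      case True
      then have "norm x powr (- a) \<le> 5 powr (- a)" using that by (intro powr_mono2) auto
      then show ?thesis by simp
    next
      case False
      then have "norm x powr (- a) \<le> 1 powr (- a)" using that by (intro powr_mono2') auto
      then show ?thesis by simp
    qed
    then have "c * norm x powr (- a) \<le> V" unfolding V_def using cpos by (intro mult_left_mono) auto
    then show ?thesis using u_seq_tendsto(2)[OF p1 e _ c that(1), of x] that(2) by fastforce
  qed
  have V: "V \<ge> 0" using cpos by (simp add: V_def)
  let ?W = "A * (V + V powr p)"
  let ?f = "\<lambda>n x. ennreal (u (real (Suc n)) x / weight K x)"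
  have fm: "?f n \<in> borel_measurable lebesgue" for n
    using borel_measurable_integrable[OF u_omega[of "real (Suc n)"]] by simp
  have fI: "(\<integral>\<^sup>+x. ?f n x \<partial>lebesgue) \<le> ennreal ?W" for n
  proof -
    have "(\<integral>\<^sup>+x. ?f n x \<partial>lebesgue) = ennreal (LINT x|lebesgue. u (real (Suc n)) x / weight K x)"
      by (rule nn_integral_eq_integral[OF u_omega])
         (auto intro!: AE_I2 divide_nonneg_nonneg u_nonneg add_nonneg_nonneg)
    also have "\<dots> \<le> ennreal ?W" by (intro ennreal_leI A(2)[rule_format]) (use V uV in auto)
    finally show ?thesis .
  qed
  have "(\<integral>\<^sup>+x. ennreal (c * norm x powr (- a) / weight K (x::real^'n)) \<partial>lebesgue) = (\<integral>\<^sup>+x. liminf (\<lambda>n. ?f n x) \<partial>lebesgue)"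
  proof (rule nn_integral_cong_AE)
    show "AE x in lebesgue. ennreal (c * norm x powr (- a) / weight K (x::real^'n)) = liminf (\<lambda>n. ?f n x)"
      using AE_neq_zero
    proof eventually_elim
      case (elim x)
      have "1 + norm x powr K \<noteq> 0" using weight_pos[of x K] by linarith
      then have "(\<lambda>n. u (real (Suc n)) x / weight K x) \<longlonglongrightarrow> c * norm x powr (- a) / weight K x"
        by (intro tendsto_divide u_seq_tendsto(1)[OF p1 e elim c] tendsto_const)
      then have "(\<lambda>n. ?f n x) \<longlonglongrightarrow> ennreal (c * norm x powr (- a) / weight K x)"
        by (rule tendsto_ennrealI)
      then show ?case by (rule lim_imp_Liminf[OF sequentially_bot, symmetric])
    qed
  qed
  also have "\<dots> \<le> liminf (\<lambda>n. \<integral>\<^sup>+x. ?f n x \<partial>lebesgue)" by (rule nn_integral_liminf[OF fm])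
  also have "\<dots> \<le> ennreal ?W"
    by (rule order_trans[OF Liminf_le_Limsup Limsup_bounded]) (use fI in auto)
  also have "\<dots> < \<infinity>" by simp
  finally have "ennreal c * (\<integral>\<^sup>+x. ennreal (norm x powr (- a) / weight K (x::real^'n)) \<partial>lebesgue) < \<infinity>"
  proof -
    have "(\<lambda>x::real^'n. ennreal (norm x powr (- a) / weight K x)) \<in> borel_measurable lebesgue"
      by (rule measurable_completion) simp
    then have "ennreal c * (\<integral>\<^sup>+x. ennreal (norm x powr (- a) / weight K (x::real^'n)) \<partial>lebesgue)
      = (\<integral>\<^sup>+x. ennreal (c * norm x powr (- a) / weight K (x::real^'n)) \<partial>lebesgue)"
      using cpos by (subst nn_integral_cmult[symmetric]) (auto simp: ennreal_mult'[symmetric])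
    then show "(\<integral>\<^sup>+x. ennreal (c * norm x powr (- a) / weight K (x::real^'n)) \<partial>lebesgue) < \<infinity> \<Longrightarrow> ?thesis" by simp
  qed
  then show ?thesis using cpos by (auto simp: ennreal_mult_less_top)
qed

lemma subcritical_infinite:
  assumes pc: "p \<le> 1 + 2 * \<alpha> / real CARD('n)"
  shows "u_infty u x = \<infinity>"
proof (cases "x = 0 \<or> p = 1")
  case True
  then show ?thesis using u_infty_zero u_infty_linear[of x] by blast
next
  case False
  then have p1: "p \<noteq> 1" and x: "x \<noteq> 0" by auto
  have N0: "real CARD('n) > 0" using N by simp
  obtain e :: "real^'n" where e: "norm e = 1" using vector_choose_size[of 1] by auto
  have "(SUP k\<in>{0<..}. ennreal (u k e)) = \<infinity>"
  proof (rule ccontr)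
    assume "(SUP k\<in>{0<..}. ennreal (u k e)) \<noteq> \<infinity>"
    from finite_imp_powr_omega[OF p1 e this]
    have "(\<integral>\<^sup>+x. ennreal (norm x powr (- a) / weight K (x::real^'n)) \<partial>lborel) < \<infinity>"
      by (simp add: nn_integral_completion)
    moreover have "(\<lambda>x::real^'n. ennreal (norm x powr (- a) / weight K x)) \<in> borel_measurable lborel" by simp
    \<comment> \<open>The factor 2 absorbs the weight: it is at most
      \<open>2 * norm x powr K\<close> outside the unit ball and at most 2 inside.\<close>
    ultimately have fin: "(\<integral>\<^sup>+x. 2 * ennreal (norm x powr (- a) / weight K (x::real^'n)) \<partial>lborel) < \<infinity>"
      by (subst nn_integral_cmult) (auto simp: ennreal_mult_less_top)
    have two: "ennreal s \<le> 2 * ennreal t" if "s \<le> 2 * t" "0 \<le> t" for s t :: real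
      using ennreal_leI[OF that(1)] that(2) by (simp add: ennreal_mult)
    show False
    proof (cases "p < 1")
      case True
      have "2 * \<alpha> * (1 - p) \<le> 2 * \<alpha> * 1" using alpha p(1) by (intro mult_left_mono) auto
      then have "2 * \<alpha> \<le> 2 * \<alpha> / (1 - p)" using True by (simp add: pos_le_divide_eq)
      also have "\<dots> = - a" unfolding a_def by (metis minus_diff_eq minus_divide_right)
      \<comment> \<open>For \<open>p < 1\<close> the profile grows at least like |x|^(2\<alpha>), so
        the divergence is at infinity.\<close>
      finally have aK: "a + K \<le> real CARD('n)" by (simp add: K_def)
      have "(\<integral>\<^sup>+x. indicator {x::real^'n. 1 \<le> norm x} x * ennreal (norm x powr (- (a + K))) \<partial>lborel)
         \<le> (\<integral>\<^sup>+x. 2 * ennreal (norm x powr (- a) / weight K (x::real^'n)) \<partial>lborel)"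
      proof (rule nn_integral_mono)
        fix x :: "real^'n"
        show "indicator {x. 1 \<le> norm x} x * ennreal (norm x powr (- (a + K))) \<le> 2 * ennreal (norm x powr (- a) / weight K x)"
        proof (cases "1 \<le> norm x")
          case True
          have "1 powr K \<le> norm x powr K" using True alpha by (intro powr_mono2) (auto simp: K_def)
          then have xK: "1 \<le> norm x powr K" by simp
          have "norm x powr (- (a + K)) = norm x powr (- a) / norm x powr K" by (simp add: powr_diff)
          also have "\<dots> \<le> norm x powr (- a) * (2 / weight K x)"
          proof -
            have "1 / norm x powr K \<le> 2 / weight K x" using xK by (simp add: divide_simps)
            then have "norm x powr (- a) * (1 / norm x powr K) \<le> norm x powr (- a) * (2 / weight K x)"
              by (rule mult_left_mono) simp
            then show ?thesis by simp
          qed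
          finally have "norm x powr (- (a + K)) \<le> 2 * (norm x powr (- a) / weight K x)" by (simp add: mult.commute)
          then show ?thesis using True xK by (auto intro!: two divide_nonneg_nonneg)
        qed simp
      qed
      then have "(\<integral>\<^sup>+x. indicator {x::real^'n. 1 \<le> norm x} x * ennreal (norm x powr (- (a + K))) \<partial>lborel) < \<infinity>"
        using fin by (rule le_less_trans)
      then show False using aK nn_integral_powr_outside[where 'a = "real^'n" and s = "a + K"] by simp
    next
      case False
      then have p1': "p > 1" using p1 by simp
      have "(p - 1) * real CARD('n) \<le> 2 * \<alpha>" using pc N0 by (simp add: field_simps)
      then have aN: "real CARD('n) \<le> a" using p1' by (simp add: a_def pos_le_divide_eq mult.commute)
      have "(\<integral>\<^sup>+x. indicator (cball (0::real^'n) 1) x * ennreal (norm x powr (- a)) \<partial>lborel)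
         \<le> (\<integral>\<^sup>+x. 2 * ennreal (norm x powr (- a) / weight K (x::real^'n)) \<partial>lborel)"
      proof (rule nn_integral_mono)
        fix x :: "real^'n"
        show "indicator (cball 0 1) x * ennreal (norm x powr (- a)) \<le> 2 * ennreal (norm x powr (- a) / weight K x)"
        proof (cases "norm x \<le> 1")
          case True
          have "norm x powr K \<le> 1" using True alpha powr_mono2[of K "norm x" 1] by (simp add: K_def)
          then have "1 \<le> 2 / weight K x" using weight_pos[of x K] by simp
          then have "norm x powr (- a) * 1 \<le> norm x powr (- a) * (2 / weight K x)"
            by (rule mult_left_mono) simp
          then have "norm x powr (- a) \<le> 2 * (norm x powr (- a) / weight K x)" by (simp add: mult.commute)
          then show ?thesis using True by (auto intro!: two divide_nonneg_nonneg)
        qed simp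
      qed
      then have "(\<integral>\<^sup>+x. indicator (cball (0::real^'n) 1) x * ennreal (norm x powr (- a)) \<partial>lborel) < \<infinity>"
        using fin by (rule le_less_trans)
      then show False using aN nn_integral_powr_inside[where 'a = "real^'n" and s = a] by simp
    qed
  qed
  moreover have "ennreal (norm x powr (- a)) \<noteq> 0" using x by (simp add: ennreal_eq_0_iff not_le)
  ultimately show ?thesis by (simp only: u_infty_power[OF p1 e x] infinity_ennreal_def ennreal_mult_top if_False)
qed

section \<open>The supercritical range\<close>

context
  assumes pc: "p > 1 + 2 * \<alpha> / real CARD('n)"
begin

text \<open>The lower bound on \<open>p\<close> is \<open>a < N\<close> rewritten, and the upper
  bound is \<open>\<sigma> = a + 2 * \<alpha> - N > 0\<close> rewritten; N \<ge> 2 and \<alpha> < 1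
  make N - 2\<alpha> positive.\<close>

lemma supercritical_exponents: "p > 1" "a > 0" "a < real CARD('n)" "\<sigma> > 0" "a * p = a + 2 * \<alpha>"
proof -
  have N0: "real CARD('n) > 0" and N2: "real CARD('n) - 2 * \<alpha> > 0" using N alpha by auto
  have "2 * \<alpha> / real CARD('n) > 0" using alpha N0 by simp
  then show p1: "p > 1" using pc by linarith
  then show "a > 0" using alpha by (simp add: a_def)
  have "2 * \<alpha> / real CARD('n) < p - 1" using pc by simp
  then have "2 * \<alpha> < (p - 1) * real CARD('n)" using N0 by (simp add: pos_divide_less_eq)
  then show "a < real CARD('n)" using p1 by (simp add: a_def pos_divide_less_eq mult.commute)
  show ap: "a * p = a + 2 * \<alpha>" using p1 by (simp add: a_def field_simps)
  have "p * (real CARD('n) - 2 * \<alpha>) < real CARD('n)" using p(2) N2 by (simp add: pos_less_divide_eq)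
  then have "(real CARD('n) - 2 * \<alpha>) * (p - 1) < 2 * \<alpha>" by (simp add: algebra_simps)
  then have "real CARD('n) - 2 * \<alpha> < a" using p1 by (simp add: a_def pos_less_divide_eq)
  then show "\<sigma> > 0" by (simp add: sigma_def ap)
qed

text \<open>
  A bound \<open>u k e \<le> M k\<^sup>s\<close> is improved to \<open>u k e \<le> M k\<^bsup>s / p\<^esup>\<close> with the same \<open>M\<close>, since the
  test identity bounds \<open>(u k e)\<^sup>p\<close> linearly by the mass of \<open>u k\<close>.
\<close>

lemma power_bound_improve:
  assumes e: "norm e = 1"
  shows "\<exists>D\<ge>0. \<forall>M\<ge>0. \<forall>s\<ge>0. \<sigma> * s \<le> a \<longrightarrow> (\<forall>k\<ge>1. u k e \<le> M * k powr s) \<longrightarrow>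
    (\<forall>k\<ge>1. u k e powr p \<le> D * M * k powr s)"
proof -
  note se = supercritical_exponents
  have p1: "p \<noteq> 1" using se(1) by simp
  have e0: "e \<noteq> 0" using e by auto
  obtain A where A: "A \<ge> 0" "\<forall>k>0. \<forall>m\<ge>0. (\<forall>x. 2 \<le> norm x \<and> norm x \<le> 4 \<longrightarrow> m \<le> u k x) \<longrightarrow>
     m powr p \<le> A * (LINT x|lebesgue. u k x / weight K x)"
    using omega_mass_lower by (elim exE conjE) (rule that)
  have wi: "integrable lebesgue (\<lambda>x::real^'n. norm x powr (- a) / weight K x)"
    using powr_omega[OF alpha(1) se(2,3)] by (simp add: omega_integrable_iff K_def)
  have oi: "integrable lebesgue (\<lambda>x::real^'n. 1 / weight K x)"
    using alpha by (intro integrable_weight) (auto simp: K_def)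
  define W where "W = (LINT x|lebesgue. norm (x::real^'n) powr (- a) / weight K x + 1 / weight K x)"
  have W: "W \<ge> 0" unfolding W_def
    by (rule Bochner_Integration.integral_nonneg) (auto intro!: add_nonneg_nonneg divide_nonneg_nonneg)
  have main: "u k e powr p \<le> (4 powr (a * p) * A * W) * M * k powr s"
    if M: "M \<ge> 0" and s: "s \<ge> 0" "\<sigma> * s \<le> a" and bound: "\<And>k. k \<ge> 1 \<Longrightarrow> u k e \<le> M * k powr s" and k: "k \<ge> 1" for M s k
  proof -
    have k0: "k > 0" using k by simp
    have big: "k \<le> k * norm x powr \<sigma>" if "norm x \<ge> 1" for x :: "real^'n"
      using mult_left_mono[OF ge_one_powr_ge_zero[OF that less_imp_le[OF se(4)]] less_imp_le[OF k0]] by simp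
    \<comment> \<open>For \<open>norm x \<ge> 1\<close> the assumed bound is used at the larger mass
      \<open>k * norm x powr \<sigma>\<close>, and \<open>\<sigma> * s \<le> a\<close> keeps the
      power of \<open>norm x\<close> bounded. Inside the unit ball monotonicity in \<open>k\<close>
      suffices and |x|^-a remains, which is \<omega>-integrable.\<close>
    have upper: "u k x \<le> M * k powr s * (norm x powr (- a) + 1)" if x: "x \<noteq> 0" for x
    proof (cases "norm x \<ge> 1")
      case True
      have "u k x = norm x powr (- a) * u (k * norm x powr \<sigma>) e" by (rule u_radial[OF p1 k0 e x])
      also have "\<dots> \<le> norm x powr (- a) * (M * (k * norm x powr \<sigma>) powr s)"
      proof (intro mult_left_mono bound)
        show "1 \<le> k * norm x powr \<sigma>" using big[OF True] k by linarith
      qed simp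
      also have "\<dots> = M * k powr s * norm x powr (\<sigma> * s - a)"
        using k0 by (simp add: powr_mult powr_powr powr_diff powr_minus divide_inverse)
      also have "\<dots> \<le> M * k powr s * 1"
      proof (rule mult_left_mono)
        have "norm x powr (\<sigma> * s - a) \<le> norm x powr 0" using True s by (intro powr_mono) auto
        then show "norm x powr (\<sigma> * s - a) \<le> 1" using x by simp
      qed (use M in simp)
      also have "\<dots> \<le> M * k powr s * (norm x powr (- a) + 1)" using M by (intro mult_left_mono) auto
      finally show ?thesis .
    next
      case False
      have "norm x powr \<sigma> \<le> 1" using False se(4) powr_mono2[of \<sigma> "norm x" 1] by simp
      then have "k * norm x powr \<sigma> \<le> k" using k0 by simp
      moreover have "0 < k * norm x powr \<sigma>" using k0 x by simp
      ultimately have "u (k * norm x powr \<sigma>) e \<le> u k e" using e0 by (intro nondecreasing)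
      also have "\<dots> \<le> M * k powr s" by (rule bound[OF k])
      finally have "norm x powr (- a) * u (k * norm x powr \<sigma>) e \<le> norm x powr (- a) * (M * k powr s)"
        by (rule mult_left_mono) simp
      then have "u k x \<le> M * k powr s * norm x powr (- a)"
        unfolding u_radial[OF p1 k0 e x] by (simp add: mult.commute)
      also have "\<dots> \<le> M * k powr s * (norm x powr (- a) + 1)" using M by (intro mult_left_mono) auto
      finally show ?thesis .
    qed
    have mass: "(LINT x|lebesgue. u k x / weight K x) \<le> M * k powr s * W"
    proof -
      have "(LINT x|lebesgue. u k x / weight K x)
        \<le> (LINT x|lebesgue. M * k powr s * (norm (x::real^'n) powr (- a) / weight K x + 1 / weight K x))"
      proof (rule integral_mono_AE)
        show "integrable lebesgue (\<lambda>x. u k x / weight K x)" by (rule u_omega[OF k0])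
        show "integrable lebesgue (\<lambda>x. M * k powr s * (norm (x::real^'n) powr (- a) / weight K x + 1 / weight K x))"
          by (intro integrable_mult_right Bochner_Integration.integrable_add wi oi)
        show "AE x in lebesgue. u k x / weight K x \<le> M * k powr s * (norm (x::real^'n) powr (- a) / weight K x + 1 / weight K x)"
          using AE_neq_zero
        proof eventually_elim
          case (elim x)
          have "u k x / weight K x \<le> (M * k powr s * (norm x powr (- a) + 1)) / weight K x"
            by (intro divide_right_mono upper[OF elim] less_imp_le[OF weight_pos])
          then show ?case by (simp add: add_divide_distrib[symmetric])
        qed
      qed
      also have "\<dots> = M * k powr s * W" unfolding W_def by (rule integral_mult_right_zero)
      finally show ?thesis .
    qed
    \<comment> \<open>On the annulus the rescaled mass is at least \<open>k\<close>, so the value at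
      \<open>e\<close> is a lower bound up to \<open>4 powr (- a)\<close>.\<close>
    have lower: "4 powr (- a) * u k e \<le> u k x" if x: "2 \<le> norm x" "norm x \<le> 4" for x
    proof -
      have x0: "x \<noteq> 0" using x by auto
      have "u k e \<le> u (k * norm x powr \<sigma>) e" using big[of x] x k0 e0 by (intro nondecreasing) auto
      moreover have "4 powr (- a) \<le> norm x powr (- a)" using x se(2) by (intro powr_mono2') auto
      ultimately have "4 powr (- a) * u k e \<le> norm x powr (- a) * u (k * norm x powr \<sigma>) e"
        using u_nonneg[OF k0, of e] by (intro mult_mono) auto
      then show ?thesis unfolding u_radial[OF p1 k0 e x0] .
    qed
    have m: "0 \<le> 4 powr (- a) * u k e" using u_nonneg[OF k0, of e] by simp
    have "(4 powr (- a) * u k e) powr p \<le> A * (LINT x|lebesgue. u k x / weight K x)"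
      by (rule A(2)[rule_format, OF k0 m]) (use lower in auto)
    also have "\<dots> \<le> A * (M * k powr s * W)" using mass A(1) by (rule mult_left_mono)
    finally have low: "(4 powr (- a) * u k e) powr p \<le> A * (M * k powr s * W)" .
    have "u k e powr p = 4 powr (a * p) * (4 powr (- a) * u k e) powr p"
    proof -
      have "(4 powr (- a) * u k e) powr p = 4 powr (- (a * p)) * u k e powr p"
        using u_nonneg[OF k0, of e] by (simp add: powr_mult powr_powr)
      then show ?thesis by (simp add: powr_minus)
    qed
    also have "\<dots> \<le> 4 powr (a * p) * (A * (M * k powr s * W))" using low by (rule mult_left_mono) simp
    finally show ?thesis by (simp only: ac_simps)
  qed
  show ?thesis
    using main A(1) W by (intro exI[of _ "4 powr (a * p) * A * W"]) auto
qed

text \<open>Choose \<open>R \<ge> 1\<close> beyond which \<open>u 1 < 1\<close>, and put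
  \<open>r = k powr (1 / \<sigma>) * R\<close>. Then \<open>k \<le> r powr \<sigma>\<close>, so by
  monotonicity and scaling \<open>u k e \<le> r powr a * u 1 (r *\<^sub>R e) \<le> r powr a\<close>.
  The exponent \<open>a / \<sigma>\<close> is the largest that \<open>power_bound_improve\<close>
  admits.\<close>

lemma u_initial_bound:
  assumes e: "norm e = 1"
  shows "\<exists>M\<ge>0. \<forall>k\<ge>1. u k e \<le> M * k powr (a / \<sigma>)"
proof -
  note se = supercritical_exponents
  have p1: "p \<noteq> 1" using se(1) by simp
  have e0: "e \<noteq> 0" using e by auto
  have "(u 1 \<longlongrightarrow> 0) at_infinity" using weak[of 1] by (simp add: weak_solution_def)
  then have "\<forall>\<^sub>F x in at_infinity. u 1 x < 1" by (rule order_tendstoD) simp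
  then obtain R0 where R0: "\<And>x. norm x \<ge> R0 \<Longrightarrow> u 1 x < 1" by (auto simp: eventually_at_infinity)
  define R where "R = max R0 1"
  have R: "R \<ge> 1" "R \<ge> R0" by (auto simp: R_def)
  have "u k e \<le> R powr a * k powr (a / \<sigma>)" if k: "k \<ge> 1" for k
  proof -
    define r where "r = k powr (1 / \<sigma>) * R"
    have k1: "k powr (1 / \<sigma>) \<ge> 1" using k se(4) by (intro ge_one_powr_ge_zero) auto
    have "1 * R \<le> r" unfolding r_def using k1 R by (intro mult_right_mono) auto
    then have r: "r \<ge> 1" "r \<ge> R0" using R by auto
    have "k powr (1 / \<sigma>) * 1 \<le> r" unfolding r_def using k1 R by (intro mult_left_mono) auto
    then have "(k powr (1 / \<sigma>)) powr \<sigma> \<le> r powr \<sigma>" using se(4) by (intro powr_mono2) auto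
    moreover have "(k powr (1 / \<sigma>)) powr \<sigma> = k" using se(4) k by (simp add: powr_powr)
    ultimately have kr: "k \<le> r powr \<sigma>" by simp
    have "u k e \<le> u (r powr \<sigma>) e" using kr k e0 by (intro nondecreasing) auto
    also have "\<dots> = r powr a * u 1 (r *\<^sub>R e)"
      using u_radial[OF p1 zero_less_one e, of "r *\<^sub>R e"] r e e0 by (simp add: powr_minus)
    also have "\<dots> \<le> r powr a * 1"
    proof (rule mult_left_mono)
      have "norm (r *\<^sub>R e) \<ge> R0" using r e by simp
      from R0[OF this] show "u 1 (r *\<^sub>R e) \<le> 1" by simp
    qed simp
    also have "\<dots> = R powr a * k powr (a / \<sigma>)"
      using R by (simp add: r_def powr_mult powr_powr)
    finally show ?thesis .
  qed
  then show ?thesis by (intro exI[of _ "R powr a"]) auto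
qed

text \<open>The choice \<open>D \<le> M powr (p - 1)\<close> gives
  \<open>D * M \<le> M powr p\<close>, so taking p-th roots reproduces \<open>M\<close> while the
  exponent of \<open>k\<close> is divided by \<open>p\<close>. The exponents
  \<open>a / \<sigma> / p ^ n\<close> tend to 0, which leaves the bound \<open>M\<close>; masses
  below 1 follow by monotonicity.\<close>

lemma u_bounded:
  assumes e: "norm e = 1"
  shows "\<exists>M. \<forall>k>0. u k e \<le> M"
proof -
  note se = supercritical_exponents
  have e0: "e \<noteq> 0" using e by auto
  obtain D where D: "D \<ge> 0" "\<forall>M\<ge>0. \<forall>s\<ge>0. \<sigma> * s \<le> a \<longrightarrow> (\<forall>k\<ge>1. u k e \<le> M * k powr s) \<longrightarrow>
    (\<forall>k\<ge>1. u k e powr p \<le> D * M * k powr s)"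
    using power_bound_improve[OF e] by (elim exE conjE) (rule that)
  obtain M0 where M0: "M0 \<ge> 0" "\<And>k. k \<ge> 1 \<Longrightarrow> u k e \<le> M0 * k powr (a / \<sigma>)"
    using u_initial_bound[OF e] by blast
  define M where "M = max M0 (max 1 (D powr (1 / (p - 1))))"
  have M: "M \<ge> 1" "M \<ge> M0" "M \<ge> D powr (1 / (p - 1))" by (auto simp: M_def)
  have DM: "D \<le> M powr (p - 1)"
  proof -
    have "D = (D powr (1 / (p - 1))) powr (p - 1)" using D(1) se(1) by (simp add: powr_powr)
    also have "\<dots> \<le> M powr (p - 1)" using M(3) se(1) by (intro powr_mono2) auto
    finally show ?thesis .
  qed
  have iter: "\<forall>k\<ge>1. u k e \<le> M * k powr (a / \<sigma> / p ^ n)" for n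
  proof (induction n)
    case 0
    have "M0 * k powr (a / \<sigma>) \<le> M * k powr (a / \<sigma>)" for k using M(2) by (rule mult_right_mono) simp
    then show ?case using M0(2) by (auto intro: order_trans)
  next
    case (Suc n)
    let ?s = "a / \<sigma> / p ^ n"
    have s0: "?s \<ge> 0" using se by simp
    have "a / p ^ n \<le> a / 1" using se one_le_power[of p n] by (intro divide_left_mono) auto
    then have s1: "\<sigma> * ?s \<le> a" using se by simp
    show ?case
    proof (intro allI impI)
      fix k :: real assume k: "k \<ge> 1"
      have "u k e powr p \<le> D * M * k powr ?s"
        using D(2)[rule_format, of M ?s k] Suc.IH s0 s1 M(1) k by auto
      also have "\<dots> \<le> M powr (p - 1) * M * k powr ?s"
        using DM M(1) by (intro mult_right_mono) auto
      also have "M powr (p - 1) * M = M powr p" using M(1) powr_add[of M "p - 1" 1] by simp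
      also have "M powr p * k powr ?s = (M * k powr (a / \<sigma> / p ^ Suc n)) powr p"
        using M(1) k se(1) by (simp add: powr_mult powr_powr)
      finally have le: "u k e powr p \<le> (M * k powr (a / \<sigma> / p ^ Suc n)) powr p" .
      show "u k e \<le> M * k powr (a / \<sigma> / p ^ Suc n)"
      proof (rule ccontr)
        assume "\<not> u k e \<le> M * k powr (a / \<sigma> / p ^ Suc n)"
        then have "(M * k powr (a / \<sigma> / p ^ Suc n)) powr p < u k e powr p"
          using M(1) p(1) by (intro powr_less_mono2) auto
        with le show False by simp
      qed
    qed
  qed
  have ge1: "u k e \<le> M" if k: "k \<ge> 1" for k
  proof -
    have "(\<lambda>n. a / \<sigma> / p ^ n) \<longlonglongrightarrow> 0" using se(1) by (rule LIMSEQ_divide_realpow_zero)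
    then have "(\<lambda>n. M * k powr (a / \<sigma> / p ^ n)) \<longlonglongrightarrow> M * k powr 0"
      using k by (intro tendsto_intros) auto
    then have "u k e \<le> M * k powr 0"
      by (rule LIMSEQ_le_const) (use iter k in blast)
    then show ?thesis using k by simp
  qed
  have "u k e \<le> M" if k: "k > 0" for k
  proof (cases "k \<ge> 1")
    case False
    then have "u k e \<le> u 1 e" using k e0 by (intro nondecreasing) auto
    with ge1[of 1] show ?thesis by simp
  qed (rule ge1)
  then show ?thesis by blast
qed

text \<open>Each \<open>u k\<close> is below \<open>c * norm x powr (- a)\<close>, and
  \<open>a < N\<close> makes this \<omega>-integrable, so dominated convergence carries the test
  identity to the limit. Comparing with \<open>powr_lap_weak\<close> determines \<open>l0\<close>,
  and a single test function suffices since \<open>l0\<close> is the only unknown.\<close>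

lemma supercritical_limit:
  "\<exists>c>0. (\<forall>x. x \<noteq> 0 \<longrightarrow> u_infty u x = ennreal (c * norm x powr (- a))) \<and>
     classical_solution \<alpha> p (\<lambda>x. c * norm (x::real^'n) powr (- a))"
proof -
  note se = supercritical_exponents
  have p1: "p \<noteq> 1" using se(1) by simp
  obtain e :: "real^'n" where e: "norm e = 1" using vector_choose_size[of 1] by auto
  have e0: "e \<noteq> 0" using e by auto
  obtain M where M: "\<And>k. k > 0 \<Longrightarrow> u k e \<le> M" using u_bounded[OF e] by blast
  have "(SUP k\<in>{0<..}. ennreal (u k e)) \<le> ennreal M"
    by (rule SUP_least) (auto intro: ennreal_leI M)
  then have "(SUP k\<in>{0<..}. ennreal (u k e)) < \<infinity>" by (rule le_less_trans) simp
  then obtain c where c: "(SUP k\<in>{0<..}. ennreal (u k e)) = ennreal c" "c \<ge> 0"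
    by (cases "SUP k\<in>{0<..}. ennreal (u k e)") auto
  have "0 < u 1 e" by (rule u_positive) (use e0 in auto)
  also have "u 1 e \<le> c * norm e powr (- a)" by (rule u_seq_tendsto(2)[OF p1 e e0 c]) simp
  finally have cpos: "c > 0" using e by simp
  have lim: "u_infty u x = ennreal (c * norm x powr (- a))" if "x \<noteq> 0" for x
    using u_infty_power[OF p1 e that] c by (simp add: ennreal_mult mult.commute)
  let ?w = "\<lambda>x::real^'n. norm x powr (- a)"
  obtain \<xi> :: "real^'n \<Rightarrow> real" and C where xi: "\<xi> \<in> test_functions \<alpha>" and xm: "\<xi> \<in> borel_measurable borel"
    and x01: "\<And>x. 0 \<le> \<xi> x" "\<And>x. \<xi> x \<le> 1" and supp: "\<And>x. \<xi> x \<noteq> 0 \<Longrightarrow> 2 \<le> norm x \<and> norm x \<le> 4"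
    and I: "\<And>b. integrable lebesgue (\<lambda>x. norm x powr b * \<xi> x)" "\<And>b. 0 < (LINT x|lebesgue. norm x powr b * \<xi> x)"
    and Ceps: "\<And>\<epsilon> x. \<epsilon> \<in> {0<..1} \<Longrightarrow> \<bar>frac_lap_eps \<alpha> \<epsilon> \<xi> x\<bar> \<le> C / weight K x"
    and C: "\<And>x. \<bar>frac_lap \<alpha> \<xi> x\<bar> \<le> C / weight K x"
    by (rule annulus_bump) (rule that)
  obtain l0 where ex: "\<And>x::real^'n. x \<noteq> 0 \<Longrightarrow> frac_lap_exists \<alpha> ?w x"
    and lap: "\<And>x::real^'n. x \<noteq> 0 \<Longrightarrow> frac_lap \<alpha> ?w x = l0 * norm x powr (- (a + 2 * \<alpha>))"
    and weak_w: "(LINT x|lebesgue. ?w x * frac_lap \<alpha> \<xi> x) = l0 * (LINT x|lebesgue. norm x powr (- (a + 2 * \<alpha>)) * \<xi> x)"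
  proof (rule powr_lap_weak[OF alpha se(2,3)], goal_cases)
    case (1 l0)
    show ?case
    proof (rule that[OF 1(2,3)])
      show "(LINT x|lebesgue. ?w x * frac_lap \<alpha> \<xi> x) = l0 * (LINT x|lebesgue. norm x powr (- (a + 2 * \<alpha>)) * \<xi> x)"
        by (rule 1(4)[OF xi xm, of 4 C]) (use x01 supp Ceps in \<open>force simp: K_def\<close>)+
    qed
  qed
  define J where "J = (LINT x|lebesgue. norm x powr (- (a + 2 * \<alpha>)) * \<xi> x)"
  have J: "J > 0" unfolding J_def by (rule I(2))
  have wL: "(LINT x|lebesgue. ?w x * frac_lap \<alpha> \<xi> x) = l0 * J"
    unfolding J_def by (rule weak_w)
  have cw: "(c * ?w x) powr p = c powr p * norm x powr (- (a + 2 * \<alpha>))" for x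
    using cpos se(5) by (simp add: powr_mult powr_powr)
  have wi: "integrable lebesgue (\<lambda>x. ?w x / weight K x)"
    using powr_omega[OF alpha(1) se(2,3)] by (simp add: omega_integrable_iff K_def)
  have xex: "frac_lap_exists \<alpha> \<xi> x" for x using xi by (simp add: test_functions_def)
  have Lm [measurable]: "frac_lap \<alpha> \<xi> \<in> borel_measurable lebesgue" and [measurable]: "\<xi> \<in> borel_measurable lebesgue"
    using frac_lap_measurable[OF xm xex] xm by (auto intro: measurable_completion)
  have wm [measurable]: "?w \<in> borel_measurable lebesgue" by (rule measurable_completion) simp
  have wLb: "\<bar>?w x * frac_lap \<alpha> \<xi> x\<bar> \<le> C * (?w x / weight K x)" for x
  proof -
    have "?w x * \<bar>frac_lap \<alpha> \<xi> x\<bar> \<le> ?w x * (C / weight K x)" by (intro mult_left_mono C) simp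
    then show ?thesis by (simp add: abs_mult mult.commute)
  qed
  have wLi: "integrable lebesgue (\<lambda>x. ?w x * frac_lap \<alpha> \<xi> x)"
  proof (rule Bochner_Integration.integrable_bound[OF integrable_mult_right[of C, OF wi]])
    show "AE x in lebesgue. norm (?w x * frac_lap \<alpha> \<xi> x) \<le> norm (C * (?w x / weight K x))"
      unfolding real_norm_def by (intro AE_I2 order_trans[OF wLb abs_ge_self])
  qed measurable
  define f where "f n x = u (real (Suc n)) x * frac_lap \<alpha> \<xi> x + u (real (Suc n)) x powr p * \<xi> x" for n x
  let ?F = "\<lambda>x. c * (?w x * frac_lap \<alpha> \<xi> x) + c powr p * (norm x powr (- (a + 2 * \<alpha>)) * \<xi> x)"
  let ?G = "\<lambda>x. c * (C * (?w x / weight K x)) + c powr p * (norm x powr (- (a + 2 * \<alpha>)) * \<xi> x)"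
  have Gi: "integrable lebesgue ?G" by (intro Bochner_Integration.integrable_add integrable_mult_right wi I(1))
  have Fi1: "integrable lebesgue (\<lambda>x. c * (?w x * frac_lap \<alpha> \<xi> x))" by (intro integrable_mult_right wLi)
  have Fi2: "integrable lebesgue (\<lambda>x. c powr p * (norm x powr (- (a + 2 * \<alpha>)) * \<xi> x))" by (intro integrable_mult_right I(1))
  have fn0: "integral\<^sup>L lebesgue (f n) = 0" and fni: "f n \<in> borel_measurable lebesgue" for n
  proof -
    have k: "real (Suc n) > 0" by simp
    note T = u_test_integrable[OF k xi xm x01 supp C]
    show "integral\<^sup>L lebesgue (f n) = 0"
      unfolding f_def using Bochner_Integration.integral_add[OF T(1,2)] T(3) by simp
    show "f n \<in> borel_measurable lebesgue"
      unfolding f_def by (intro borel_measurable_integrable Bochner_Integration.integrable_add T(1,2))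
  qed
  have "(\<lambda>n. integral\<^sup>L lebesgue (f n)) \<longlonglongrightarrow> integral\<^sup>L lebesgue ?F"
  proof (rule integral_dominated_convergence[OF _ fni Gi])
    show "?F \<in> borel_measurable lebesgue"
      by (intro borel_measurable_integrable Bochner_Integration.integrable_add Fi1 Fi2)
    show "AE x in lebesgue. (\<lambda>n. f n x) \<longlonglongrightarrow> ?F x"
      using AE_neq_zero
    proof eventually_elim
      case (elim x)
      \<comment> \<open>A nonzero limit of the base is needed for convergence of the
        \<open>p\<close>-th powers.\<close>
      have cx: "c * ?w x \<noteq> 0" using cpos elim by simp
      have "(\<lambda>n. f n x) \<longlonglongrightarrow> c * ?w x * frac_lap \<alpha> \<xi> x + (c * ?w x) powr p * \<xi> x"
        unfolding f_def using u_seq_tendsto(1)[OF p1 e elim c] cx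
        by (intro tendsto_add tendsto_mult tendsto_powr tendsto_const)
      then show ?case unfolding cw by (simp only: mult.assoc)
    qed
    show "AE x in lebesgue. norm (f n x) \<le> ?G x" for n
      using AE_neq_zero
    proof eventually_elim
      case (elim x)
      have k: "real (Suc n) > 0" by simp
      note u0 = u_nonneg[OF k, of x] and uw = u_seq_tendsto(2)[OF p1 e elim c k]
      have "\<bar>u (real (Suc n)) x * frac_lap \<alpha> \<xi> x\<bar> = u (real (Suc n)) x * \<bar>frac_lap \<alpha> \<xi> x\<bar>"
        using u0 by (simp add: abs_mult)
      also have "\<dots> \<le> (c * ?w x) * \<bar>frac_lap \<alpha> \<xi> x\<bar>" by (intro mult_right_mono uw) simp
      also have "\<dots> = c * \<bar>?w x * frac_lap \<alpha> \<xi> x\<bar>" by (simp add: abs_mult)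
      also have "\<dots> \<le> c * (C * (?w x / weight K x))" using cpos by (intro mult_left_mono wLb) simp
      finally have 1: "\<bar>u (real (Suc n)) x * frac_lap \<alpha> \<xi> x\<bar> \<le> c * (C * (?w x / weight K x))" .
      have "u (real (Suc n)) x powr p * \<xi> x \<le> (c * ?w x) powr p * \<xi> x"
        using p(1) by (intro mult_right_mono powr_mono2 u0 uw x01) simp
      then have 2: "u (real (Suc n)) x powr p * \<xi> x \<le> c powr p * (norm x powr (- (a + 2 * \<alpha>)) * \<xi> x)"
        unfolding cw by (simp only: mult.assoc)
      have 3: "0 \<le> u (real (Suc n)) x powr p * \<xi> x" using x01(1) by simp
      show "norm (f n x) \<le> ?G x" unfolding f_def real_norm_def using 1 2 3 by linarith
    qed
  qed
  then have "integral\<^sup>L lebesgue ?F = 0" unfolding fn0 by (rule LIMSEQ_unique[OF _ tendsto_const])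
  moreover have "integral\<^sup>L lebesgue ?F = c * (l0 * J) + c powr p * J"
    unfolding Bochner_Integration.integral_add[OF Fi1 Fi2] integral_mult_right_zero wL J_def ..
  \<comment> \<open>Positivity of \<open>J\<close> allows it to be cancelled; what remains is the
    equation for \<open>c * norm x powr (- a)\<close> with the common factor
    \<open>norm x powr (- (a + 2 * \<alpha>))\<close> removed.\<close>
  ultimately have "(c * l0 + c powr p) * J = 0" by (simp add: algebra_simps)
  then have c0: "c * l0 + c powr p = 0" using J by simp
  have "classical_solution \<alpha> p (\<lambda>x. c * ?w x)"
    unfolding classical_solution_def
  proof (intro conjI allI impI)
    show "continuous_on (- {0}) (\<lambda>x. c * ?w x)" by (intro continuous_intros) auto
    fix x :: "real^'n" assume x: "x \<noteq> 0"
    show "frac_lap_exists \<alpha> (\<lambda>x. c * ?w x) x" by (rule frac_lap_exists_cmult[OF ex[OF x]])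
    have "frac_lap \<alpha> (\<lambda>x. c * ?w x) x + (c * ?w x) powr p = (c * l0 + c powr p) * norm x powr (- (a + 2 * \<alpha>))"
      unfolding frac_lap_cmult[OF ex[OF x]] lap[OF x] cw by (simp only: distrib_right mult.assoc)
    then show "frac_lap \<alpha> (\<lambda>x. c * ?w x) x + (c * ?w x) powr p = 0" by (simp add: c0)
  qed
  with lim cpos show ?thesis by blast
qed

end

end

theorem theorem1p4:
  fixes \<alpha> p :: real and u :: "real \<Rightarrow> real^'n \<Rightarrow> real"
  assumes N: "CARD('n) \<ge> 2"
    and alpha: "0 < \<alpha>" "\<alpha> < 1"
    and p: "0 < p" "p < real CARD('n) / (real CARD('n) - 2 * \<alpha>)"
    and weak: "\<And>k. k > 0 \<Longrightarrow> weak_solution \<alpha> p k (u k)"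
    and unique: "\<And>k v. k > 0 \<Longrightarrow> weak_solution \<alpha> p k v \<Longrightarrow> AE x in lebesgue. v x = u k x"
    and classical: "\<And>k. k > 0 \<Longrightarrow> classical_solution \<alpha> p (u k)"
    and nondecreasing: "\<And>k l x. 0 < k \<Longrightarrow> k \<le> l \<Longrightarrow> x \<noteq> 0 \<Longrightarrow> u k x \<le> u l x"
  shows "(\<forall>x. ((\<lambda>k. pointwise_value (u k) x) \<longlongrightarrow> u_infty u x) at_top) \<and>
    (p \<le> 1 + 2 * \<alpha> / real CARD('n) \<longrightarrow> (\<forall>x. u_infty u x = \<infinity>)) \<and>
    (p > 1 + 2 * \<alpha> / real CARD('n) \<longrightarrow>
       classical_solution \<alpha> p (\<lambda>x. enn2real (u_infty u x)) \<and>
       (\<exists>c\<^sub>3>0. \<forall>x. x \<noteq> 0 \<longrightarrow> u_infty u x = ennreal (c\<^sub>3 * norm x powr (- (2 * \<alpha> / (p - 1))))))"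
proof -
  interpret weak_solution_family \<alpha> p "real CARD('n) + 2 * \<alpha>" "2 * \<alpha> / (p - 1)"
    "2 * \<alpha> / (p - 1) * p - real CARD('n)" u
    by (unfold_locales; (rule refl | fact))
  have "classical_solution \<alpha> p (\<lambda>x. enn2real (u_infty u x)) \<and>
       (\<exists>c\<^sub>3>0. \<forall>x. x \<noteq> 0 \<longrightarrow> u_infty u x = ennreal (c\<^sub>3 * norm x powr (- (2 * \<alpha> / (p - 1)))))"
    if pc: "p > 1 + 2 * \<alpha> / real CARD('n)"
  proof -
    obtain c where c: "c > 0" "\<And>x. x \<noteq> 0 \<Longrightarrow> u_infty u x = ennreal (c * norm x powr (- (2 * \<alpha> / (p - 1))))"
      and cl: "classical_solution \<alpha> p (\<lambda>x::real^'n. c * norm x powr (- (2 * \<alpha> / (p - 1))))"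
      using supercritical_limit[OF pc] by blast
    \<comment> \<open>The functions agree at the origin too:
      \<open>enn2real \<infinity> = 0\<close>, and 0 to any power under \<open>powr\<close> is
      0.\<close>
    have "(\<lambda>x. enn2real (u_infty u x)) = (\<lambda>x. c * norm x powr (- (2 * \<alpha> / (p - 1))))"
    proof
      fix x
      show "enn2real (u_infty u x) = c * norm x powr (- (2 * \<alpha> / (p - 1)))"
        using c by (cases "x = 0") (simp_all add: u_infty_zero)
    qed
    with c cl show ?thesis by auto
  qed
  then show ?thesis using u_infty_tendsto subcritical_infinite by blast
qed

end
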